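(* Let $R$ be a ring with unity, let $\mathcal{X}$ be a semibrick of left $R$-modules and let $Y$ be a left $R$-module. For a short exact sequence $$0\to Y\xrightarrow{\alpha}M\xrightarrow{\beta}\bigoplus_{X\in\mathcal{X}}X^{(I_X)}\to0$$ (with index sets $I_X$, $X\in\mathcal{X}$) the following statements are equivalent: (i) The sequence is $\mathcal{X}$-universal. (ii) For every $X'\in\mathcal{X}$, the connecting homomorphism $\delta:\mathrm{Hom}(X',\bigoplus_{X\in\mathcal{X}}X^{(I_X)})\to\mathrm{Ext}^1(X',Y)$ is an isomorphism.
   Context: A brick is a finitely presented left $R$-module whose endomorphism ring is a division ring. A semibrick is a class $\mathcal{X}$ of pairwise non-isomorphic bricks with $\mathrm{Hom}(X,X')=0$ for distinct $X,X'\in\mathcal{X}$. $\mathcal{X}$-universal sequences: for each $X\in\mathcal{X}$, $\mathrm{Ext}^1(X,Y)$ is a left $\mathrm{End}(X)$-module (endomorphisms act by pull-back; compositions are written from left to right). Choose a basis $(0\to Y\to M_{X,i}\to X\to 0)_{i\in I_X}$ of it over the division ring $\mathrm{End}(X)$. The $\mathcal{X}$-universal short exact sequence starting from $Y$ for this choice of bases is the push-out $0\to Y\to M\to\bigoplus_{X\in\mathcal{X}}X^{(I_X)}\to 0$ of the direct sum sequence $0\to\bigoplus_{X}Y^{(I_X)}\to\bigoplus_{X,i}M_{X,i}\to\bigoplus_{X}X^{(I_X)}\to 0$ along the summation map $\bigoplus_X Y^{(I_X)}\to Y$. A short exact sequence $0\to Y\to M\to\bigoplus_{X\in\mathcal{X}}X^{(I_X)}\to0$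 is $\mathcal{X}$-universal if it is (equivalent to) the sequence obtained in this way from some choice of bases indexed by the sets $I_X$. *)

theory Defs
  imports "HOL-Algebra.AbelCoset" "HOL-Algebra.Module" "HOL-Algebra.Free_Abelian_Groups"
begin

section \<open>Left modules over an arbitrary ring\<close>

text \<open>
  The library locale \<open>module\<close> is restricted to commutative rings of scalars. Its record type is
  reused here; as in the library, the fields \<open>mult\<close> and \<open>one\<close> of a module carry no meaning.
\<close>

locale left_module = R?: ring R + M?: abelian_group M
  for R :: "('r, 'e) ring_scheme" (structure) and M :: "('r, 'm, 'f) module_scheme" (structure) +
  assumes smult_closed:
      "\<lbrakk>a \<in> carrier R; x \<in> carrier M\<rbrakk> \<Longrightarrow> a \<odot>\<^bsub>M\<^esub> x \<in> carrier M"
    and smult_l_distr: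
      "\<lbrakk>a \<in> carrier R; b \<in> carrier R; x \<in> carrier M\<rbrakk>
        \<Longrightarrow> (a \<oplus>\<^bsub>R\<^esub> b) \<odot>\<^bsub>M\<^esub> x = a \<odot>\<^bsub>M\<^esub> x \<oplus>\<^bsub>M\<^esub> b \<odot>\<^bsub>M\<^esub> x"
    and smult_r_distr:
      "\<lbrakk>a \<in> carrier R; x \<in> carrier M; y \<in> carrier M\<rbrakk>
        \<Longrightarrow> a \<odot>\<^bsub>M\<^esub> (x \<oplus>\<^bsub>M\<^esub> y) = a \<odot>\<^bsub>M\<^esub> x \<oplus>\<^bsub>M\<^esub> a \<odot>\<^bsub>M\<^esub> y"
    and smult_assoc1:
      "\<lbrakk>a \<in> carrier R; b \<in> carrier R; x \<in> carrier M\<rbrakk>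
        \<Longrightarrow> (a \<otimes>\<^bsub>R\<^esub> b) \<odot>\<^bsub>M\<^esub> x = a \<odot>\<^bsub>M\<^esub> (b \<odot>\<^bsub>M\<^esub> x)"
    and smult_one:
      "x \<in> carrier M \<Longrightarrow> \<one>\<^bsub>R\<^esub> \<odot>\<^bsub>M\<^esub> x = x"

definition mod_hom ::
    "('r, 'e) ring_scheme \<Rightarrow> ('r, 'm) module \<Rightarrow> ('r, 'n) module \<Rightarrow> ('m \<Rightarrow> 'n) set" where
  "mod_hom R M N =
    {h \<in> hom (add_monoid M) (add_monoid N).
      \<forall>r\<in>carrier R. \<forall>x\<in>carrier M. h (r \<odot>\<^bsub>M\<^esub> x) = r \<odot>\<^bsub>N\<^esub> h x}"

definition mod_iso ::
    "('r, 'e) ring_scheme \<Rightarrow> ('r, 'm) module \<Rightarrow> ('r, 'n) module \<Rightarrow> ('m \<Rightarrow> 'n) set" where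
  "mod_iso R M N = {h \<in> mod_hom R M N. bij_betw h (carrier M) (carrier N)}"

text \<open>
  Elements of the Hom groups are taken to be extensional, so that two homomorphisms are equal
  as HOL functions iff they agree on the carrier of the domain.
\<close>

definition Hom_group ::
    "('r, 'e) ring_scheme \<Rightarrow> ('r, 'm) module \<Rightarrow> ('r, 'n) module \<Rightarrow> ('m \<Rightarrow> 'n) monoid" where
  "Hom_group R M N =
    \<lparr>carrier = mod_hom R M N \<inter> extensional (carrier M),
     monoid.mult = (\<lambda>f g. \<lambda>x\<in>carrier M. f x \<oplus>\<^bsub>N\<^esub> g x),
     one = (\<lambda>x\<in>carrier M. \<zero>\<^bsub>N\<^esub>)\<rparr>"

text \<open>Compositions are written from left to right: \<open>f \<otimes> g\<close> is ``first \<open>f\<close>, then \<open>g\<close>''.\<close>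

definition End_ring ::
    "('r, 'e) ring_scheme \<Rightarrow> ('r, 'm) module \<Rightarrow> ('m \<Rightarrow> 'm) ring" where
  "End_ring R M =
    \<lparr>carrier = carrier (Hom_group R M M),
     monoid.mult = (\<lambda>f g. compose (carrier M) g f),
     one = (\<lambda>x\<in>carrier M. x),
     ring.zero = \<one>\<^bsub>Hom_group R M M\<^esub>,
     add = monoid.mult (Hom_group R M M)\<rparr>"

definition division_ring :: "('a, 'e) ring_scheme \<Rightarrow> bool" where
  "division_ring D \<longleftrightarrow>
    ring D \<and> \<one>\<^bsub>D\<^esub> \<noteq> \<zero>\<^bsub>D\<^esub> \<and> Units D = carrier D - {\<zero>\<^bsub>D\<^esub>}"


subsection \<open>Constructions\<close>

text \<open>The module with a given (multiplicatively written) additive group and scalar action.\<close>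

definition module_of :: "'m monoid \<Rightarrow> ('r \<Rightarrow> 'm \<Rightarrow> 'm) \<Rightarrow> ('r, 'm) module" where
  "module_of G s =
    \<lparr>carrier = carrier G, monoid.mult = undefined, one = undefined,
     ring.zero = \<one>\<^bsub>G\<^esub>, add = monoid.mult G, smult = s\<rparr>"

definition regular_module :: "('r, 'e) ring_scheme \<Rightarrow> ('r, 'r) module" where
  "regular_module R =
    \<lparr>carrier = carrier R, monoid.mult = undefined, one = undefined,
     ring.zero = \<zero>\<^bsub>R\<^esub>, add = add R, smult = monoid.mult R\<rparr>"

text \<open>External direct sum: functions of finite support, extensional on the index set.\<close>

definition direct_sum :: "'k set \<Rightarrow> ('k \<Rightarrow> ('r, 'm) module) \<Rightarrow> ('r, 'k \<Rightarrow> 'm) module" where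
  "direct_sum K A =
    module_of (sum_group K (\<lambda>k. add_monoid (A k))) (\<lambda>r f. \<lambda>k\<in>K. r \<odot>\<^bsub>A k\<^esub> f k)"

definition binary_sum :: "('r, 'm) module \<Rightarrow> ('r, 'n) module \<Rightarrow> ('r, 'm \<times> 'n) module" where
  "binary_sum M N =
    module_of (add_monoid M \<times>\<times> add_monoid N) (\<lambda>r (x, y). (r \<odot>\<^bsub>M\<^esub> x, r \<odot>\<^bsub>N\<^esub> y))"

definition quotient_module :: "('r, 'm) module \<Rightarrow> 'm set \<Rightarrow> ('r, 'm set) module" where
  "quotient_module M N =
    module_of (M A_Mod N) (\<lambda>r C. \<Union>x\<in>C. N +>\<^bsub>M\<^esub> (r \<odot>\<^bsub>M\<^esub> x))"

definition summation_map :: "'k set \<Rightarrow> ('r, 'm) module \<Rightarrow> ('k \<Rightarrow> 'm) \<Rightarrow> 'm" where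
  "summation_map K Y f = gfinprod (add_monoid Y) f K"


section \<open>Bricks and semibricks\<close>

definition finitely_presented :: "('r, 'e) ring_scheme \<Rightarrow> ('r, 'm) module \<Rightarrow> bool" where
  "finitely_presented R M \<longleftrightarrow> left_module R M \<and>
    (\<exists>(m::nat) (n::nat).
      \<exists>f \<in> mod_hom R (direct_sum {..<m} (\<lambda>_. regular_module R))
                       (direct_sum {..<n} (\<lambda>_. regular_module R)).
      \<exists>g \<in> mod_hom R (direct_sum {..<n} (\<lambda>_. regular_module R)) M.
        f ` carrier (direct_sum {..<m} (\<lambda>_. regular_module R))
          = a_kernel (direct_sum {..<n} (\<lambda>_. regular_module R)) M g \<and>
        g ` carrier (direct_sum {..<n} (\<lambda>_. regular_module R)) = carrier M)"

definition brick :: "('r, 'e) ring_scheme \<Rightarrow> ('r, 'm) module \<Rightarrow> bool" where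
  "brick R X \<longleftrightarrow> finitely_presented R X \<and> division_ring (End_ring R X)"

definition semibrick :: "('r, 'e) ring_scheme \<Rightarrow> ('r, 'x) module set \<Rightarrow> bool" where
  "semibrick R \<X> \<longleftrightarrow>
    (\<forall>X\<in>\<X>. brick R X) \<and>
    (\<forall>X\<in>\<X>. \<forall>X'\<in>\<X>. X \<noteq> X' \<longrightarrow>
      mod_iso R X X' = {} \<and> carrier (Hom_group R X X') = {\<one>\<^bsub>Hom_group R X X'\<^esub>})"


section \<open>Extensions\<close>

record ('r, 'y, 'm, 'x) ses =
  inc :: "'y \<Rightarrow> 'm"
  mid :: "('r, 'm) module"
  prj :: "'m \<Rightarrow> 'x"

text \<open>\<open>short_exact R Y S X\<close>: the sequence \<open>0 \<rightarrow> Y \<rightarrow> mid S \<rightarrow> X \<rightarrow> 0\<close> of left modules is exact.\<close>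

definition short_exact ::
    "('r, 'e) ring_scheme \<Rightarrow> ('r, 'y) module \<Rightarrow> ('r, 'y, 'm, 'x) ses \<Rightarrow> ('r, 'x) module \<Rightarrow> bool"
  where
  "short_exact R Y S X \<longleftrightarrow>
    left_module R Y \<and> left_module R (mid S) \<and> left_module R X \<and>
    inc S \<in> mod_hom R Y (mid S) \<and> prj S \<in> mod_hom R (mid S) X \<and>
    inj_on (inc S) (carrier Y) \<and>
    inc S ` carrier Y = a_kernel (mid S) X (prj S) \<and>
    prj S ` carrier (mid S) = carrier X"

definition ses_equiv ::
    "('r, 'e) ring_scheme \<Rightarrow> ('r, 'y) module \<Rightarrow> ('r, 'y, 'm, 'x) ses \<Rightarrow> ('r, 'y, 'n, 'x) ses \<Rightarrow> bool"
  where
  "ses_equiv R Y S T \<longleftrightarrow>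
    (\<exists>h \<in> mod_iso R (mid S) (mid T).
      (\<forall>y\<in>carrier Y. h (inc S y) = inc T y) \<and>
      (\<forall>m\<in>carrier (mid S). prj T (h m) = prj S m))"

definition pullback ::
    "('r, 'x) module \<Rightarrow> ('x \<Rightarrow> 'z) \<Rightarrow> ('r, 'y, 'm, 'z) ses \<Rightarrow> ('r, 'y, 'x \<times> 'm, 'x) ses" where
  "pullback X f S =
    \<lparr>inc = (\<lambda>y. (\<zero>\<^bsub>X\<^esub>, inc S y)),
     mid = (binary_sum X (mid S))
       \<lparr>carrier := {(x, m) \<in> carrier X \<times> carrier (mid S). f x = prj S m}\<rparr>,
     prj = fst\<rparr>"

text \<open>
  The push-out of \<open>0 \<rightarrow> A \<rightarrow> M \<rightarrow> X \<rightarrow> 0\<close> along \<open>f : A \<rightarrow> B\<close> has middle term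
  \<open>(B \<oplus> M) / {(f a, - a) | a \<in> A}\<close>.
\<close>

definition pushout ::
    "('r, 'a) module \<Rightarrow> ('r, 'b) module \<Rightarrow> ('a \<Rightarrow> 'b) \<Rightarrow> ('r, 'a, 'm, 'x) ses
      \<Rightarrow> ('r, 'b, ('b \<times> 'm) set, 'x) ses" where
  "pushout A B f S =
    (let N = (\<lambda>a. (f a, \<ominus>\<^bsub>mid S\<^esub> inc S a)) ` carrier A in
    \<lparr>inc = (\<lambda>b. N +>\<^bsub>binary_sum B (mid S)\<^esub> (b, \<zero>\<^bsub>mid S\<^esub>)),
     mid = quotient_module (binary_sum B (mid S)) N,
     prj = (\<lambda>C. the_elem ((\<lambda>(b, m). prj S m) ` C))\<rparr>)"

definition binary_sum_ses ::
    "('r, 'a, 'm, 'x) ses \<Rightarrow> ('r, 'b, 'n, 'z) ses \<Rightarrow> ('r, 'a \<times> 'b, 'm \<times> 'n, 'x \<times> 'z) ses" where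
  "binary_sum_ses S T =
    \<lparr>inc = map_prod (inc S) (inc T),
     mid = binary_sum (mid S) (mid T),
     prj = map_prod (prj S) (prj T)\<rparr>"

definition direct_sum_ses ::
    "'k set \<Rightarrow> ('k \<Rightarrow> ('r, 'y, 'm, 'x) ses) \<Rightarrow> ('r, 'k \<Rightarrow> 'y, 'k \<Rightarrow> 'm, 'k \<Rightarrow> 'x) ses" where
  "direct_sum_ses K S =
    \<lparr>inc = (\<lambda>f. \<lambda>k\<in>K. inc (S k) (f k)),
     mid = direct_sum K (\<lambda>k. mid (S k)),
     prj = (\<lambda>f. \<lambda>k\<in>K. prj (S k) (f k))\<rparr>"

definition split_ses ::
    "('r, 'x) module \<Rightarrow> ('r, 'y) module \<Rightarrow> ('r, 'y, 'y \<times> 'x, 'x) ses" where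
  "split_ses X Y = \<lparr>inc = (\<lambda>y. (y, \<zero>\<^bsub>X\<^esub>)), mid = binary_sum Y X, prj = snd\<rparr>"

definition baer_sum ::
    "('r, 'x) module \<Rightarrow> ('r, 'y) module \<Rightarrow> ('r, 'y, 'm, 'x) ses \<Rightarrow> ('r, 'y, 'n, 'x) ses
      \<Rightarrow> ('r, 'y, ('y \<times> 'x \<times> 'm \<times> 'n) set, 'x) ses" where
  "baer_sum X Y S T =
    pushout (binary_sum Y Y) Y (\<lambda>(y, y'). y \<oplus>\<^bsub>Y\<^esub> y')
      (pullback X (\<lambda>x. (x, x)) (binary_sum_ses S T))"


subsection \<open>The Yoneda group \<open>Ext\<^sup>1\<close>\<close>

text \<open>
  The elements of \<open>Ext\<^sup>1(X,Y)\<close> are equivalence classes of extensions whose middle term is carried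
  by a subset of \<open>'y \<times> 'x\<close>. This is no restriction: the middle term of any extension is in
  bijection with \<open>carrier Y \<times> carrier X\<close>. Accordingly \<open>ext_class R X Y S\<close> makes sense for an
  extension \<open>S\<close> with middle term on any type.
\<close>

definition ext_class ::
    "('r, 'e) ring_scheme \<Rightarrow> ('r, 'x) module \<Rightarrow> ('r, 'y) module \<Rightarrow> ('r, 'y, 'm, 'x) ses
      \<Rightarrow> ('r, 'y, 'y \<times> 'x, 'x) ses set" where
  "ext_class R X Y S = {T. short_exact R Y T X \<and> ses_equiv R Y S T}"

text \<open>
  Addition is the Baer sum and endomorphisms of \<open>X\<close> act by pull-back. The unions are taken over
  representatives of the given classes, all of which contribute the same class.
\<close>

definition Ext1 ::
    "('r, 'e) ring_scheme \<Rightarrow> ('r, 'x) module \<Rightarrow> ('r, 'y) module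
      \<Rightarrow> ('x \<Rightarrow> 'x, ('r, 'y, 'y \<times> 'x, 'x) ses set) module" where
  "Ext1 R X Y =
    \<lparr>carrier = {S. short_exact R Y S X} //
       {(S, T). short_exact R Y S X \<and> short_exact R Y T X \<and> ses_equiv R Y S T},
     monoid.mult = undefined, one = undefined,
     ring.zero = ext_class R X Y (split_ses X Y),
     add = (\<lambda>c d. \<Union>S\<in>c. \<Union>T\<in>d. ext_class R X Y (baer_sum X Y S T)),
     smult = (\<lambda>f c. \<Union>S\<in>c. ext_class R X Y (pullback X f S))\<rparr>"

text \<open>The connecting homomorphism \<open>Hom(X,Z) \<rightarrow> Ext\<^sup>1(X,Y)\<close> of a sequence \<open>0 \<rightarrow> Y \<rightarrow> M \<rightarrow> Z \<rightarrow> 0\<close>.\<close>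

definition connecting_hom ::
    "('r, 'e) ring_scheme \<Rightarrow> ('r, 'x) module \<Rightarrow> ('r, 'y) module \<Rightarrow> ('r, 'y, 'm, 'z) ses
      \<Rightarrow> ('x \<Rightarrow> 'z) \<Rightarrow> ('r, 'y, 'y \<times> 'x, 'x) ses set" where
  "connecting_hom R X Y S f = ext_class R X Y (pullback X f S)"


section \<open>Universal sequences\<close>

definition is_basis ::
    "('d, 'e) ring_scheme \<Rightarrow> ('d, 'v) module \<Rightarrow> 'i set \<Rightarrow> ('i \<Rightarrow> 'v) \<Rightarrow> bool" where
  "is_basis D V I b \<longleftrightarrow>
    (\<forall>i\<in>I. b i \<in> carrier V) \<and>
    (\<forall>F c. finite F \<longrightarrow> F \<subseteq> I \<longrightarrow> c \<in> F \<rightarrow> carrier D \<longrightarrow>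
      finsum V (\<lambda>i. c i \<odot>\<^bsub>V\<^esub> b i) F = \<zero>\<^bsub>V\<^esub> \<longrightarrow> (\<forall>i\<in>F. c i = \<zero>\<^bsub>D\<^esub>)) \<and>
    (\<forall>v\<in>carrier V. \<exists>F c. finite F \<and> F \<subseteq> I \<and> c \<in> F \<rightarrow> carrier D \<and>
      v = finsum V (\<lambda>i. c i \<odot>\<^bsub>V\<^esub> b i) F)"

text \<open>
  The direct sum over \<open>X \<in> \<X>\<close> of the copowers of \<open>X\<close> by \<open>I X\<close>, as a single direct sum over all
  pairs \<open>(X, i)\<close> with \<open>i \<in> I X\<close>.
\<close>

definition copower_sum ::
    "('r, 'x) module set \<Rightarrow> (('r, 'x) module \<Rightarrow> 'i set)
      \<Rightarrow> ('r, ('r, 'x) module \<times> 'i \<Rightarrow> 'x) module" where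
  "copower_sum \<X> I = direct_sum (Sigma \<X> I) fst"

text \<open>
  \<open>E X i\<close> is the chosen sequence \<open>0 \<rightarrow> Y \<rightarrow> M\<^sub>X\<^sub>,\<^sub>i \<rightarrow> X \<rightarrow> 0\<close>. Replacing it by an equivalent sequence
  changes the push-out only up to equivalence, so the type of its middle term is no restriction.
\<close>

definition universal_ses ::
    "('r, 'x) module set \<Rightarrow> ('r, 'y) module \<Rightarrow> (('r, 'x) module \<Rightarrow> 'i set)
      \<Rightarrow> (('r, 'x) module \<Rightarrow> 'i \<Rightarrow> ('r, 'y, 'y \<times> 'x, 'x) ses)
      \<Rightarrow> ('r, 'y, ('y \<times> (('r, 'x) module \<times> 'i \<Rightarrow> 'y \<times> 'x)) set,
          ('r, 'x) module \<times> 'i \<Rightarrow> 'x) ses" where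
  "universal_ses \<X> Y I E =
    pushout (direct_sum (Sigma \<X> I) (\<lambda>_. Y)) Y (summation_map (Sigma \<X> I) Y)
      (direct_sum_ses (Sigma \<X> I) (\<lambda>(X, i). E X i))"

definition is_universal ::
    "('r, 'e) ring_scheme \<Rightarrow> ('r, 'x) module set \<Rightarrow> ('r, 'y) module
      \<Rightarrow> (('r, 'x) module \<Rightarrow> 'i set)
      \<Rightarrow> ('r, 'y, 'm, ('r, 'x) module \<times> 'i \<Rightarrow> 'x) ses \<Rightarrow> bool" where
  "is_universal R \<X> Y I S \<longleftrightarrow>
    (\<exists>E :: ('r, 'x) module \<Rightarrow> 'i \<Rightarrow> ('r, 'y, 'y \<times> 'x, 'x) ses.
      (\<forall>X\<in>\<X>. \<forall>i\<in>I X. short_exact R Y (E X i) X) \<and>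
      (\<forall>X\<in>\<X>. is_basis (End_ring R X) (Ext1 R X Y) (I X) (\<lambda>i. ext_class R X Y (E X i))) \<and>
      ses_equiv R Y (universal_ses \<X> Y I E) S)"

end

theory Submission
  imports Defs
begin

text \<open>
  Choosing set-theoretic sections, extensions of \<open>X\<close> by \<open>Y\<close> are classified by their factor sets: two
  extensions are equivalent iff they share one, Baer sums add factor sets pointwise, and pull-backs
  compose them with the map. Hence \<open>Ext\<^sup>1(X,Y)\<close> is an abelian group and the connecting homomorphism
  \<open>\<delta>\<close> is additive and \<open>End(X)\<close>-linear.

  By the universal property of push-outs and direct sums, the sequence is equivalent to the universal
  sequence built from extensions \<open>E X i\<close> iff \<open>E X i\<close> represents \<open>\<delta>\<close> of the inclusion of the copy
  \<open>(X, i)\<close>, for all \<open>X\<close> and \<open>i\<close>. So the sequence is universal iff these values of \<open>\<delta>\<close> form a basis of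
  each \<open>Ext\<^sup>1(X,Y)\<close>. As \<open>X'\<close> is finitely generated and \<open>Hom(X',X) = 0\<close> for \<open>X \<noteq> X'\<close>, the inclusions of
  the copies of \<open>X'\<close> are a basis of the Hom group over \<open>End(X')\<close>. Therefore their images form a basis
  iff \<open>\<delta>\<close> is bijective.
\<close>

section \<open>Homomorphisms and constructions of left modules\<close>

lemma left_module_abelian: "left_module R M \<Longrightarrow> abelian_group M"
  by (simp add: left_module_def)

lemma left_module_ring: "left_module R M \<Longrightarrow> ring R"
  by (simp add: left_module_def)

lemma left_module_surj_image:
  fixes P :: "('r, 'm) module" and Q :: "('r, 'n) module"
  assumes P: "left_module R P" and surj: "k ` carrier P = carrier Q"
    and add: "\<And>x y. \<lbrakk>x \<in> carrier P; y \<in> carrier P\<rbrakk> \<Longrightarrow> k x \<oplus>\<^bsub>Q\<^esub> k y = k (x \<oplus>\<^bsub>P\<^esub> y)"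
    and zero: "\<zero>\<^bsub>Q\<^esub> = k \<zero>\<^bsub>P\<^esub>"
    and smult: "\<And>r x. \<lbrakk>r \<in> carrier R; x \<in> carrier P\<rbrakk> \<Longrightarrow> r \<odot>\<^bsub>Q\<^esub> k x = k (r \<odot>\<^bsub>P\<^esub> x)"
  shows "left_module R Q"
proof -
  interpret P: left_module R P by fact
  have car: "\<exists>a\<in>carrier P. x = k a" if "x \<in> carrier Q" for x
    using that surj by auto
  have closed: "k x \<in> carrier Q" if "x \<in> carrier P" for x
    using that surj by auto
  have "abelian_group Q"
  proof (rule abelian_groupI)
    fix x assume "x \<in> carrier Q"
    then obtain a where a: "a \<in> carrier P" "x = k a" using car by blast
    show "\<exists>y\<in>carrier Q. y \<oplus>\<^bsub>Q\<^esub> x = \<zero>\<^bsub>Q\<^esub>"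
      using a by (intro bexI[of _ "k (\<ominus>\<^bsub>P\<^esub> a)"]) (auto simp: add zero closed P.M.l_neg)
  qed (auto dest!: car simp: add zero closed P.M.a_assoc intro!: arg_cong[of _ _ k] P.M.a_comm)
  then show ?thesis
    by (intro left_module.intro left_module_axioms.intro left_module_ring[OF P])
       (auto dest!: car simp: add smult closed P.smult_closed P.smult_l_distr P.smult_r_distr
         P.smult_assoc1 P.smult_one)
qed

lemma mod_homI:
  assumes "\<And>x. x \<in> carrier M \<Longrightarrow> h x \<in> carrier N"
    and "\<And>x y. \<lbrakk>x \<in> carrier M; y \<in> carrier M\<rbrakk> \<Longrightarrow> h (x \<oplus>\<^bsub>M\<^esub> y) = h x \<oplus>\<^bsub>N\<^esub> h y"
    and "\<And>r x. \<lbrakk>r \<in> carrier R; x \<in> carrier M\<rbrakk> \<Longrightarrow> h (r \<odot>\<^bsub>M\<^esub> x) = r \<odot>\<^bsub>N\<^esub> h x"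
  shows "h \<in> mod_hom R M N"
  using assms by (auto simp: mod_hom_def hom_def)

lemma mod_hom_closed: "\<lbrakk>h \<in> mod_hom R M N; x \<in> carrier M\<rbrakk> \<Longrightarrow> h x \<in> carrier N"
  by (auto simp: mod_hom_def hom_def)

lemma mod_hom_add:
  "\<lbrakk>h \<in> mod_hom R M N; x \<in> carrier M; y \<in> carrier M\<rbrakk> \<Longrightarrow> h (x \<oplus>\<^bsub>M\<^esub> y) = h x \<oplus>\<^bsub>N\<^esub> h y"
  by (auto simp: mod_hom_def hom_def)

lemma mod_hom_smult:
  "\<lbrakk>h \<in> mod_hom R M N; r \<in> carrier R; x \<in> carrier M\<rbrakk> \<Longrightarrow> h (r \<odot>\<^bsub>M\<^esub> x) = r \<odot>\<^bsub>N\<^esub> h x"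
  by (auto simp: mod_hom_def)

lemma mod_hom_abelian_group_hom:
  assumes "left_module R M" "left_module R N" "h \<in> mod_hom R M N"
  shows "abelian_group_hom M N h"
  using assms by (intro abelian_group_homI group_hom.intro group_hom_axioms.intro)
    (auto simp: left_module_def mod_hom_def abelian_group.a_group)

lemma mod_hom_zero:
  assumes "left_module R M" "left_module R N" "h \<in> mod_hom R M N"
  shows "h \<zero>\<^bsub>M\<^esub> = \<zero>\<^bsub>N\<^esub>"
proof -
  interpret abelian_group_hom M N h by (rule mod_hom_abelian_group_hom) fact+
  show ?thesis by simp
qed

lemma mod_hom_neg:
  assumes "left_module R M" "left_module R N" "h \<in> mod_hom R M N" "x \<in> carrier M"
  shows "h (\<ominus>\<^bsub>M\<^esub> x) = \<ominus>\<^bsub>N\<^esub> h x"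
proof -
  interpret abelian_group_hom M N h by (rule mod_hom_abelian_group_hom) fact+
  show ?thesis using assms by simp
qed

lemma mod_hom_inj_on:
  assumes "left_module R M" "left_module R N" "h \<in> mod_hom R M N"
    and "\<And>x. \<lbrakk>x \<in> carrier M; h x = \<zero>\<^bsub>N\<^esub>\<rbrakk> \<Longrightarrow> x = \<zero>\<^bsub>M\<^esub>"
  shows "inj_on h (carrier M)"
  using group_hom.inj_on_one_iff[OF abelian_group_hom.a_group_hom[OF mod_hom_abelian_group_hom[OF assms(1-3)]]]
    assms(4) by simp

lemma mod_hom_compose:
  assumes "f \<in> mod_hom R L M" "g \<in> mod_hom R M N"
  shows "(\<lambda>x. g (f x)) \<in> mod_hom R L N"
  using assms by (auto intro!: mod_homI simp: mod_hom_closed mod_hom_add mod_hom_smult)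

lemma mod_hom_id: "(\<lambda>x. x) \<in> mod_hom R M M"
  by (rule mod_homI) auto

lemma mod_hom_cong:
  assumes "left_module R M" "\<And>x. x \<in> carrier M \<Longrightarrow> f x = g x"
  shows "f \<in> mod_hom R M N \<longleftrightarrow> g \<in> mod_hom R M N"
proof -
  interpret M: left_module R M by fact
  show ?thesis
    using assms(2) by (auto simp: mod_hom_def hom_def Pi_def M.smult_closed)
qed

lemma left_module_smult_zero:
  assumes "left_module R M" "r \<in> carrier R"
  shows "r \<odot>\<^bsub>M\<^esub> \<zero>\<^bsub>M\<^esub> = \<zero>\<^bsub>M\<^esub>"
proof -
  interpret M: left_module R M by fact
  have "r \<odot>\<^bsub>M\<^esub> \<zero>\<^bsub>M\<^esub> \<oplus>\<^bsub>M\<^esub> r \<odot>\<^bsub>M\<^esub> \<zero>\<^bsub>M\<^esub> = r \<odot>\<^bsub>M\<^esub> \<zero>\<^bsub>M\<^esub> \<oplus>\<^bsub>M\<^esub> \<zero>\<^bsub>M\<^esub>"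
    using assms(2) M.smult_r_distr[of r "\<zero>\<^bsub>M\<^esub>" "\<zero>\<^bsub>M\<^esub>"] M.smult_closed by simp
  then show ?thesis
    using assms(2) M.smult_closed by simp
qed

lemma left_module_smult_neg:
  assumes "left_module R M" "r \<in> carrier R" "x \<in> carrier M"
  shows "r \<odot>\<^bsub>M\<^esub> (\<ominus>\<^bsub>M\<^esub> x) = \<ominus>\<^bsub>M\<^esub> (r \<odot>\<^bsub>M\<^esub> x)"
proof -
  interpret M: left_module R M by fact
  have "(\<lambda>x. r \<odot>\<^bsub>M\<^esub> x) \<in> hom (add_monoid M) (add_monoid M)"
    using assms by (auto simp: hom_def M.smult_closed M.smult_r_distr)
  then interpret abelian_group_hom M M "\<lambda>x. r \<odot>\<^bsub>M\<^esub> x"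
    by (intro abelian_group_homI group_hom.intro group_hom_axioms.intro)
       (auto simp: M.M.abelian_group_axioms M.M.a_group)
  show ?thesis using assms by simp
qed

lemma mod_hom_zero_map: "left_module R N \<Longrightarrow> (\<lambda>x. \<zero>\<^bsub>N\<^esub>) \<in> mod_hom R M N"
  by (rule mod_homI) (auto simp: abelian_group.axioms left_module_smult_zero
    dest!: left_module_abelian abelian_group.axioms(1) intro: abelian_monoid.zero_closed abelian_monoid.l_zero[symmetric])

lemma mod_hom_plus:
  assumes "left_module R N" "f \<in> mod_hom R M N" "g \<in> mod_hom R M N"
  shows "(\<lambda>x. f x \<oplus>\<^bsub>N\<^esub> g x) \<in> mod_hom R M N"
proof -
  interpret N: left_module R N by fact
  show ?thesis
    by (rule mod_homI)
       (use assms(2,3) in \<open>simp_all add: mod_hom_closed mod_hom_add mod_hom_smult N.smult_r_distr N.M.a_ac\<close>)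
qed

lemma mod_hom_uminus:
  assumes "left_module R N" "f \<in> mod_hom R M N"
  shows "(\<lambda>x. \<ominus>\<^bsub>N\<^esub> f x) \<in> mod_hom R M N"
proof -
  interpret N: left_module R N by fact
  show ?thesis
    by (rule mod_homI)
       (use assms(2) in \<open>simp_all add: mod_hom_closed mod_hom_add mod_hom_smult N.M.minus_add
          left_module_smult_neg[OF assms(1)]\<close>)
qed

lemma binary_sum_simps [simp]:
  "carrier (binary_sum M N) = carrier M \<times> carrier N"
  "\<zero>\<^bsub>binary_sum M N\<^esub> = (\<zero>\<^bsub>M\<^esub>, \<zero>\<^bsub>N\<^esub>)"
  "(x, y) \<oplus>\<^bsub>binary_sum M N\<^esub> (x', y') = (x \<oplus>\<^bsub>M\<^esub> x', y \<oplus>\<^bsub>N\<^esub> y')"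
  "r \<odot>\<^bsub>binary_sum M N\<^esub> (x, y) = (r \<odot>\<^bsub>M\<^esub> x, r \<odot>\<^bsub>N\<^esub> y)"
  by (simp_all add: binary_sum_def module_of_def)

lemma left_module_binary_sum:
  assumes "left_module R M" "left_module R N"
  shows "left_module R (binary_sum M N)"
proof -
  interpret M: left_module R M by fact
  interpret N: left_module R N by fact
  have "abelian_group (binary_sum M N)"
  proof (rule abelian_groupI)
    fix z assume "z \<in> carrier (binary_sum M N)"
    then obtain x y where z: "z = (x, y)" "x \<in> carrier M" "y \<in> carrier N" by auto
    show "\<exists>y\<in>carrier (binary_sum M N). y \<oplus>\<^bsub>binary_sum M N\<^esub> z = \<zero>\<^bsub>binary_sum M N\<^esub>"
      by (rule bexI[of _ "(\<ominus>\<^bsub>M\<^esub> x, \<ominus>\<^bsub>N\<^esub> y)"]) (auto simp: z M.M.l_neg N.M.l_neg)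
  qed (auto simp: M.M.a_ac N.M.a_ac)
  then show ?thesis
    by (intro left_module.intro left_module_axioms.intro left_module_ring[OF assms(1)])
       (auto simp: M.smult_closed M.smult_l_distr M.smult_r_distr M.smult_assoc1 M.smult_one
         N.smult_closed N.smult_l_distr N.smult_r_distr N.smult_assoc1 N.smult_one)
qed

lemma direct_sum_simps [simp]:
  "\<zero>\<^bsub>direct_sum K A\<^esub> = (\<lambda>k\<in>K. \<zero>\<^bsub>A k\<^esub>)"
  "f \<oplus>\<^bsub>direct_sum K A\<^esub> g = (\<lambda>k\<in>K. f k \<oplus>\<^bsub>A k\<^esub> g k)"
  "r \<odot>\<^bsub>direct_sum K A\<^esub> f = (\<lambda>k\<in>K. r \<odot>\<^bsub>A k\<^esub> f k)"
  by (simp_all add: direct_sum_def module_of_def)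

lemma carrier_direct_sum:
  assumes "\<And>k. k \<in> K \<Longrightarrow> left_module R (A k)"
  shows "carrier (direct_sum K A)
    = {f \<in> (\<Pi>\<^sub>E k\<in>K. carrier (A k)). finite {k\<in>K. f k \<noteq> \<zero>\<^bsub>A k\<^esub>}}"
proof -
  have "group (add_monoid (A k))" if "k \<in> K" for k
    using assms[OF that] by (intro abelian_group.a_group) (rule left_module_abelian)
  then show ?thesis by (simp add: direct_sum_def module_of_def carrier_sum_group)
qed

lemma left_module_direct_sum:
  assumes "ring R" and A: "\<And>k. k \<in> K \<Longrightarrow> left_module R (A k)"
  shows "left_module R (direct_sum K A)"
proof -
  have ab: "abelian_group (A k)" if "k \<in> K" for k
    using A[OF that] by (rule left_module_abelian)
  have G: "group (add_monoid (A k))" if "k \<in> K" for k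
    using ab[OF that] by (rule abelian_group.a_group)
  note car = carrier_direct_sum[of K R A, OF A]
  interpret S: group "sum_group K (\<lambda>k. add_monoid (A k))"
    using G by simp
  have car': "carrier (direct_sum K A) = carrier (sum_group K (\<lambda>k. add_monoid (A k)))"
    by (simp add: direct_sum_def module_of_def)
  have ag: "abelian_group (direct_sum K A)"
  proof (rule abelian_groupI)
    fix f g
    assume "f \<in> carrier (direct_sum K A)" "g \<in> carrier (direct_sum K A)"
    then show "f \<oplus>\<^bsub>direct_sum K A\<^esub> g = g \<oplus>\<^bsub>direct_sum K A\<^esub> f"
      using ab by (auto simp: car PiE_iff abelian_group_def abelian_monoid.a_comm intro!: restrict_ext)
  qed (use S.m_closed S.one_closed S.m_assoc S.l_one S.l_inv_ex in \<open>simp_all add: car'\<close>)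
  have fin: "finite {k\<in>K. r \<odot>\<^bsub>A k\<^esub> f k \<noteq> \<zero>\<^bsub>A k\<^esub>}"
    if "r \<in> carrier R" "finite {k\<in>K. f k \<noteq> \<zero>\<^bsub>A k\<^esub>}" for r f
    by (rule finite_subset[OF _ that(2)]) (auto simp: left_module_smult_zero[OF A] that)
  show ?thesis
  proof (intro left_module.intro left_module_axioms.intro assms(1) ag)
    fix a f assume "a \<in> carrier R" "f \<in> carrier (direct_sum K A)"
    then show "a \<odot>\<^bsub>direct_sum K A\<^esub> f \<in> carrier (direct_sum K A)"
      by (auto simp: car PiE_iff left_module.smult_closed[OF A] fin cong: conj_cong)
  next
    fix f assume "f \<in> carrier (direct_sum K A)"
    then have f: "f \<in> (\<Pi>\<^sub>E k\<in>K. carrier (A k))" by (simp add: car)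
    then show "\<one>\<^bsub>R\<^esub> \<odot>\<^bsub>direct_sum K A\<^esub> f = f"
      by (intro extensionalityI[of _ K]) (auto simp: PiE_iff left_module.smult_one[OF A])
  qed (auto simp: car PiE_iff left_module.smult_l_distr[OF A] left_module.smult_r_distr[OF A]
        left_module.smult_assoc1[OF A] intro!: restrict_ext)
qed

lemma left_module_submodule:
  fixes P :: "('r, 'm) module"
  assumes P: "left_module R P" and sub: "C \<subseteq> carrier P" and zero: "\<zero>\<^bsub>P\<^esub> \<in> C"
    and add: "\<And>x y. \<lbrakk>x \<in> C; y \<in> C\<rbrakk> \<Longrightarrow> x \<oplus>\<^bsub>P\<^esub> y \<in> C"
    and smult: "\<And>r x. \<lbrakk>r \<in> carrier R; x \<in> C\<rbrakk> \<Longrightarrow> r \<odot>\<^bsub>P\<^esub> x \<in> C"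
    and neg: "\<And>x. x \<in> C \<Longrightarrow> \<ominus>\<^bsub>P\<^esub> x \<in> C"
  shows "left_module R (P\<lparr>carrier := C\<rparr>)"
proof -
  interpret P: left_module R P by fact
  have sub': "x \<in> carrier P" if "x \<in> C" for x using that sub by blast
  have "abelian_group (P\<lparr>carrier := C\<rparr>)"
    by (rule abelian_groupI) (use neg in \<open>auto simp: add zero sub' P.M.a_ac intro!: bexI[of _ "\<ominus>\<^bsub>P\<^esub> _"] P.M.r_neg\<close>)
  then show ?thesis
    by (intro left_module.intro left_module_axioms.intro left_module_ring[OF P])
       (auto simp: smult sub' P.smult_l_distr P.smult_r_distr P.smult_assoc1 P.smult_one)
qed

section \<open>Exact sequences and factor sets\<close>

locale exact_seq =
  fixes R :: "('r, 'e) ring_scheme" and Y :: "('r, 'y) module"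
    and S :: "('r, 'y, 'm, 'x) ses" and X :: "('r, 'x) module"
  assumes exact: "short_exact R Y S X"
begin

sublocale Y: left_module R Y using exact by (simp add: short_exact_def)
sublocale M: left_module R "mid S" using exact by (simp add: short_exact_def)
sublocale X: left_module R X using exact by (simp add: short_exact_def)

lemma inc_hom: "inc S \<in> mod_hom R Y (mid S)" and prj_hom: "prj S \<in> mod_hom R (mid S) X"
  using exact by (simp_all add: short_exact_def)

lemmas inc_closed [simp] = mod_hom_closed[OF inc_hom]
  and inc_add = mod_hom_add[OF inc_hom]
  and inc_smult = mod_hom_smult[OF inc_hom]
  and inc_zero [simp] = mod_hom_zero[OF Y.left_module_axioms M.left_module_axioms inc_hom]
  and inc_neg = mod_hom_neg[OF Y.left_module_axioms M.left_module_axioms inc_hom]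
  and prj_closed [simp] = mod_hom_closed[OF prj_hom]
  and prj_add = mod_hom_add[OF prj_hom]
  and prj_smult = mod_hom_smult[OF prj_hom]
  and prj_zero [simp] = mod_hom_zero[OF M.left_module_axioms X.left_module_axioms prj_hom]
  and prj_neg = mod_hom_neg[OF M.left_module_axioms X.left_module_axioms prj_hom]

lemma inc_eq_iff: "\<lbrakk>y \<in> carrier Y; y' \<in> carrier Y\<rbrakk> \<Longrightarrow> inc S y = inc S y' \<longleftrightarrow> y = y'"
  using exact by (auto simp: short_exact_def inj_on_def)

lemma prj_inc [simp]: "y \<in> carrier Y \<Longrightarrow> prj S (inc S y) = \<zero>\<^bsub>X\<^esub>"
  using exact by (auto simp: short_exact_def a_kernel_def' )

lemma prj_eq_zeroE:
  assumes "m \<in> carrier (mid S)" "prj S m = \<zero>\<^bsub>X\<^esub>"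
  obtains y where "y \<in> carrier Y" "m = inc S y"
proof -
  have "m \<in> a_kernel (mid S) X (prj S)" using assms by (simp add: a_kernel_def')
  also have "\<dots> = inc S ` carrier Y" using exact by (simp add: short_exact_def)
  finally show ?thesis using that by blast
qed

lemma prj_surjE:
  assumes "x \<in> carrier X" obtains m where "m \<in> carrier (mid S)" "prj S m = x"
proof -
  have "x \<in> prj S ` carrier (mid S)" using assms exact by (simp add: short_exact_def)
  then show ?thesis using that by blast
qed

lemma prj_eqE:
  assumes "m \<in> carrier (mid S)" "m' \<in> carrier (mid S)" "prj S m = prj S m'"
  obtains y where "y \<in> carrier Y" "m = inc S y \<oplus>\<^bsub>mid S\<^esub> m'"
proof -
  have "prj S (m \<oplus>\<^bsub>mid S\<^esub> \<ominus>\<^bsub>mid S\<^esub> m') = \<zero>\<^bsub>X\<^esub>"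
    using assms by (simp add: prj_add prj_neg X.M.r_neg)
  then obtain y where y: "y \<in> carrier Y" "m \<oplus>\<^bsub>mid S\<^esub> \<ominus>\<^bsub>mid S\<^esub> m' = inc S y"
    using assms by (auto elim!: prj_eq_zeroE[rotated])
  have "m = m \<oplus>\<^bsub>mid S\<^esub> \<ominus>\<^bsub>mid S\<^esub> m' \<oplus>\<^bsub>mid S\<^esub> m'"
    using assms by (simp add: M.M.a_assoc M.M.l_neg)
  with y that show ?thesis by metis
qed

end

lemma short_exactI:
  assumes "left_module R Y" "left_module R (mid S)" "left_module R X"
    and inc: "inc S \<in> mod_hom R Y (mid S)" and prj: "prj S \<in> mod_hom R (mid S) X"
    and inj: "\<And>y. \<lbrakk>y \<in> carrier Y; inc S y = \<zero>\<^bsub>mid S\<^esub>\<rbrakk> \<Longrightarrow> y = \<zero>\<^bsub>Y\<^esub>"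
    and prj_inc: "\<And>y. y \<in> carrier Y \<Longrightarrow> prj S (inc S y) = \<zero>\<^bsub>X\<^esub>"
    and ker: "\<And>m. \<lbrakk>m \<in> carrier (mid S); prj S m = \<zero>\<^bsub>X\<^esub>\<rbrakk> \<Longrightarrow> \<exists>y\<in>carrier Y. m = inc S y"
    and surj: "\<And>x. x \<in> carrier X \<Longrightarrow> \<exists>m\<in>carrier (mid S). prj S m = x"
  shows "short_exact R Y S X"
proof -
  have "inj_on (inc S) (carrier Y)"
    using assms(1,2) inc inj by (rule mod_hom_inj_on)
  moreover have "inc S ` carrier Y = a_kernel (mid S) X (prj S)"
    using ker prj_inc mod_hom_closed[OF inc] by (auto simp: a_kernel_def')
  moreover have "prj S ` carrier (mid S) = carrier X"
    using surj mod_hom_closed[OF prj] by (force simp: image_iff)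
  ultimately show ?thesis using assms by (simp add: short_exact_def)
qed

definition ses_hom ::
    "('r, 'e) ring_scheme \<Rightarrow> ('r, 'a) module \<Rightarrow> ('a \<Rightarrow> 'b) \<Rightarrow> ('m \<Rightarrow> 'n) \<Rightarrow> ('x \<Rightarrow> 'z)
      \<Rightarrow> ('r, 'a, 'm, 'x) ses \<Rightarrow> ('r, 'b, 'n, 'z) ses \<Rightarrow> bool"
  where
  "ses_hom R A a h g T S \<longleftrightarrow> h \<in> mod_hom R (mid T) (mid S) \<and>
    (\<forall>y\<in>carrier A. h (inc T y) = inc S (a y)) \<and> (\<forall>m\<in>carrier (mid T). prj S (h m) = g (prj T m))"

text \<open>
  For \<open>f = id\<close> the function \<open>t\<close> is a set-theoretic section of the projection, and \<open>(c, d)\<close> is the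
  factor set of the extension with respect to it. In general \<open>t\<close> amounts to a section of the
  pull-back of \<open>S\<close> along \<open>f\<close>, so that \<open>(c, d)\<close> is a factor set of that pull-back.
\<close>

definition lifts ::
    "('r, 'e) ring_scheme \<Rightarrow> ('r, 'x) module \<Rightarrow> ('r, 'y) module \<Rightarrow> ('r, 'y, 'm, 'z) ses \<Rightarrow> ('x \<Rightarrow> 'z)
      \<Rightarrow> ('x \<Rightarrow> 'x \<Rightarrow> 'y) \<Rightarrow> ('r \<Rightarrow> 'x \<Rightarrow> 'y) \<Rightarrow> ('x \<Rightarrow> 'm) \<Rightarrow> bool"
  where
  "lifts R X Y S f c d t \<longleftrightarrow>
    (\<forall>x\<in>carrier X. t x \<in> carrier (mid S) \<and> prj S (t x) = f x) \<and>
    (\<forall>x\<in>carrier X. \<forall>x'\<in>carrier X. c x x' \<in> carrier Y \<and>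
      t x \<oplus>\<^bsub>mid S\<^esub> t x' = inc S (c x x') \<oplus>\<^bsub>mid S\<^esub> t (x \<oplus>\<^bsub>X\<^esub> x')) \<and>
    (\<forall>r\<in>carrier R. \<forall>x\<in>carrier X. d r x \<in> carrier Y \<and>
      r \<odot>\<^bsub>mid S\<^esub> t x = inc S (d r x) \<oplus>\<^bsub>mid S\<^esub> t (r \<odot>\<^bsub>X\<^esub> x))"

definition has_cocycle ::
    "('r, 'e) ring_scheme \<Rightarrow> ('r, 'x) module \<Rightarrow> ('r, 'y) module \<Rightarrow> ('r, 'y, 'm, 'z) ses \<Rightarrow> ('x \<Rightarrow> 'z)
      \<Rightarrow> ('x \<Rightarrow> 'x \<Rightarrow> 'y) \<Rightarrow> ('r \<Rightarrow> 'x \<Rightarrow> 'y) \<Rightarrow> bool"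
  where "has_cocycle R X Y S f c d \<longleftrightarrow> (\<exists>t. lifts R X Y S f c d t)"

lemma liftsD:
  assumes "lifts R X Y S f c d t"
  shows "x \<in> carrier X \<Longrightarrow> t x \<in> carrier (mid S)"
    and "x \<in> carrier X \<Longrightarrow> prj S (t x) = f x"
    and "\<lbrakk>x \<in> carrier X; x' \<in> carrier X\<rbrakk> \<Longrightarrow> c x x' \<in> carrier Y"
    and "\<lbrakk>x \<in> carrier X; x' \<in> carrier X\<rbrakk> \<Longrightarrow>
      t x \<oplus>\<^bsub>mid S\<^esub> t x' = inc S (c x x') \<oplus>\<^bsub>mid S\<^esub> t (x \<oplus>\<^bsub>X\<^esub> x')"
    and "\<lbrakk>r \<in> carrier R; x \<in> carrier X\<rbrakk> \<Longrightarrow> d r x \<in> carrier Y"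
    and "\<lbrakk>r \<in> carrier R; x \<in> carrier X\<rbrakk> \<Longrightarrow>
      r \<odot>\<^bsub>mid S\<^esub> t x = inc S (d r x) \<oplus>\<^bsub>mid S\<^esub> t (r \<odot>\<^bsub>X\<^esub> x)"
  using assms by (simp_all add: lifts_def)

lemma has_cocycleI: "lifts R X Y S f c d t \<Longrightarrow> has_cocycle R X Y S f c d"
  by (auto simp: has_cocycle_def)

lemma (in exact_seq) lifts_ex_factor_set:
  assumes W: "left_module R W" and f: "f \<in> mod_hom R W X"
    and t: "\<And>w. w \<in> carrier W \<Longrightarrow> t w \<in> carrier (mid S)" "\<And>w. w \<in> carrier W \<Longrightarrow> prj S (t w) = f w"
  shows "\<exists>c d. lifts R W Y S f c d t"
proof -
  interpret W: left_module R W by fact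
  have "\<exists>y. y \<in> carrier Y \<and> t w \<oplus>\<^bsub>mid S\<^esub> t w' = inc S y \<oplus>\<^bsub>mid S\<^esub> t (w \<oplus>\<^bsub>W\<^esub> w')"
    if "w \<in> carrier W" "w' \<in> carrier W" for w w'
    by (rule prj_eqE[of "t w \<oplus>\<^bsub>mid S\<^esub> t w'" "t (w \<oplus>\<^bsub>W\<^esub> w')"])
       (use that t in \<open>auto simp: prj_add mod_hom_add[OF f]\<close>)
  then obtain c where c: "\<And>w w'. \<lbrakk>w \<in> carrier W; w' \<in> carrier W\<rbrakk> \<Longrightarrow> c w w' \<in> carrier Y \<and>
      t w \<oplus>\<^bsub>mid S\<^esub> t w' = inc S (c w w') \<oplus>\<^bsub>mid S\<^esub> t (w \<oplus>\<^bsub>W\<^esub> w')"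
    by metis
  have "\<exists>y. y \<in> carrier Y \<and> r \<odot>\<^bsub>mid S\<^esub> t w = inc S y \<oplus>\<^bsub>mid S\<^esub> t (r \<odot>\<^bsub>W\<^esub> w)"
    if "r \<in> carrier R" "w \<in> carrier W" for r w
    by (rule prj_eqE[of "r \<odot>\<^bsub>mid S\<^esub> t w" "t (r \<odot>\<^bsub>W\<^esub> w)"])
       (use that t in \<open>auto simp: prj_smult mod_hom_smult[OF f] M.smult_closed W.smult_closed\<close>)
  then obtain d where d: "\<And>r w. \<lbrakk>r \<in> carrier R; w \<in> carrier W\<rbrakk> \<Longrightarrow> d r w \<in> carrier Y \<and>
      r \<odot>\<^bsub>mid S\<^esub> t w = inc S (d r w) \<oplus>\<^bsub>mid S\<^esub> t (r \<odot>\<^bsub>W\<^esub> w)"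
    by metis
  show ?thesis
    by (intro exI[of _ c] exI[of _ d]) (use c d t in \<open>simp add: lifts_def\<close>)
qed

lemma (in exact_seq) has_cocycle_ex:
  assumes W: "left_module R W" and f: "f \<in> mod_hom R W X"
  shows "\<exists>c d. has_cocycle R W Y S f c d"
proof -
  have "\<exists>m. m \<in> carrier (mid S) \<and> prj S m = f w" if "w \<in> carrier W" for w
    using prj_surjE mod_hom_closed[OF f that] by metis
  then obtain t where "\<And>w. w \<in> carrier W \<Longrightarrow> t w \<in> carrier (mid S) \<and> prj S (t w) = f w"
    by metis
  then show ?thesis using lifts_ex_factor_set[OF W f, of t] by (auto simp: has_cocycle_def)
qed

lemma lifts_ses_hom:
  assumes W: "left_module R W" and T: "short_exact R A T Z"
    and h: "ses_hom R A a h g T S" and a: "a \<in> mod_hom R A B"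
    and t: "lifts R W A T f c d t"
  shows "lifts R W B S (\<lambda>x. g (f x)) (\<lambda>x x'. a (c x x')) (\<lambda>r x. a (d r x)) (\<lambda>x. h (t x))"
proof -
  interpret T: exact_seq R A T Z by (rule exact_seq.intro) fact
  interpret W: left_module R W by fact
  have h': "h \<in> mod_hom R (mid T) (mid S)" using h by (simp add: ses_hom_def)
  have h_inc: "h (inc T y) = inc S (a y)" if "y \<in> carrier A" for y
    using h that by (simp add: ses_hom_def)
  note t = liftsD[OF t]
  have "h (t x) \<oplus>\<^bsub>mid S\<^esub> h (t x') = inc S (a (c x x')) \<oplus>\<^bsub>mid S\<^esub> h (t (x \<oplus>\<^bsub>W\<^esub> x'))"
    if x: "x \<in> carrier W" "x' \<in> carrier W" for x x'
  proof -
    have "h (t x) \<oplus>\<^bsub>mid S\<^esub> h (t x') = h (t x \<oplus>\<^bsub>mid T\<^esub> t x')"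
      using x by (simp add: mod_hom_add[OF h'] t(1))
    also have "\<dots> = inc S (a (c x x')) \<oplus>\<^bsub>mid S\<^esub> h (t (x \<oplus>\<^bsub>W\<^esub> x'))"
      using x unfolding t(4)[OF x] by (simp add: mod_hom_add[OF h'] t(1,3) h_inc)
    finally show ?thesis .
  qed
  moreover have "r \<odot>\<^bsub>mid S\<^esub> h (t x) = inc S (a (d r x)) \<oplus>\<^bsub>mid S\<^esub> h (t (r \<odot>\<^bsub>W\<^esub> x))"
    if x: "r \<in> carrier R" "x \<in> carrier W" for r x
  proof -
    have "r \<odot>\<^bsub>mid S\<^esub> h (t x) = h (r \<odot>\<^bsub>mid T\<^esub> t x)"
      using x by (simp add: mod_hom_smult[OF h'] t(1))
    also have "\<dots> = inc S (a (d r x)) \<oplus>\<^bsub>mid S\<^esub> h (t (r \<odot>\<^bsub>W\<^esub> x))"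
      using x unfolding t(6)[OF x]
      by (simp add: mod_hom_add[OF h'] t(1,5) W.smult_closed h_inc)
    finally show ?thesis .
  qed
  ultimately show ?thesis
    using h by (auto simp: lifts_def mod_hom_closed[OF h'] mod_hom_closed[OF a] t(1,2,3,5) ses_hom_def)
qed

lemma ses_hom_from_cocycle:
  assumes T: "short_exact R Y T W" and S: "short_exact R Y S X"
    and "has_cocycle R W Y T (\<lambda>x. x) c d" "has_cocycle R W Y S f c d"
  shows "\<exists>h. ses_hom R Y (\<lambda>y. y) h f T S"
proof -
  interpret T: exact_seq R Y T W by (rule exact_seq.intro) fact
  interpret S: exact_seq R Y S X by (rule exact_seq.intro) fact
  obtain t s where "lifts R W Y T (\<lambda>x. x) c d t" "lifts R W Y S f c d s"
    using assms(3,4) by (auto simp: has_cocycle_def)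
  note t = liftsD[OF this(1)] and s = liftsD[OF this(2)]
  define q where "q m = (THE y. y \<in> carrier Y \<and> m = inc T y \<oplus>\<^bsub>mid T\<^esub> t (prj T m))" for m
  define h where "h m = inc S (q m) \<oplus>\<^bsub>mid S\<^esub> s (prj T m)" for m
  have q: "q (inc T y \<oplus>\<^bsub>mid T\<^esub> t x) = y" if "y \<in> carrier Y" "x \<in> carrier W" for y x
    unfolding q_def
    by (rule the_equality) (use that in \<open>auto simp: t T.prj_add T.inc_eq_iff\<close>)
  have h: "h (inc T y \<oplus>\<^bsub>mid T\<^esub> t x) = inc S y \<oplus>\<^bsub>mid S\<^esub> s x"
    if "y \<in> carrier Y" "x \<in> carrier W" for y x
    unfolding h_def by (simp add: q that t T.prj_add)
  have cases: "\<exists>y\<in>carrier Y. \<exists>x\<in>carrier W. m = inc T y \<oplus>\<^bsub>mid T\<^esub> t x" if m: "m \<in> carrier (mid T)" for m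
  proof -
    have x: "prj T m \<in> carrier W" using m by (rule T.prj_closed)
    obtain y where y: "y \<in> carrier Y" "m = inc T y \<oplus>\<^bsub>mid T\<^esub> t (prj T m)"
      by (rule T.prj_eqE[OF m t(1)[OF x] t(2)[OF x, symmetric]])
    show ?thesis by (intro bexI[of _ y] bexI[of _ "prj T m"]) (rule x y)+
  qed
  have "h \<in> mod_hom R (mid T) (mid S)"
  proof (rule mod_homI)
    fix m assume "m \<in> carrier (mid T)"
    then obtain y x where m: "y \<in> carrier Y" "x \<in> carrier W" "m = inc T y \<oplus>\<^bsub>mid T\<^esub> t x"
      using cases by blast
    then show "h m \<in> carrier (mid S)" by (simp add: h s)
    fix m' assume "m' \<in> carrier (mid T)"
    then obtain y' x' where m': "y' \<in> carrier Y" "x' \<in> carrier W" "m' = inc T y' \<oplus>\<^bsub>mid T\<^esub> t x'"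
      using cases by blast
    have "m \<oplus>\<^bsub>mid T\<^esub> m' = inc T y \<oplus>\<^bsub>mid T\<^esub> inc T y' \<oplus>\<^bsub>mid T\<^esub> (t x \<oplus>\<^bsub>mid T\<^esub> t x')"
      using m m' by (simp add: t(1) T.M.M.a_ac)
    also have "\<dots> = inc T (y \<oplus>\<^bsub>Y\<^esub> y' \<oplus>\<^bsub>Y\<^esub> c x x') \<oplus>\<^bsub>mid T\<^esub> t (x \<oplus>\<^bsub>W\<^esub> x')"
      using m m' unfolding t(4)[OF m(2) m'(2)] by (simp add: T.inc_add t(1,3) T.M.M.a_assoc)
    finally have "h (m \<oplus>\<^bsub>mid T\<^esub> m') = inc S (y \<oplus>\<^bsub>Y\<^esub> y' \<oplus>\<^bsub>Y\<^esub> c x x') \<oplus>\<^bsub>mid S\<^esub> s (x \<oplus>\<^bsub>W\<^esub> x')"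
      using m m' by (simp add: h t(3))
    also have "\<dots> = inc S y \<oplus>\<^bsub>mid S\<^esub> inc S y' \<oplus>\<^bsub>mid S\<^esub> (s x \<oplus>\<^bsub>mid S\<^esub> s x')"
      using m m' unfolding s(4)[OF m(2) m'(2)] by (simp add: S.inc_add s(1,3) S.M.M.a_assoc)
    also have "\<dots> = h m \<oplus>\<^bsub>mid S\<^esub> h m'"
      using m m' by (simp add: h s(1) S.M.M.a_ac)
    finally show "h (m \<oplus>\<^bsub>mid T\<^esub> m') = h m \<oplus>\<^bsub>mid S\<^esub> h m'" .
  next
    fix r m assume r: "r \<in> carrier R" and "m \<in> carrier (mid T)"
    then obtain y x where m: "y \<in> carrier Y" "x \<in> carrier W" "m = inc T y \<oplus>\<^bsub>mid T\<^esub> t x"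
      using cases by blast
    have "r \<odot>\<^bsub>mid T\<^esub> m = inc T (r \<odot>\<^bsub>Y\<^esub> y) \<oplus>\<^bsub>mid T\<^esub> (r \<odot>\<^bsub>mid T\<^esub> t x)"
      using r m by (simp add: T.M.smult_r_distr t(1) T.inc_smult)
    also have "\<dots> = inc T (r \<odot>\<^bsub>Y\<^esub> y \<oplus>\<^bsub>Y\<^esub> d r x) \<oplus>\<^bsub>mid T\<^esub> t (r \<odot>\<^bsub>W\<^esub> x)"
      using r m unfolding t(6)[OF r m(2)]
      by (simp add: T.inc_add t(1,5) T.M.M.a_assoc T.Y.smult_closed T.X.smult_closed)
    finally have "h (r \<odot>\<^bsub>mid T\<^esub> m) = inc S (r \<odot>\<^bsub>Y\<^esub> y \<oplus>\<^bsub>Y\<^esub> d r x) \<oplus>\<^bsub>mid S\<^esub> s (r \<odot>\<^bsub>W\<^esub> x)"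
      using r m by (simp add: h t(5) T.Y.smult_closed T.X.smult_closed)
    also have "\<dots> = inc S (r \<odot>\<^bsub>Y\<^esub> y) \<oplus>\<^bsub>mid S\<^esub> (r \<odot>\<^bsub>mid S\<^esub> s x)"
      using r m unfolding s(6)[OF r m(2)]
      by (simp add: S.inc_add s(1,5) S.M.M.a_assoc T.Y.smult_closed T.X.smult_closed)
    also have "\<dots> = r \<odot>\<^bsub>mid S\<^esub> h m"
      using r m by (simp add: h s(1) S.M.smult_r_distr S.inc_smult)
    finally show "h (r \<odot>\<^bsub>mid T\<^esub> m) = r \<odot>\<^bsub>mid S\<^esub> h m" .
  qed
  moreover have "h (inc T y) = inc S y" if y: "y \<in> carrier Y" for y
  proof -
    let ?z = "\<zero>\<^bsub>W\<^esub>"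
    have z: "?z \<in> carrier W" by simp
    have t0: "t ?z = inc T (c ?z ?z)"
      using t(4)[OF z z] z by (simp add: t(1,3))
    have s0: "s ?z = inc S (c ?z ?z)"
      using s(4)[OF z z] z by (simp add: s(1,3))
    have c: "c ?z ?z \<in> carrier Y" using t(3) z by blast
    have y': "y \<oplus>\<^bsub>Y\<^esub> \<ominus>\<^bsub>Y\<^esub> c ?z ?z \<oplus>\<^bsub>Y\<^esub> c ?z ?z = y"
      using y c by (simp add: T.Y.M.a_assoc T.Y.M.l_neg)
    have "h (inc T (y \<oplus>\<^bsub>Y\<^esub> \<ominus>\<^bsub>Y\<^esub> c ?z ?z) \<oplus>\<^bsub>mid T\<^esub> t ?z)
        = inc S (y \<oplus>\<^bsub>Y\<^esub> \<ominus>\<^bsub>Y\<^esub> c ?z ?z) \<oplus>\<^bsub>mid S\<^esub> s ?z"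
      using y c by (intro h) auto
    then show ?thesis
      unfolding t0 s0 using y c by (simp flip: T.inc_add S.inc_add add: y')
  qed
  moreover have "prj S (h m) = f (prj T m)" if mem: "m \<in> carrier (mid T)" for m
  proof -
    obtain y x where m: "y \<in> carrier Y" "x \<in> carrier W" "m = inc T y \<oplus>\<^bsub>mid T\<^esub> t x"
      using cases[OF mem] by blast
    have "f x \<in> carrier X" using s(1,2)[OF m(2)] S.prj_closed[of "s x"] by simp
    then show ?thesis using m by (simp add: h S.prj_add T.prj_add s(1,2) t(1,2))
  qed
  ultimately show ?thesis by (auto simp: ses_hom_def)
qed

lemma ses_hom_bij:
  assumes T: "short_exact R Y T X" and S: "short_exact R Y S X"
    and h: "ses_hom R Y (\<lambda>y. y) h (\<lambda>x. x) T S"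
  shows "h \<in> mod_iso R (mid T) (mid S)"
proof -
  interpret T: exact_seq R Y T X by (rule exact_seq.intro) fact
  interpret S: exact_seq R Y S X by (rule exact_seq.intro) fact
  have hh: "h \<in> mod_hom R (mid T) (mid S)" using h by (simp add: ses_hom_def)
  have "m = \<zero>\<^bsub>mid T\<^esub>" if m: "m \<in> carrier (mid T)" "h m = \<zero>\<^bsub>mid S\<^esub>" for m
  proof -
    have "prj T m = \<zero>\<^bsub>X\<^esub>" using h m by (metis S.prj_zero ses_hom_def)
    then obtain y where y: "y \<in> carrier Y" "m = inc T y" using m T.prj_eq_zeroE by metis
    then have "inc S y = inc S \<zero>\<^bsub>Y\<^esub>" using h m by (simp add: ses_hom_def)
    then have "y = \<zero>\<^bsub>Y\<^esub>" using y(1) by (subst (asm) S.inc_eq_iff) auto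
    with y show ?thesis by simp
  qed
  then have "inj_on h (carrier (mid T))"
    by (rule mod_hom_inj_on[OF T.M.left_module_axioms S.M.left_module_axioms hh])
  moreover have "\<exists>m\<in>carrier (mid T). n = h m" if n: "n \<in> carrier (mid S)" for n
  proof -
    obtain m where m: "m \<in> carrier (mid T)" "prj T m = prj S n"
      by (rule T.prj_surjE[OF S.prj_closed[OF n]])
    then have eq: "prj S n = prj S (h m)" using h by (simp add: ses_hom_def)
    obtain y where y: "y \<in> carrier Y" "n = inc S y \<oplus>\<^bsub>mid S\<^esub> h m"
      by (rule S.prj_eqE[OF n mod_hom_closed[OF hh m(1)] eq])
    have "h (inc T y) = inc S y" using h y(1) unfolding ses_hom_def by blast
    then have "n = h (inc T y \<oplus>\<^bsub>mid T\<^esub> m)"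
      using y mod_hom_add[OF hh T.inc_closed[OF y(1)] m(1)] by simp
    then show ?thesis using y(1) m(1) by (intro bexI[of _ "inc T y \<oplus>\<^bsub>mid T\<^esub> m"]) auto
  qed
  ultimately show ?thesis
    using hh mod_hom_closed[OF hh] by (auto simp: mod_iso_def bij_betw_def)
qed

lemma ses_equiv_iff_ses_hom:
  assumes "short_exact R Y T X" "short_exact R Y S X"
  shows "ses_equiv R Y T S \<longleftrightarrow> (\<exists>h. ses_hom R Y (\<lambda>y. y) h (\<lambda>x. x) T S)"
  using ses_hom_bij[OF assms] by (auto simp: ses_equiv_def ses_hom_def mod_iso_def)

lemma ses_hom_has_cocycle:
  assumes "short_exact R Y T X" "ses_hom R Y (\<lambda>y. y) h g T S"
    and "left_module R W" "has_cocycle R W Y T f c d"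
  shows "has_cocycle R W Y S (\<lambda>x. g (f x)) c d"
  using assms(4) lifts_ses_hom[OF assms(3,1,2) mod_hom_id] unfolding has_cocycle_def by blast

lemma ses_equiv_iff_cocycle:
  assumes T: "short_exact R Y T X" and S: "short_exact R Y S X"
    and c: "has_cocycle R X Y T (\<lambda>x. x) c d"
  shows "ses_equiv R Y T S \<longleftrightarrow> has_cocycle R X Y S (\<lambda>x. x) c d"
proof -
  have "left_module R X" using T by (simp add: short_exact_def)
  then show ?thesis
    using ses_equiv_iff_ses_hom[OF T S] ses_hom_has_cocycle[OF T _ _ c] ses_hom_from_cocycle[OF T S c]
    by blast
qed

lemma ses_equiv_refl: "short_exact R Y T X \<Longrightarrow> ses_equiv R Y T T"
  using exact_seq.has_cocycle_ex[OF exact_seq.intro, of R Y T X X "\<lambda>x. x"]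
  by (auto simp: short_exact_def mod_hom_id ses_equiv_iff_cocycle)

section \<open>Pull-backs, direct sums and push-outs of sequences\<close>

lemma pullback_simps [simp]:
  "inc (pullback X f S) y = (\<zero>\<^bsub>X\<^esub>, inc S y)"
  "prj (pullback X f S) p = fst p"
  "carrier (mid (pullback X f S)) = {(x, m) \<in> carrier X \<times> carrier (mid S). f x = prj S m}"
  "(x, m) \<oplus>\<^bsub>mid (pullback X f S)\<^esub> (x', m') = (x \<oplus>\<^bsub>X\<^esub> x', m \<oplus>\<^bsub>mid S\<^esub> m')"
  "r \<odot>\<^bsub>mid (pullback X f S)\<^esub> (x, m) = (r \<odot>\<^bsub>X\<^esub> x, r \<odot>\<^bsub>mid S\<^esub> m)"
  "\<zero>\<^bsub>mid (pullback X f S)\<^esub> = (\<zero>\<^bsub>X\<^esub>, \<zero>\<^bsub>mid S\<^esub>)"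
  by (simp_all add: pullback_def binary_sum_def module_of_def)

lemma binary_sum_neg:
  assumes "left_module R M" "left_module R N" "x \<in> carrier M" "y \<in> carrier N"
  shows "\<ominus>\<^bsub>binary_sum M N\<^esub> (x, y) = (\<ominus>\<^bsub>M\<^esub> x, \<ominus>\<^bsub>N\<^esub> y)"
proof -
  interpret M: left_module R M by fact
  interpret N: left_module R N by fact
  interpret S: left_module R "binary_sum M N" by (rule left_module_binary_sum) fact+
  show ?thesis
    by (rule S.M.minus_equality) (use assms in \<open>auto simp: M.M.l_neg N.M.l_neg\<close>)
qed

lemma short_exact_pullback:
  assumes S: "short_exact R Y S Z" and X: "left_module R X" and f: "f \<in> mod_hom R X Z"
  shows "short_exact R Y (pullback X f S) X"
proof -
  interpret S: exact_seq R Y S Z by (rule exact_seq.intro) fact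
  interpret X: left_module R X by fact
  note f_simps = mod_hom_closed[OF f] mod_hom_add[OF f] mod_hom_smult[OF f]
    mod_hom_zero[OF X S.X.left_module_axioms f] mod_hom_neg[OF X S.X.left_module_axioms f]
  have "left_module R (mid (pullback X f S))"
    unfolding pullback_def ses.simps
    by (rule left_module_submodule)
       (auto simp: f_simps S.prj_add S.prj_smult S.prj_neg X.smult_closed S.M.smult_closed
         binary_sum_neg[OF X S.M.left_module_axioms]
         intro: left_module_binary_sum[OF X S.M.left_module_axioms])
  then show ?thesis
  proof (rule short_exactI[OF S.Y.left_module_axioms _ X])
    show "inc (pullback X f S) \<in> mod_hom R Y (mid (pullback X f S))"
      by (rule mod_homI) (auto simp: f_simps S.inc_add S.inc_smult left_module_smult_zero[OF X])
    show "prj (pullback X f S) \<in> mod_hom R (mid (pullback X f S)) X"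
      by (rule mod_homI) auto
  next
    fix y assume "y \<in> carrier Y" "inc (pullback X f S) y = \<zero>\<^bsub>mid (pullback X f S)\<^esub>"
    then show "y = \<zero>\<^bsub>Y\<^esub>"
      using S.inc_eq_iff[of y "\<zero>\<^bsub>Y\<^esub>"] by simp
  next
    fix p assume "p \<in> carrier (mid (pullback X f S))" "prj (pullback X f S) p = \<zero>\<^bsub>X\<^esub>"
    then obtain m where "p = (\<zero>\<^bsub>X\<^esub>, m)" "m \<in> carrier (mid S)" "prj S m = \<zero>\<^bsub>Z\<^esub>"
      by (cases p) (auto simp: f_simps)
    then show "\<exists>y\<in>carrier Y. p = inc (pullback X f S) y"
      by (auto elim!: S.prj_eq_zeroE)
  next
    fix x assume x: "x \<in> carrier X"
    then obtain m where "m \<in> carrier (mid S)" "prj S m = f x"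
      using S.prj_surjE f_simps(1) by metis
    then show "\<exists>p\<in>carrier (mid (pullback X f S)). prj (pullback X f S) p = x"
      using x by (intro bexI[of _ "(x, m)"]) auto
  qed simp
qed

lemma has_cocycle_pullback_iff:
  assumes S: "short_exact R Y S Z" and X: "left_module R X" and W: "left_module R W"
    and f: "f \<in> mod_hom R X Z" and g: "g \<in> mod_hom R W X"
  shows "has_cocycle R W Y (pullback X f S) g c d \<longleftrightarrow> has_cocycle R W Y S (\<lambda>w. f (g w)) c d"
proof
  have "ses_hom R Y (\<lambda>y. y) snd f (pullback X f S) S"
    by (auto simp: ses_hom_def intro!: mod_homI)
  then show "has_cocycle R W Y S (\<lambda>w. f (g w)) c d" if "has_cocycle R W Y (pullback X f S) g c d"
    using ses_hom_has_cocycle[OF short_exact_pullback[OF S X f]] that W by blast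
next
  assume "has_cocycle R W Y S (\<lambda>w. f (g w)) c d"
  then obtain t where t: "lifts R W Y S (\<lambda>w. f (g w)) c d t" by (auto simp: has_cocycle_def)
  interpret S: exact_seq R Y S Z by (rule exact_seq.intro) fact
  interpret X: left_module R X by fact
  interpret W: left_module R W by fact
  have "lifts R W Y (pullback X f S) g c d (\<lambda>w. (g w, t w))"
    using t g by (auto simp: lifts_def mod_hom_closed mod_hom_add mod_hom_smult
        X.smult_closed W.smult_closed)
  then show "has_cocycle R W Y (pullback X f S) g c d" by (rule has_cocycleI)
qed

lemma binary_sum_ses_simps [simp]:
  "inc (binary_sum_ses S T) = map_prod (inc S) (inc T)"
  "prj (binary_sum_ses S T) = map_prod (prj S) (prj T)"
  "mid (binary_sum_ses S T) = binary_sum (mid S) (mid T)"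
  by (simp_all add: binary_sum_ses_def)

lemma short_exact_binary_sum_ses:
  assumes "short_exact R A S X" "short_exact R B T Z"
  shows "short_exact R (binary_sum A B) (binary_sum_ses S T) (binary_sum X Z)"
proof -
  interpret S: exact_seq R A S X by (rule exact_seq.intro) fact
  interpret T: exact_seq R B T Z by (rule exact_seq.intro) fact
  show ?thesis
  proof (rule short_exactI)
    show "inc (binary_sum_ses S T) \<in> mod_hom R (binary_sum A B) (mid (binary_sum_ses S T))"
      by (rule mod_homI) (auto simp: S.inc_add S.inc_smult T.inc_add T.inc_smult)
    show "prj (binary_sum_ses S T) \<in> mod_hom R (mid (binary_sum_ses S T)) (binary_sum X Z)"
      by (rule mod_homI) (auto simp: S.prj_add S.prj_smult T.prj_add T.prj_smult)
  next
    fix y assume "y \<in> carrier (binary_sum A B)"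
      "inc (binary_sum_ses S T) y = \<zero>\<^bsub>mid (binary_sum_ses S T)\<^esub>"
    then show "y = \<zero>\<^bsub>binary_sum A B\<^esub>"
      using S.inc_eq_iff[of _ "\<zero>\<^bsub>A\<^esub>"] T.inc_eq_iff[of _ "\<zero>\<^bsub>B\<^esub>"] by (cases y) auto
  next
    fix p assume "p \<in> carrier (mid (binary_sum_ses S T))"
      "prj (binary_sum_ses S T) p = \<zero>\<^bsub>binary_sum X Z\<^esub>"
    then obtain m n where p: "p = (m, n)" "m \<in> carrier (mid S)" "n \<in> carrier (mid T)"
      "prj S m = \<zero>\<^bsub>X\<^esub>" "prj T n = \<zero>\<^bsub>Z\<^esub>"
      by auto
    obtain a b where "a \<in> carrier A" "m = inc S a" "b \<in> carrier B" "n = inc T b"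
      using S.prj_eq_zeroE[OF p(2,4)] T.prj_eq_zeroE[OF p(3,5)] by metis
    then show "\<exists>y\<in>carrier (binary_sum A B). p = inc (binary_sum_ses S T) y"
      using p(1) by (intro bexI[of _ "(a, b)"]) auto
  next
    fix p assume "p \<in> carrier (binary_sum X Z)"
    then obtain x z where p: "p = (x, z)" "x \<in> carrier X" "z \<in> carrier Z" by auto
    obtain m n where "m \<in> carrier (mid S)" "prj S m = x" "n \<in> carrier (mid T)" "prj T n = z"
      using S.prj_surjE[OF p(2)] T.prj_surjE[OF p(3)] by metis
    then show "\<exists>q\<in>carrier (mid (binary_sum_ses S T)). prj (binary_sum_ses S T) q = p"
      using p(1) by (intro bexI[of _ "(m, n)"]) auto
  qed (auto intro: left_module_binary_sum S.Y.left_module_axioms S.M.left_module_axioms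
      S.X.left_module_axioms T.Y.left_module_axioms T.M.left_module_axioms T.X.left_module_axioms)
qed

lemma lifts_binary_sum_ses:
  assumes "lifts R X A S f c d s" "lifts R X B T g c' d' t"
  shows "lifts R X (binary_sum A B) (binary_sum_ses S T) (\<lambda>x. (f x, g x))
    (\<lambda>x x'. (c x x', c' x x')) (\<lambda>r x. (d r x, d' r x)) (\<lambda>x. (s x, t x))"
  using assms by (simp add: lifts_def)

lemma direct_sum_map_hom:
  assumes A: "\<And>k. k \<in> K \<Longrightarrow> left_module R (A k)" and B: "\<And>k. k \<in> K \<Longrightarrow> left_module R (B k)"
    and h: "\<And>k. k \<in> K \<Longrightarrow> h k \<in> mod_hom R (A k) (B k)"
  shows "(\<lambda>f. \<lambda>k\<in>K. h k (f k)) \<in> mod_hom R (direct_sum K A) (direct_sum K B)"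
proof (rule mod_homI)
  note car = carrier_direct_sum[of K R A, OF A] carrier_direct_sum[of K R B, OF B]
  fix f assume f: "f \<in> carrier (direct_sum K A)"
  then have "finite {k\<in>K. f k \<noteq> \<zero>\<^bsub>A k\<^esub>}" by (simp add: car)
  then have "finite {k\<in>K. h k (f k) \<noteq> \<zero>\<^bsub>B k\<^esub>}"
    by (rule rev_finite_subset) (auto simp: mod_hom_zero[OF A B h])
  then show "(\<lambda>k\<in>K. h k (f k)) \<in> carrier (direct_sum K B)"
    using f by (auto simp: car PiE_iff mod_hom_closed[OF h] cong: conj_cong)
  show "(\<lambda>k\<in>K. h k ((r \<odot>\<^bsub>direct_sum K A\<^esub> f) k)) = r \<odot>\<^bsub>direct_sum K B\<^esub> (\<lambda>k\<in>K. h k (f k))"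
    if "r \<in> carrier R" for r
    using f that by (auto simp: car PiE_iff mod_hom_smult[OF h] intro!: restrict_ext)
  fix g assume "g \<in> carrier (direct_sum K A)"
  then show "(\<lambda>k\<in>K. h k ((f \<oplus>\<^bsub>direct_sum K A\<^esub> g) k))
      = (\<lambda>k\<in>K. h k (f k)) \<oplus>\<^bsub>direct_sum K B\<^esub> (\<lambda>k\<in>K. h k (g k))"
    using f by (auto simp: car PiE_iff mod_hom_add[OF h] intro!: restrict_ext)
qed

lemma direct_sum_ses_simps [simp]:
  "inc (direct_sum_ses K S) f = (\<lambda>k\<in>K. inc (S k) (f k))"
  "mid (direct_sum_ses K S) = direct_sum K (\<lambda>k. mid (S k))"
  "prj (direct_sum_ses K S) g = (\<lambda>k\<in>K. prj (S k) (g k))"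
  by (simp_all add: direct_sum_ses_def)

lemma short_exact_direct_sum_ses:
  assumes "ring R" and S: "\<And>k. k \<in> K \<Longrightarrow> short_exact R (A k) (S k) (X k)"
  shows "short_exact R (direct_sum K A) (direct_sum_ses K S) (direct_sum K X)"
proof -
  have ex: "exact_seq R (A k) (S k) (X k)" if "k \<in> K" for k
    using S[OF that] by (rule exact_seq.intro)
  have A: "left_module R (A k)" and M: "left_module R (mid (S k))" and X: "left_module R (X k)"
    if "k \<in> K" for k
    using S[OF that] by (simp_all add: short_exact_def)
  note car = carrier_direct_sum[of K R A, OF A] carrier_direct_sum[of K R "\<lambda>k. mid (S k)", OF M]
    carrier_direct_sum[of K R X, OF X]
  show ?thesis
  proof (rule short_exactI)
    show "inc (direct_sum_ses K S) \<in> mod_hom R (direct_sum K A) (mid (direct_sum_ses K S))"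
      using direct_sum_map_hom[of K R A "\<lambda>k. mid (S k)" "\<lambda>k. inc (S k)", OF A M exact_seq.inc_hom[OF ex]]
      by (simp add: direct_sum_ses_def)
    show "prj (direct_sum_ses K S) \<in> mod_hom R (mid (direct_sum_ses K S)) (direct_sum K X)"
      using direct_sum_map_hom[of K R "\<lambda>k. mid (S k)" X "\<lambda>k. prj (S k)", OF M X exact_seq.prj_hom[OF ex]]
      by (simp add: direct_sum_ses_def)
  next
    fix f assume f: "f \<in> carrier (direct_sum K A)"
      and eq: "inc (direct_sum_ses K S) f = \<zero>\<^bsub>mid (direct_sum_ses K S)\<^esub>"
    have "f k = \<zero>\<^bsub>A k\<^esub>" if k: "k \<in> K" for k
    proof -
      interpret k: exact_seq R "A k" "S k" "X k" by (rule ex) fact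
      have "inc (S k) (f k) = inc (S k) \<zero>\<^bsub>A k\<^esub>"
        using fun_cong[OF eq, of k] k by simp
      then show ?thesis
        using f k by (subst (asm) k.inc_eq_iff) (auto simp: car)
    qed
    then show "f = \<zero>\<^bsub>direct_sum K A\<^esub>"
      using f by (intro extensionalityI[of _ K]) (auto simp: car PiE_iff)
  next
    fix f assume "f \<in> carrier (direct_sum K A)"
    then show "prj (direct_sum_ses K S) (inc (direct_sum_ses K S) f) = \<zero>\<^bsub>direct_sum K X\<^esub>"
      by (auto simp: car PiE_iff exact_seq.prj_inc[OF ex] intro!: restrict_ext)
  next
    fix m assume m: "m \<in> carrier (mid (direct_sum_ses K S))"
      and eq: "prj (direct_sum_ses K S) m = \<zero>\<^bsub>direct_sum K X\<^esub>"
    have "\<exists>y. y \<in> carrier (A k) \<and> m k = inc (S k) y \<and> (m k = \<zero>\<^bsub>mid (S k)\<^esub> \<longrightarrow> y = \<zero>\<^bsub>A k\<^esub>)" if k: "k \<in> K" for k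
    proof -
      interpret k: exact_seq R "A k" "S k" "X k" by (rule ex) fact
      have "prj (S k) (m k) = \<zero>\<^bsub>X k\<^esub>" using fun_cong[OF eq, of k] k by simp
      then obtain y where "y \<in> carrier (A k)" "m k = inc (S k) y"
        using m k by (auto simp: car PiE_iff elim!: k.prj_eq_zeroE[rotated])
      then show ?thesis using k.inc_eq_iff[of y "\<zero>\<^bsub>A k\<^esub>"] by auto
    qed
    then obtain y where y: "\<And>k. k \<in> K \<Longrightarrow> y k \<in> carrier (A k) \<and> m k = inc (S k) (y k) \<and>
        (m k = \<zero>\<^bsub>mid (S k)\<^esub> \<longrightarrow> y k = \<zero>\<^bsub>A k\<^esub>)"
      by metis
    have "finite {k\<in>K. m k \<noteq> \<zero>\<^bsub>mid (S k)\<^esub>}" using m by (simp add: car)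
    then have "finite {k\<in>K. y k \<noteq> \<zero>\<^bsub>A k\<^esub>}"
      by (rule rev_finite_subset) (use y in auto)
    then have "(\<lambda>k\<in>K. y k) \<in> carrier (direct_sum K A)"
      using y by (auto simp: car cong: conj_cong)
    moreover have "m = inc (direct_sum_ses K S) (\<lambda>k\<in>K. y k)"
      using m y by (intro extensionalityI[of _ K]) (auto simp: car PiE_iff)
    ultimately show "\<exists>y\<in>carrier (direct_sum K A). m = inc (direct_sum_ses K S) y" by blast
  next
    fix x assume x: "x \<in> carrier (direct_sum K X)"
    have "\<exists>m. m \<in> carrier (mid (S k)) \<and> prj (S k) m = x k \<and> (x k = \<zero>\<^bsub>X k\<^esub> \<longrightarrow> m = \<zero>\<^bsub>mid (S k)\<^esub>)"
      if k: "k \<in> K" for k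
    proof -
      interpret k: exact_seq R "A k" "S k" "X k" by (rule ex) fact
      show ?thesis
      proof (cases "x k = \<zero>\<^bsub>X k\<^esub>")
        case True
        then show ?thesis by (intro exI[of _ "\<zero>\<^bsub>mid (S k)\<^esub>"]) auto
      next
        case False
        then show ?thesis using x k by (auto simp: car PiE_iff elim!: k.prj_surjE)
      qed
    qed
    then obtain m where m: "\<And>k. k \<in> K \<Longrightarrow> m k \<in> carrier (mid (S k)) \<and> prj (S k) (m k) = x k \<and>
        (x k = \<zero>\<^bsub>X k\<^esub> \<longrightarrow> m k = \<zero>\<^bsub>mid (S k)\<^esub>)"
      by metis
    have "finite {k\<in>K. x k \<noteq> \<zero>\<^bsub>X k\<^esub>}" using x by (simp add: car)
    then have "finite {k\<in>K. m k \<noteq> \<zero>\<^bsub>mid (S k)\<^esub>}"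
      by (rule rev_finite_subset) (use m in auto)
    then have "(\<lambda>k\<in>K. m k) \<in> carrier (direct_sum K (\<lambda>k. mid (S k)))"
      using m by (auto simp: car cong: conj_cong)
    moreover have "prj (direct_sum_ses K S) (\<lambda>k\<in>K. m k) = x"
      using x m by (intro extensionalityI[of _ K]) (auto simp: car PiE_iff)
    ultimately show "\<exists>m\<in>carrier (mid (direct_sum_ses K S)). prj (direct_sum_ses K S) m = x"
      by (intro bexI[of _ "\<lambda>k\<in>K. m k"]) simp_all
  qed (auto intro!: left_module_direct_sum assms(1) A M X)
qed

lemma quotient_module:
  assumes P: "left_module R P" and N: "N \<subseteq> carrier P" "\<zero>\<^bsub>P\<^esub> \<in> N"
    and add: "\<And>x y. \<lbrakk>x \<in> N; y \<in> N\<rbrakk> \<Longrightarrow> x \<oplus>\<^bsub>P\<^esub> y \<in> N"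
    and neg: "\<And>x. x \<in> N \<Longrightarrow> \<ominus>\<^bsub>P\<^esub> x \<in> N"
    and smult: "\<And>r x. \<lbrakk>r \<in> carrier R; x \<in> N\<rbrakk> \<Longrightarrow> r \<odot>\<^bsub>P\<^esub> x \<in> N"
  shows left_module_quotient: "left_module R (quotient_module P N)"
    and quotient_map_hom: "(\<lambda>x. N +>\<^bsub>P\<^esub> x) \<in> mod_hom R P (quotient_module P N)"
    and carrier_quotient_module:
      "carrier (quotient_module P N) = (\<lambda>x. N +>\<^bsub>P\<^esub> x) ` carrier P"
    and quotient_map_eq_zero_iff:
      "x \<in> carrier P \<Longrightarrow> N +>\<^bsub>P\<^esub> x = \<zero>\<^bsub>quotient_module P N\<^esub> \<longleftrightarrow> x \<in> N"
proof -
  interpret P: left_module R P by fact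
  have sub: "additive_subgroup N P"
    by (intro additive_subgroup.intro P.M.add.subgroupI) (use N add neg in auto)
  interpret N: abelian_subgroup N P
    by (rule abelian_subgroupI3) (use sub P.M.abelian_group_axioms in auto)
  have N': "x \<in> carrier P" if "x \<in> N" for x using that N by blast
  show car: "carrier (quotient_module P N) = (\<lambda>x. N +>\<^bsub>P\<^esub> x) ` carrier P"
    by (auto simp: quotient_module_def module_of_def A_FactGroup_def' A_RCOSETS_def')
  have cadd: "(N +>\<^bsub>P\<^esub> x) \<oplus>\<^bsub>quotient_module P N\<^esub> (N +>\<^bsub>P\<^esub> y) = N +>\<^bsub>P\<^esub> (x \<oplus>\<^bsub>P\<^esub> y)"
    if "x \<in> carrier P" "y \<in> carrier P" for x y
    using that by (simp add: quotient_module_def module_of_def A_FactGroup_def' N.a_rcos_sum)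
  have czero: "\<zero>\<^bsub>quotient_module P N\<^esub> = N +>\<^bsub>P\<^esub> \<zero>\<^bsub>P\<^esub>"
    using N by (simp add: quotient_module_def module_of_def A_FactGroup_def' P.M.a_coset_add_zero)
  have absorb: "N +>\<^bsub>P\<^esub> (n \<oplus>\<^bsub>P\<^esub> x) = N +>\<^bsub>P\<^esub> x" if "n \<in> N" "x \<in> carrier P" for n x
    using that N by (metis N' N.a_rcos_const P.M.a_coset_add_assoc)
  have csmult: "r \<odot>\<^bsub>quotient_module P N\<^esub> (N +>\<^bsub>P\<^esub> x) = N +>\<^bsub>P\<^esub> (r \<odot>\<^bsub>P\<^esub> x)"
    if r: "r \<in> carrier R" and x: "x \<in> carrier P" for r x
  proof -
    have "N +>\<^bsub>P\<^esub> (r \<odot>\<^bsub>P\<^esub> (n \<oplus>\<^bsub>P\<^esub> x)) = N +>\<^bsub>P\<^esub> (r \<odot>\<^bsub>P\<^esub> x)" if "n \<in> N" for n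
      using r x that N' by (simp add: P.smult_r_distr absorb smult P.smult_closed)
    moreover have "N \<noteq> {}" using N(2) by blast
    ultimately show ?thesis
      by (simp add: quotient_module_def module_of_def a_r_coset_def'[of P N x])
  qed
  show "(\<lambda>x. N +>\<^bsub>P\<^esub> x) \<in> mod_hom R P (quotient_module P N)"
    by (rule mod_homI) (auto simp: car cadd csmult)
  show "left_module R (quotient_module P N)"
    by (rule left_module_surj_image[OF P]) (auto simp: car cadd czero csmult)
  show "N +>\<^bsub>P\<^esub> x = \<zero>\<^bsub>quotient_module P N\<^esub> \<longleftrightarrow> x \<in> N" if "x \<in> carrier P"
    using that N by (metis N.a_rcos_const N.a_rcos_self P.M.a_coset_add_zero czero)
qed

lemma pushout:
  fixes S :: "('r, 'a, 'm, 'x) ses" and B :: "('r, 'b) module"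
  assumes S: "short_exact R A S X" and B: "left_module R B" and f: "f \<in> mod_hom R A B"
  shows short_exact_pushout: "short_exact R B (pushout A B f S) X"
    and ses_hom_pushout: "\<exists>h. ses_hom R A f h (\<lambda>x. x) S (pushout A B f S)"
proof -
  interpret S: exact_seq R A S X by (rule exact_seq.intro) fact
  interpret B: left_module R B by fact
  let ?P = "binary_sum B (mid S)"
  interpret P: left_module R ?P by (rule left_module_binary_sum[OF B S.M.left_module_axioms])
  define N where "N = (\<lambda>a. (f a, \<ominus>\<^bsub>mid S\<^esub> inc S a)) ` carrier A"
  define k where "k p = N +>\<^bsub>?P\<^esub> p" for p
  define U where "U = pushout A B f S"
  have neg_zero: "\<ominus>\<^bsub>mid S\<^esub> \<zero>\<^bsub>mid S\<^esub> = \<zero>\<^bsub>mid S\<^esub>"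
    by (rule S.M.M.minus_equality) auto
  note f_simps = mod_hom_closed[OF f] mod_hom_add[OF f, symmetric] mod_hom_smult[OF f, symmetric]
    mod_hom_zero[OF S.Y.left_module_axioms B f]
    mod_hom_neg[OF S.Y.left_module_axioms B f, symmetric]
  have Nmem: "(f a, \<ominus>\<^bsub>mid S\<^esub> inc S a) \<in> N" if "a \<in> carrier A" for a
    using that by (auto simp: N_def)
  have N: "N \<subseteq> carrier ?P" "\<zero>\<^bsub>?P\<^esub> \<in> N"
    "\<And>x y. \<lbrakk>x \<in> N; y \<in> N\<rbrakk> \<Longrightarrow> x \<oplus>\<^bsub>?P\<^esub> y \<in> N"
    "\<And>x. x \<in> N \<Longrightarrow> \<ominus>\<^bsub>?P\<^esub> x \<in> N"
    "\<And>r x. \<lbrakk>r \<in> carrier R; x \<in> N\<rbrakk> \<Longrightarrow> r \<odot>\<^bsub>?P\<^esub> x \<in> N"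
  proof -
    show "N \<subseteq> carrier ?P" by (auto simp: N_def f_simps)
    show "\<zero>\<^bsub>?P\<^esub> \<in> N" using Nmem[of "\<zero>\<^bsub>A\<^esub>"] by (simp add: f_simps neg_zero)
    fix x assume "x \<in> N"
    then obtain a where a: "a \<in> carrier A" "x = (f a, \<ominus>\<^bsub>mid S\<^esub> inc S a)" by (auto simp: N_def)
    show "\<ominus>\<^bsub>?P\<^esub> x \<in> N" using Nmem[of "\<ominus>\<^bsub>A\<^esub> a"] a
      by (simp add: f_simps binary_sum_neg[OF B S.M.left_module_axioms] S.inc_neg)
    show "r \<odot>\<^bsub>?P\<^esub> x \<in> N" if "r \<in> carrier R" for r
      using Nmem[of "r \<odot>\<^bsub>A\<^esub> a"] a that
      by (simp add: f_simps left_module_smult_neg[OF S.M.left_module_axioms] S.inc_smult S.Y.smult_closed)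
    fix y assume "y \<in> N"
    then obtain a' where "a' \<in> carrier A" "y = (f a', \<ominus>\<^bsub>mid S\<^esub> inc S a')" by (auto simp: N_def)
    then show "x \<oplus>\<^bsub>?P\<^esub> y \<in> N" using Nmem[of "a \<oplus>\<^bsub>A\<^esub> a'"] a
      by (simp add: f_simps S.inc_add S.M.M.minus_add)
  qed
  have Q: "left_module R (quotient_module ?P N)"
      "(\<lambda>x. N +>\<^bsub>?P\<^esub> x) \<in> mod_hom R ?P (quotient_module ?P N)"
      "carrier (quotient_module ?P N) = (\<lambda>x. N +>\<^bsub>?P\<^esub> x) ` carrier ?P"
      "\<And>x. x \<in> carrier ?P \<Longrightarrow> N +>\<^bsub>?P\<^esub> x = \<zero>\<^bsub>quotient_module ?P N\<^esub> \<longleftrightarrow> x \<in> N"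
    using N by (intro quotient_module[OF P.left_module_axioms]; blast)+
  note Q = Q[folded k_def]
  have midU: "mid U = quotient_module ?P N" and incU: "inc U b = k (b, \<zero>\<^bsub>mid S\<^esub>)" for b
    by (simp_all add: U_def pushout_def Let_def N_def k_def)
  have k: "k \<in> mod_hom R ?P (mid U)" using Q(2) by (simp add: midU)
  have carU: "carrier (mid U) = k ` carrier ?P" using Q(3) by (simp add: midU)
  have k_zero: "p \<in> N" if "p \<in> carrier ?P" "k p = \<zero>\<^bsub>mid U\<^esub>" for p
    using Q(4)[OF that(1)] that(2) by (simp add: midU)
  have k_N: "k p = \<zero>\<^bsub>mid U\<^esub>" if "p \<in> N" for p
    using Q(4)[of p] that N(1) by (auto simp: midU)
  have lmU: "left_module R (mid U)" using Q(1) by (simp add: midU)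
  interpret U: left_module R "mid U" by fact
  have prjU: "prj U (k (b, m)) = prj S m" if "b \<in> carrier B" "m \<in> carrier (mid S)" for b m
  proof -
    have "(\<lambda>(b, m). prj S m) ` k (b, m) = {prj S m}"
      using that S.Y.M.zero_closed
      by (auto simp: k_def a_r_coset_def' N_def S.prj_add S.prj_neg image_iff simp del: S.Y.M.zero_closed)
    then show ?thesis
      unfolding U_def pushout_def Let_def by (simp flip: N_def add: k_def)
  qed
  have k_inc: "k (\<zero>\<^bsub>B\<^esub>, inc S a) = inc U (f a)" if a: "a \<in> carrier A" for a
  proof -
    have "k (f a, \<zero>\<^bsub>mid S\<^esub>)
        = k ((f a, \<ominus>\<^bsub>mid S\<^esub> inc S a) \<oplus>\<^bsub>?P\<^esub> (\<zero>\<^bsub>B\<^esub>, inc S a))"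
      using a by (simp add: f_simps S.M.M.l_neg)
    also have "\<dots> = k (\<zero>\<^bsub>B\<^esub>, inc S a)"
      using a by (subst mod_hom_add[OF k])
        (auto simp: k_N[OF Nmem] f_simps intro!: U.M.l_zero mod_hom_closed[OF k])
    finally show ?thesis by (simp add: incU)
  qed
  show "short_exact R B (pushout A B f S) X"
    unfolding U_def[symmetric]
  proof (rule short_exactI[OF B lmU S.X.left_module_axioms])
    show "inc U \<in> mod_hom R B (mid U)"
      unfolding incU[abs_def]
      by (rule mod_hom_compose[OF _ k], rule mod_homI)
         (auto simp: left_module_smult_zero[OF S.M.left_module_axioms])
    show "prj U \<in> mod_hom R (mid U) X"
    proof (rule mod_homI)
      fix u assume "u \<in> carrier (mid U)"
      then obtain b m where u: "b \<in> carrier B" "m \<in> carrier (mid S)" "u = k (b, m)"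
        by (auto simp: carU)
      then show "prj U u \<in> carrier X" by (simp add: prjU)
      show "prj U (r \<odot>\<^bsub>mid U\<^esub> u) = r \<odot>\<^bsub>X\<^esub> prj U u" if r: "r \<in> carrier R" for r
        using u r mod_hom_smult[OF k r, of "(b, m)", symmetric]
        by (simp add: prjU B.smult_closed S.M.smult_closed S.prj_smult)
      fix v assume "v \<in> carrier (mid U)"
      then obtain b' m' where v: "b' \<in> carrier B" "m' \<in> carrier (mid S)" "v = k (b', m')"
        by (auto simp: carU)
      show "prj U (u \<oplus>\<^bsub>mid U\<^esub> v) = prj U u \<oplus>\<^bsub>X\<^esub> prj U v"
        using u v mod_hom_add[OF k, of "(b, m)" "(b', m')", symmetric]
        by (simp add: prjU S.prj_add)
    qed
  next
    fix b assume b: "b \<in> carrier B" "inc U b = \<zero>\<^bsub>mid U\<^esub>"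
    then have "(b, \<zero>\<^bsub>mid S\<^esub>) \<in> N" by (intro k_zero) (auto simp: incU)
    then obtain a where a': "a \<in> carrier A" "(b, \<zero>\<^bsub>mid S\<^esub>) = (f a, \<ominus>\<^bsub>mid S\<^esub> inc S a)"
      unfolding N_def by (rule imageE)
    then have a: "a \<in> carrier A" "b = f a" "\<ominus>\<^bsub>mid S\<^esub> inc S a = \<zero>\<^bsub>mid S\<^esub>"
      by simp_all
    then have "inc S a = inc S \<zero>\<^bsub>A\<^esub>"
      using S.M.M.r_neg[OF S.inc_closed[OF a(1)]] by simp
    then have "a = \<zero>\<^bsub>A\<^esub>" using a(1) by (subst (asm) S.inc_eq_iff) auto
    then show "b = \<zero>\<^bsub>B\<^esub>" using a by (simp add: f_simps)
  next
    fix b assume "b \<in> carrier B"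
    then show "prj U (inc U b) = \<zero>\<^bsub>X\<^esub>" by (simp add: incU prjU)
  next
    fix u assume "u \<in> carrier (mid U)" "prj U u = \<zero>\<^bsub>X\<^esub>"
    then obtain b m where u: "b \<in> carrier B" "m \<in> carrier (mid S)" "u = k (b, m)" "prj S m = \<zero>\<^bsub>X\<^esub>"
      by (auto simp: carU prjU)
    then obtain a where a: "a \<in> carrier A" "m = inc S a" by (auto elim!: S.prj_eq_zeroE)
    have "u = k ((b, \<zero>\<^bsub>mid S\<^esub>) \<oplus>\<^bsub>?P\<^esub> (\<zero>\<^bsub>B\<^esub>, inc S a))"
      using u a by simp
    also have "\<dots> = k (b, \<zero>\<^bsub>mid S\<^esub>) \<oplus>\<^bsub>mid U\<^esub> k (f a, \<zero>\<^bsub>mid S\<^esub>)"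
      using u a k_inc[OF a(1)] by (subst mod_hom_add[OF k]) (auto simp: incU)
    also have "\<dots> = inc U (b \<oplus>\<^bsub>B\<^esub> f a)"
      using u a mod_hom_add[OF k, of "(b, \<zero>\<^bsub>mid S\<^esub>)" "(f a, \<zero>\<^bsub>mid S\<^esub>)"]
      by (simp add: incU f_simps(1))
    finally show "\<exists>y\<in>carrier B. u = inc U y" using u a by (auto simp: f_simps(1))
  next
    fix x assume "x \<in> carrier X"
    then obtain m where "m \<in> carrier (mid S)" "prj S m = x" by (rule S.prj_surjE)
    then show "\<exists>u\<in>carrier (mid U). prj U u = x"
      by (intro bexI[of _ "k (\<zero>\<^bsub>B\<^esub>, m)"]) (auto simp: prjU carU)
  qed
  have "(\<lambda>m. k (\<zero>\<^bsub>B\<^esub>, m)) \<in> mod_hom R (mid S) (mid U)"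
    by (rule mod_hom_compose[OF _ k], rule mod_homI) (auto simp: left_module_smult_zero[OF B])
  then have "ses_hom R A f (\<lambda>m. k (\<zero>\<^bsub>B\<^esub>, m)) (\<lambda>x. x) S U"
    by (auto simp: ses_hom_def k_inc prjU)
  then show "\<exists>h. ses_hom R A f h (\<lambda>x. x) S (pushout A B f S)"
    by (auto simp: U_def)
qed

section \<open>The group of extensions\<close>

lemma lifts_cong:
  assumes W: "left_module R W"
    and "\<And>x. x \<in> carrier W \<Longrightarrow> f x = f' x"
    and "\<And>x x'. \<lbrakk>x \<in> carrier W; x' \<in> carrier W\<rbrakk> \<Longrightarrow> c x x' = c' x x'"
    and "\<And>r x. \<lbrakk>r \<in> carrier R; x \<in> carrier W\<rbrakk> \<Longrightarrow> d r x = d' r x"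
  shows "lifts R W Y S f c d t \<longleftrightarrow> lifts R W Y S f' c' d' t"
  using assms by (simp add: lifts_def)

lemma has_cocycle_cong:
  assumes "left_module R W"
    and "\<And>x. x \<in> carrier W \<Longrightarrow> f x = f' x"
    and "\<And>x x'. \<lbrakk>x \<in> carrier W; x' \<in> carrier W\<rbrakk> \<Longrightarrow> c x x' = c' x x'"
    and "\<And>r x. \<lbrakk>r \<in> carrier R; x \<in> carrier W\<rbrakk> \<Longrightarrow> d r x = d' r x"
  shows "has_cocycle R W Y S f c d \<longleftrightarrow> has_cocycle R W Y S f' c' d'"
  unfolding has_cocycle_def by (intro ex_cong1 lifts_cong assms)

lemma has_cocycle_closed:
  assumes "has_cocycle R W Y S f c d"
  shows "\<lbrakk>x \<in> carrier W; x' \<in> carrier W\<rbrakk> \<Longrightarrow> c x x' \<in> carrier Y"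
    and "\<lbrakk>r \<in> carrier R; x \<in> carrier W\<rbrakk> \<Longrightarrow> d r x \<in> carrier Y"
  using assms by (auto simp: has_cocycle_def lifts_def)

lemma has_cocycle_precompose:
  assumes W: "left_module R W" and g: "g \<in> mod_hom R W X" and c: "has_cocycle R X Y S f c d"
  shows "has_cocycle R W Y S (\<lambda>w. f (g w)) (\<lambda>w w'. c (g w) (g w')) (\<lambda>r w. d r (g w))"
proof -
  interpret W: left_module R W by fact
  obtain t where "lifts R X Y S f c d t" using c by (auto simp: has_cocycle_def)
  then have "lifts R W Y S (\<lambda>w. f (g w)) (\<lambda>w w'. c (g w) (g w')) (\<lambda>r w. d r (g w)) (\<lambda>w. t (g w))"
    by (simp add: lifts_def mod_hom_closed[OF g] mod_hom_add[OF g] mod_hom_smult[OF g])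
  then show ?thesis by (rule has_cocycleI)
qed

lemma has_cocycle_plus:
  assumes S: "short_exact R Y S Z" and W: "left_module R W"
    and c: "has_cocycle R W Y S f c d" and c': "has_cocycle R W Y S g c' d'"
  shows "has_cocycle R W Y S (\<lambda>x. f x \<oplus>\<^bsub>Z\<^esub> g x)
    (\<lambda>x x'. c x x' \<oplus>\<^bsub>Y\<^esub> c' x x') (\<lambda>r x. d r x \<oplus>\<^bsub>Y\<^esub> d' r x)"
proof -
  interpret S: exact_seq R Y S Z by (rule exact_seq.intro) fact
  interpret W: left_module R W by fact
  obtain s t where "lifts R W Y S f c d s" "lifts R W Y S g c' d' t"
    using c c' by (auto simp: has_cocycle_def)
  note s = liftsD[OF this(1)] and t = liftsD[OF this(2)]
  have "lifts R W Y S (\<lambda>x. f x \<oplus>\<^bsub>Z\<^esub> g x)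
    (\<lambda>x x'. c x x' \<oplus>\<^bsub>Y\<^esub> c' x x') (\<lambda>r x. d r x \<oplus>\<^bsub>Y\<^esub> d' r x) (\<lambda>x. s x \<oplus>\<^bsub>mid S\<^esub> t x)"
    unfolding lifts_def
  proof (intro conjI ballI)
    fix x assume x: "x \<in> carrier W"
    show "s x \<oplus>\<^bsub>mid S\<^esub> t x \<in> carrier (mid S)" using x s(1) t(1) by simp
    show "prj S (s x \<oplus>\<^bsub>mid S\<^esub> t x) = f x \<oplus>\<^bsub>Z\<^esub> g x" using x s(1,2) t(1,2) by (simp add: S.prj_add)
    fix x' assume x': "x' \<in> carrier W"
    show "c x x' \<oplus>\<^bsub>Y\<^esub> c' x x' \<in> carrier Y" using x x' s(3) t(3) by simp
    have "(s x \<oplus>\<^bsub>mid S\<^esub> t x) \<oplus>\<^bsub>mid S\<^esub> (s x' \<oplus>\<^bsub>mid S\<^esub> t x')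
        = (s x \<oplus>\<^bsub>mid S\<^esub> s x') \<oplus>\<^bsub>mid S\<^esub> (t x \<oplus>\<^bsub>mid S\<^esub> t x')"
      using x x' s(1) t(1) by (simp add: S.M.M.a_ac)
    also have "\<dots> = inc S (c x x' \<oplus>\<^bsub>Y\<^esub> c' x x') \<oplus>\<^bsub>mid S\<^esub> (s (x \<oplus>\<^bsub>W\<^esub> x') \<oplus>\<^bsub>mid S\<^esub> t (x \<oplus>\<^bsub>W\<^esub> x'))"
      unfolding s(4)[OF x x'] t(4)[OF x x']
      using x x' s(1,3) t(1,3) by (simp add: S.M.M.a_ac S.inc_add)
    finally show "(s x \<oplus>\<^bsub>mid S\<^esub> t x) \<oplus>\<^bsub>mid S\<^esub> (s x' \<oplus>\<^bsub>mid S\<^esub> t x') =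
      inc S (c x x' \<oplus>\<^bsub>Y\<^esub> c' x x') \<oplus>\<^bsub>mid S\<^esub> (s (x \<oplus>\<^bsub>W\<^esub> x') \<oplus>\<^bsub>mid S\<^esub> t (x \<oplus>\<^bsub>W\<^esub> x'))" .
  next
    fix r x assume r: "r \<in> carrier R" and x: "x \<in> carrier W"
    show "d r x \<oplus>\<^bsub>Y\<^esub> d' r x \<in> carrier Y" using r x s(5) t(5) by simp
    have "r \<odot>\<^bsub>mid S\<^esub> (s x \<oplus>\<^bsub>mid S\<^esub> t x) = (r \<odot>\<^bsub>mid S\<^esub> s x) \<oplus>\<^bsub>mid S\<^esub> (r \<odot>\<^bsub>mid S\<^esub> t x)"
      using r x s(1) t(1) by (simp add: S.M.smult_r_distr)
    also have "\<dots> = inc S (d r x \<oplus>\<^bsub>Y\<^esub> d' r x) \<oplus>\<^bsub>mid S\<^esub> (s (r \<odot>\<^bsub>W\<^esub> x) \<oplus>\<^bsub>mid S\<^esub> t (r \<odot>\<^bsub>W\<^esub> x))"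
      unfolding s(6)[OF r x] t(6)[OF r x]
      using r x s(1,5) t(1,5) by (simp add: S.M.M.a_ac S.inc_add W.smult_closed)
    finally show "r \<odot>\<^bsub>mid S\<^esub> (s x \<oplus>\<^bsub>mid S\<^esub> t x) =
      inc S (d r x \<oplus>\<^bsub>Y\<^esub> d' r x) \<oplus>\<^bsub>mid S\<^esub> (s (r \<odot>\<^bsub>W\<^esub> x) \<oplus>\<^bsub>mid S\<^esub> t (r \<odot>\<^bsub>W\<^esub> x))" .
  qed
  then show ?thesis by (rule has_cocycleI)
qed

lemma mod_hom_binary_plus:
  assumes "left_module R Y"
  shows "(\<lambda>(y, y'). y \<oplus>\<^bsub>Y\<^esub> y') \<in> mod_hom R (binary_sum Y Y) Y"
proof -
  interpret Y: left_module R Y by fact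
  show ?thesis by (rule mod_homI) (auto simp: Y.M.a_ac Y.smult_r_distr)
qed

lemma baer_sum:
  assumes S: "short_exact R Y S X" and T: "short_exact R Y T X"
  shows short_exact_baer_sum: "short_exact R Y (baer_sum X Y S T) X"
    and has_cocycle_baer_sum:
      "\<lbrakk>has_cocycle R X Y S (\<lambda>x. x) c d; has_cocycle R X Y T (\<lambda>x. x) c' d'\<rbrakk> \<Longrightarrow>
        has_cocycle R X Y (baer_sum X Y S T) (\<lambda>x. x)
          (\<lambda>x x'. c x x' \<oplus>\<^bsub>Y\<^esub> c' x x') (\<lambda>r x. d r x \<oplus>\<^bsub>Y\<^esub> d' r x)"
proof -
  have X: "left_module R X" and Y: "left_module R Y" using S by (simp_all add: short_exact_def)
  note ST = short_exact_binary_sum_ses[OF S T]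
  have diag: "(\<lambda>x. (x, x)) \<in> mod_hom R X (binary_sum X X)" by (rule mod_homI) auto
  let ?P = "pullback X (\<lambda>x. (x, x)) (binary_sum_ses S T)"
  note P = short_exact_pullback[OF ST X diag]
  note plus = mod_hom_binary_plus[OF Y]
  show "short_exact R Y (baer_sum X Y S T) X"
    unfolding baer_sum_def by (rule short_exact_pushout[OF P Y plus])
  assume "has_cocycle R X Y S (\<lambda>x. x) c d" "has_cocycle R X Y T (\<lambda>x. x) c' d'"
  then obtain s t where "lifts R X Y S (\<lambda>x. x) c d s" "lifts R X Y T (\<lambda>x. x) c' d' t"
    by (auto simp: has_cocycle_def)
  note has_cocycleI[OF lifts_binary_sum_ses[OF this]]
  then have "has_cocycle R X (binary_sum Y Y) ?P (\<lambda>x. x) (\<lambda>x x'. (c x x', c' x x')) (\<lambda>r x. (d r x, d' r x))"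
    by (subst has_cocycle_pullback_iff[OF ST X X diag mod_hom_id])
  then obtain p where p: "lifts R X (binary_sum Y Y) ?P (\<lambda>x. x) (\<lambda>x x'. (c x x', c' x x')) (\<lambda>r x. (d r x, d' r x)) p"
    by (auto simp: has_cocycle_def)
  obtain h where "ses_hom R (binary_sum Y Y) (\<lambda>(y, y'). y \<oplus>\<^bsub>Y\<^esub> y') h (\<lambda>x. x) ?P (baer_sum X Y S T)"
    using ses_hom_pushout[OF P Y plus] unfolding baer_sum_def by blast
  from has_cocycleI[OF lifts_ses_hom[OF X P this plus p]]
  show "has_cocycle R X Y (baer_sum X Y S T) (\<lambda>x. x)
          (\<lambda>x x'. c x x' \<oplus>\<^bsub>Y\<^esub> c' x x') (\<lambda>r x. d r x \<oplus>\<^bsub>Y\<^esub> d' r x)"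
    by simp
qed

lemma split_ses:
  assumes X: "left_module R X" and Y: "left_module R Y"
  shows short_exact_split_ses: "short_exact R Y (split_ses X Y) X"
    and has_cocycle_split_ses: "has_cocycle R X Y (split_ses X Y) (\<lambda>x. x) (\<lambda>_ _. \<zero>\<^bsub>Y\<^esub>) (\<lambda>_ _. \<zero>\<^bsub>Y\<^esub>)"
proof -
  interpret X: left_module R X by fact
  interpret Y: left_module R Y by fact
  show "short_exact R Y (split_ses X Y) X"
  proof (rule short_exactI[OF Y _ X])
    show "left_module R (mid (split_ses X Y))"
      by (simp add: split_ses_def left_module_binary_sum X Y)
    show "inc (split_ses X Y) \<in> mod_hom R Y (mid (split_ses X Y))"
      by (rule mod_homI) (auto simp: split_ses_def left_module_smult_zero[OF X])
    show "prj (split_ses X Y) \<in> mod_hom R (mid (split_ses X Y)) X"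
      by (rule mod_homI) (auto simp: split_ses_def)
  qed (auto simp: split_ses_def intro: bexI[of _ "(\<zero>\<^bsub>Y\<^esub>, _)"])
  have "lifts R X Y (split_ses X Y) (\<lambda>x. x) (\<lambda>_ _. \<zero>\<^bsub>Y\<^esub>) (\<lambda>_ _. \<zero>\<^bsub>Y\<^esub>) (\<lambda>x. (\<zero>\<^bsub>Y\<^esub>, x))"
    by (auto simp: lifts_def split_ses_def left_module_smult_zero[OF Y] X.smult_closed)
  then show "has_cocycle R X Y (split_ses X Y) (\<lambda>x. x) (\<lambda>_ _. \<zero>\<^bsub>Y\<^esub>) (\<lambda>_ _. \<zero>\<^bsub>Y\<^esub>)"
    by (rule has_cocycleI)
qed

lemma negated_inc:
  assumes S: "short_exact R Y S X"
  defines "T \<equiv> S\<lparr>inc := (\<lambda>y. inc S (\<ominus>\<^bsub>Y\<^esub> y))\<rparr>"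
  shows short_exact_negated_inc: "short_exact R Y T X"
    and has_cocycle_negated_inc: "has_cocycle R X Y S (\<lambda>x. x) c d \<Longrightarrow>
      has_cocycle R X Y T (\<lambda>x. x) (\<lambda>x x'. \<ominus>\<^bsub>Y\<^esub> c x x') (\<lambda>r x. \<ominus>\<^bsub>Y\<^esub> d r x)"
proof -
  interpret S: exact_seq R Y S X by (rule exact_seq.intro) fact
  have [simp]: "mid T = mid S" "prj T = prj S" "inc T = (\<lambda>y. inc S (\<ominus>\<^bsub>Y\<^esub> y))" by (simp_all add: T_def)
  show "short_exact R Y T X"
  proof (rule short_exactI)
    show "inc T \<in> mod_hom R Y (mid T)"
      by simp (rule mod_hom_compose[OF mod_hom_uminus[OF S.Y.left_module_axioms mod_hom_id] S.inc_hom])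
    show "y = \<zero>\<^bsub>Y\<^esub>" if "y \<in> carrier Y" "inc T y = \<zero>\<^bsub>mid T\<^esub>" for y
    proof -
      have "inc S (\<ominus>\<^bsub>Y\<^esub> y) = inc S \<zero>\<^bsub>Y\<^esub>" using that by simp
      then have "\<ominus>\<^bsub>Y\<^esub> y = \<zero>\<^bsub>Y\<^esub>" using that by (subst (asm) S.inc_eq_iff) auto
      then show ?thesis using that by (metis S.Y.M.r_neg S.Y.M.r_zero)
    qed
    show "\<exists>y\<in>carrier Y. m = inc T y" if m: "m \<in> carrier (mid T)" "prj T m = \<zero>\<^bsub>X\<^esub>" for m
    proof -
      obtain y where "y \<in> carrier Y" "m = inc S y"
        by (rule S.prj_eq_zeroE[of m]) (use m in simp_all)
      then show ?thesis by (intro bexI[of _ "\<ominus>\<^bsub>Y\<^esub> y"]) auto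
    qed
    show "\<exists>m\<in>carrier (mid T). prj T m = x" if "x \<in> carrier X" for x
      using that by (auto elim: S.prj_surjE)
  qed (use S.Y.left_module_axioms S.M.left_module_axioms S.X.left_module_axioms S.prj_hom in simp_all)
  assume "has_cocycle R X Y S (\<lambda>x. x) c d"
  then obtain t where "lifts R X Y S (\<lambda>x. x) c d t" by (auto simp: has_cocycle_def)
  then have "lifts R X Y T (\<lambda>x. x) (\<lambda>x x'. \<ominus>\<^bsub>Y\<^esub> c x x') (\<lambda>r x. \<ominus>\<^bsub>Y\<^esub> d r x) t"
    by (simp add: lifts_def)
  then show "has_cocycle R X Y T (\<lambda>x. x) (\<lambda>x x'. \<ominus>\<^bsub>Y\<^esub> c x x') (\<lambda>r x. \<ominus>\<^bsub>Y\<^esub> d r x)"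
    by (rule has_cocycleI)
qed

lemma ses_transport:
  fixes S :: "('r, 'y, 'm, 'x) ses" and C :: "'n set"
  assumes S: "short_exact R Y S X" and b: "bij_betw b C (carrier (mid S))"
  shows "\<exists>T :: ('r, 'y, 'n, 'x) ses. short_exact R Y T X \<and> ses_equiv R Y S T"
proof -
  interpret S: exact_seq R Y S X by (rule exact_seq.intro) fact
  define b' where "b' = inv_into C b"
  have b': "b' m \<in> C" "b (b' m) = m" if "m \<in> carrier (mid S)" for m
    using that b by (auto simp: b'_def bij_betw_def f_inv_into_f inv_into_into)
  have bb: "b p \<in> carrier (mid S)" "b' (b p) = p" if "p \<in> C" for p
    using that b by (auto simp: b'_def bij_betw_def)
  define T where "T = \<lparr>inc = (\<lambda>y. b' (inc S y)),
    mid = \<lparr>carrier = C, monoid.mult = undefined, one = undefined, ring.zero = b' \<zero>\<^bsub>mid S\<^esub>,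
      add = (\<lambda>p q. b' (b p \<oplus>\<^bsub>mid S\<^esub> b q)), smult = (\<lambda>r p. b' (r \<odot>\<^bsub>mid S\<^esub> b p))\<rparr>,
    prj = (\<lambda>p. prj S (b p))\<rparr>"
  have T [simp]: "inc T y = b' (inc S y)" "carrier (mid T) = C" "\<zero>\<^bsub>mid T\<^esub> = b' \<zero>\<^bsub>mid S\<^esub>"
    "p \<oplus>\<^bsub>mid T\<^esub> q = b' (b p \<oplus>\<^bsub>mid S\<^esub> b q)" "r \<odot>\<^bsub>mid T\<^esub> p = b' (r \<odot>\<^bsub>mid S\<^esub> b p)"
    "prj T p = prj S (b p)" for y p q r
    by (simp_all add: T_def)
  have hom: "b' \<in> mod_hom R (mid S) (mid T)"
    by (rule mod_homI) (simp_all add: b' S.M.smult_closed)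
  have "p \<in> b' ` carrier (mid S)" if "p \<in> C" for p
    by (rule image_eqI[of _ _ "b p"]) (use bb that in auto)
  then have "b' ` carrier (mid S) = C" using b' by blast
  then have lm: "left_module R (mid T)"
    by (intro left_module_surj_image[OF S.M.left_module_axioms, of b']) (auto simp: b')
  have "short_exact R Y T X"
  proof (rule short_exactI[OF S.Y.left_module_axioms lm S.X.left_module_axioms])
    show "inc T \<in> mod_hom R Y (mid T)"
      using mod_hom_compose[OF S.inc_hom hom] by (simp add: T_def)
    show "prj T \<in> mod_hom R (mid T) X"
      by (rule mod_homI) (simp_all add: bb b' S.prj_add S.prj_smult S.M.smult_closed)
  next
    fix y assume y: "y \<in> carrier Y" "inc T y = \<zero>\<^bsub>mid T\<^esub>"
    then have eq: "b' (inc S y) = b' \<zero>\<^bsub>mid S\<^esub>" by simp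
    have "inc S y = b (b' (inc S y))" using y(1) by (simp add: b')
    also have "\<dots> = inc S \<zero>\<^bsub>Y\<^esub>" unfolding eq by (simp add: b')
    finally show "y = \<zero>\<^bsub>Y\<^esub>" using y by (subst (asm) S.inc_eq_iff) auto
  next
    fix p assume p: "p \<in> carrier (mid T)" "prj T p = \<zero>\<^bsub>X\<^esub>"
    then obtain y where "y \<in> carrier Y" "b p = inc S y"
      using S.prj_eq_zeroE[of "b p"] bb(1)[of p] by auto
    then show "\<exists>y\<in>carrier Y. p = inc T y"
      using p bb(2)[of p] by (intro bexI[of _ y]) auto
  next
    fix x assume "x \<in> carrier X"
    then obtain m where "m \<in> carrier (mid S)" "prj S m = x" by (rule S.prj_surjE)
    then show "\<exists>p\<in>carrier (mid T). prj T p = x"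
      by (intro bexI[of _ "b' m"]) (auto simp: b')
  qed (simp add: b')
  moreover from this S hom have "ses_equiv R Y S T"
    by (subst ses_equiv_iff_ses_hom) (auto simp: ses_hom_def b')
  ultimately show ?thesis by blast
qed

lemma ext_class_nonempty:
  assumes S: "short_exact R Y S X"
  shows "ext_class R X Y S \<noteq> {}"
proof -
  interpret S: exact_seq R Y S X by (rule exact_seq.intro) fact
  obtain c d where "has_cocycle R X Y S (\<lambda>x. x) c d"
    using S.has_cocycle_ex[OF S.X.left_module_axioms mod_hom_id] by blast
  then obtain t where "lifts R X Y S (\<lambda>x. x) c d t" by (auto simp: has_cocycle_def)
  note t = liftsD(1,2)[OF this]
  let ?b = "\<lambda>(y, x). inc S y \<oplus>\<^bsub>mid S\<^esub> t x"
  have "bij_betw ?b (carrier Y \<times> carrier X) (carrier (mid S))"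
  proof (rule bij_betw_imageI)
    show "inj_on ?b (carrier Y \<times> carrier X)"
    proof (clarsimp simp: inj_on_def)
      fix y x y' x' assume yx: "y \<in> carrier Y" "x \<in> carrier X" "y' \<in> carrier Y" "x' \<in> carrier X"
        and eq: "inc S y \<oplus>\<^bsub>mid S\<^esub> t x = inc S y' \<oplus>\<^bsub>mid S\<^esub> t x'"
      from arg_cong[OF eq, of "prj S"] yx have "x = x'" by (simp add: S.prj_add t)
      then show "y = y' \<and> x = x'" using eq yx by (simp add: t S.inc_eq_iff)
    qed
    have "m \<in> ?b ` (carrier Y \<times> carrier X)" if m: "m \<in> carrier (mid S)" for m
    proof -
      have x: "prj S m \<in> carrier X" using m by (rule S.prj_closed)
      obtain y where y: "y \<in> carrier Y" "m = inc S y \<oplus>\<^bsub>mid S\<^esub> t (prj S m)"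
        by (rule S.prj_eqE[OF m t(1)[OF x] t(2)[OF x, symmetric]])
      show ?thesis by (rule image_eqI[of _ _ "(y, prj S m)"]) (use x y in simp_all)
    qed
    then show "?b ` (carrier Y \<times> carrier X) = carrier (mid S)" using t by auto
  qed
  from ses_transport[OF S this] show ?thesis by (auto simp: ext_class_def)
qed

definition cocycle_class ::
    "('r, 'e) ring_scheme \<Rightarrow> ('r, 'x) module \<Rightarrow> ('r, 'y) module
      \<Rightarrow> ('x \<Rightarrow> 'x \<Rightarrow> 'y) \<Rightarrow> ('r \<Rightarrow> 'x \<Rightarrow> 'y) \<Rightarrow> ('r, 'y, 'y \<times> 'x, 'x) ses set"
  where "cocycle_class R X Y c d = {T. short_exact R Y T X \<and> has_cocycle R X Y T (\<lambda>x. x) c d}"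

lemma ext_class_eq_cocycle_class:
  assumes "short_exact R Y S X" "has_cocycle R X Y S (\<lambda>x. x) c d"
  shows "ext_class R X Y S = cocycle_class R X Y c d"
  using ses_equiv_iff_cocycle[OF assms(1) _ assms(2)] by (auto simp: ext_class_def cocycle_class_def)

lemma cocycle_class_nonempty:
  assumes "short_exact R Y S X" "has_cocycle R X Y S (\<lambda>x. x) c d"
  shows "cocycle_class R X Y c d \<noteq> {}"
  using ext_class_nonempty[OF assms(1)] ext_class_eq_cocycle_class[OF assms] by simp

lemma cocycle_class_cong:
  assumes "left_module R X"
    and "\<And>x x'. \<lbrakk>x \<in> carrier X; x' \<in> carrier X\<rbrakk> \<Longrightarrow> c x x' = c' x x'"
    and "\<And>r x. \<lbrakk>r \<in> carrier R; x \<in> carrier X\<rbrakk> \<Longrightarrow> d r x = d' r x"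
  shows "cocycle_class R X Y c d = cocycle_class R X Y c' d'"
  unfolding cocycle_class_def by (intro Collect_cong conj_cong has_cocycle_cong assms refl)

lemma cocycle_class_closed:
  assumes "cocycle_class R X Y c d \<noteq> {}"
  shows "\<lbrakk>x \<in> carrier X; x' \<in> carrier X\<rbrakk> \<Longrightarrow> c x x' \<in> carrier Y"
    and "\<lbrakk>r \<in> carrier R; x \<in> carrier X\<rbrakk> \<Longrightarrow> d r x \<in> carrier Y"
  using assms by (auto simp: cocycle_class_def dest: has_cocycle_closed)

lemma carrier_Ext1:
  fixes X :: "('r, 'x) module" and Y :: "('r, 'y) module"
  shows "carrier (Ext1 R X Y)
    = ext_class R X Y ` {S :: ('r, 'y, 'y \<times> 'x, 'x) ses. short_exact R Y S X}"
proof -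
  let ?A = "{S :: ('r, 'y, 'y \<times> 'x, 'x) ses. short_exact R Y S X}"
  let ?r = "{(S, T). S \<in> ?A \<and> T \<in> ?A \<and> ses_equiv R Y S T}"
  have r: "?r `` {S} = ext_class R X Y S" if "short_exact R Y S X" for S
    using that by (auto simp: ext_class_def)
  have "carrier (Ext1 R X Y) = ?A // ?r"
    unfolding Ext1_def by simp
  also have "\<dots> = (\<lambda>S. ?r `` {S}) ` ?A"
    unfolding quotient_def by (simp only: UNION_singleton_eq_range)
  also have "\<dots> = ext_class R X Y ` ?A"
    by (intro image_cong refl r) simp
  finally show ?thesis .
qed

lemma mem_carrier_Ext1_iff:
  fixes X :: "('r, 'x) module" and Y :: "('r, 'y) module"
  shows "C \<in> carrier (Ext1 R X Y) \<longleftrightarrow> (\<exists>c d. C = cocycle_class R X Y c d) \<and> C \<noteq> {}"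
proof
  assume "C \<in> carrier (Ext1 R X Y)"
  then obtain S :: "('r, 'y, 'y \<times> 'x, 'x) ses" where S: "short_exact R Y S X" "C = ext_class R X Y S"
    unfolding carrier_Ext1 by blast
  obtain c d where "has_cocycle R X Y S (\<lambda>x. x) c d"
    using exact_seq.has_cocycle_ex[OF exact_seq.intro[OF S(1)] _ mod_hom_id] S(1)
    by (auto simp: short_exact_def)
  then show "(\<exists>c d. C = cocycle_class R X Y c d) \<and> C \<noteq> {}"
    using S ext_class_eq_cocycle_class ext_class_nonempty by metis
next
  assume "(\<exists>c d. C = cocycle_class R X Y c d) \<and> C \<noteq> {}"
  then obtain c d T where T: "C = cocycle_class R X Y c d" "T \<in> C" by auto
  then have "short_exact R Y T X" "has_cocycle R X Y T (\<lambda>x. x) c d" by (auto simp: cocycle_class_def)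
  from ext_class_eq_cocycle_class[OF this] this T show "C \<in> carrier (Ext1 R X Y)"
    by (auto simp: carrier_Ext1)
qed

lemma Ext1_add:
  assumes "cocycle_class R X Y c d \<noteq> {}" "cocycle_class R X Y c' d' \<noteq> {}"
  shows "cocycle_class R X Y c d \<oplus>\<^bsub>Ext1 R X Y\<^esub> cocycle_class R X Y c' d'
      = cocycle_class R X Y (\<lambda>x x'. c x x' \<oplus>\<^bsub>Y\<^esub> c' x x') (\<lambda>r x. d r x \<oplus>\<^bsub>Y\<^esub> d' r x)"
    and "cocycle_class R X Y (\<lambda>x x'. c x x' \<oplus>\<^bsub>Y\<^esub> c' x x') (\<lambda>r x. d r x \<oplus>\<^bsub>Y\<^esub> d' r x) \<noteq> {}"
proof -
  let ?C = "cocycle_class R X Y (\<lambda>x x'. c x x' \<oplus>\<^bsub>Y\<^esub> c' x x') (\<lambda>r x. d r x \<oplus>\<^bsub>Y\<^esub> d' r x)"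
  have *: "ext_class R X Y (baer_sum X Y S T) = ?C"
    if "S \<in> cocycle_class R X Y c d" "T \<in> cocycle_class R X Y c' d'" for S T
    using that baer_sum[of R Y S X T] unfolding cocycle_class_def[of R X Y c d] cocycle_class_def[of R X Y c' d']
    by (intro ext_class_eq_cocycle_class) blast+
  have "cocycle_class R X Y c d \<oplus>\<^bsub>Ext1 R X Y\<^esub> cocycle_class R X Y c' d'
      = (\<Union>S\<in>cocycle_class R X Y c d. \<Union>T\<in>cocycle_class R X Y c' d'. ext_class R X Y (baer_sum X Y S T))"
    by (simp add: Ext1_def)
  also have "\<dots> = (\<Union>S\<in>cocycle_class R X Y c d. \<Union>T\<in>cocycle_class R X Y c' d'. ?C)"
    by (intro SUP_cong refl *)
  also have "\<dots> = ?C" using assms by simp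
  finally show "cocycle_class R X Y c d \<oplus>\<^bsub>Ext1 R X Y\<^esub> cocycle_class R X Y c' d' = ?C" .
  obtain S T where ST: "S \<in> cocycle_class R X Y c d" "T \<in> cocycle_class R X Y c' d'"
    using assms by blast
  then have "short_exact R Y (baer_sum X Y S T) X"
    by (intro short_exact_baer_sum) (auto simp: cocycle_class_def)
  from ext_class_nonempty[OF this] *[OF ST] show "?C \<noteq> {}" by simp
qed

lemma Ext1_zero:
  assumes "left_module R X" "left_module R Y"
  shows "\<zero>\<^bsub>Ext1 R X Y\<^esub> = cocycle_class R X Y (\<lambda>_ _. \<zero>\<^bsub>Y\<^esub>) (\<lambda>_ _. \<zero>\<^bsub>Y\<^esub>)"
    and "cocycle_class R X Y (\<lambda>_ _. \<zero>\<^bsub>Y\<^esub>) (\<lambda>_ _. \<zero>\<^bsub>Y\<^esub>) \<noteq> {}"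
  using ext_class_eq_cocycle_class[OF split_ses[OF assms]] cocycle_class_nonempty[OF split_ses[OF assms]]
  by (simp_all add: Ext1_def)

lemma Ext1_abelian_group:
  fixes X :: "('r, 'x) module" and Y :: "('r, 'y) module"
  assumes X: "left_module R X" and Y: "left_module R Y"
  shows "abelian_group (Ext1 R X Y)"
proof (rule abelian_groupI)
  interpret Y: left_module R Y by fact
  note ext = mem_carrier_Ext1_iff and cong = cocycle_class_cong[OF X]
  show "C \<oplus>\<^bsub>Ext1 R X Y\<^esub> D \<in> carrier (Ext1 R X Y)"
    if "C \<in> carrier (Ext1 R X Y)" "D \<in> carrier (Ext1 R X Y)" for C D
    using that unfolding ext by (elim conjE exE) (simp add: Ext1_add, blast)
  show "\<zero>\<^bsub>Ext1 R X Y\<^esub> \<in> carrier (Ext1 R X Y)"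
    unfolding ext using Ext1_zero[OF X Y] by blast
  fix C assume "C \<in> carrier (Ext1 R X Y)"
  then obtain c d where C: "C = cocycle_class R X Y c d" "cocycle_class R X Y c d \<noteq> {}"
    by (auto simp: ext)
  note c = cocycle_class_closed[OF C(2)]
  show "\<zero>\<^bsub>Ext1 R X Y\<^esub> \<oplus>\<^bsub>Ext1 R X Y\<^esub> C = C"
    unfolding C(1) Ext1_zero[OF X Y] Ext1_add[OF Ext1_zero(2)[OF X Y] C(2)]
    by (rule cong) (simp_all add: c)
  show "\<exists>D\<in>carrier (Ext1 R X Y). D \<oplus>\<^bsub>Ext1 R X Y\<^esub> C = \<zero>\<^bsub>Ext1 R X Y\<^esub>"
  proof -
    obtain S :: "('r, 'y, 'y \<times> 'x, 'x) ses"
      where S: "short_exact R Y S X" "has_cocycle R X Y S (\<lambda>x. x) c d"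
      using C(2) by (auto simp: cocycle_class_def)
    let ?D = "cocycle_class R X Y (\<lambda>x x'. \<ominus>\<^bsub>Y\<^esub> c x x') (\<lambda>r x. \<ominus>\<^bsub>Y\<^esub> d r x)"
    have D: "?D \<noteq> {}"
      by (rule cocycle_class_nonempty[OF negated_inc[OF S(1)]]) (rule S(2))
    have "?D \<oplus>\<^bsub>Ext1 R X Y\<^esub> C = \<zero>\<^bsub>Ext1 R X Y\<^esub>"
      unfolding C(1) Ext1_zero[OF X Y] Ext1_add[OF D C(2)]
      by (rule cong) (simp_all add: c Y.M.l_neg)
    moreover have "?D \<in> carrier (Ext1 R X Y)"
      using D unfolding ext by blast
    ultimately show ?thesis by blast
  qed
  fix D assume "D \<in> carrier (Ext1 R X Y)"
  then obtain c' d' where D: "D = cocycle_class R X Y c' d'" "cocycle_class R X Y c' d' \<noteq> {}"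
    by (auto simp: ext)
  note d = cocycle_class_closed[OF D(2)]
  show "C \<oplus>\<^bsub>Ext1 R X Y\<^esub> D = D \<oplus>\<^bsub>Ext1 R X Y\<^esub> C"
    unfolding C(1) D(1) Ext1_add[OF C(2) D(2)] Ext1_add[OF D(2) C(2)]
    by (rule cong) (simp_all add: c d Y.M.a_comm)
  fix E assume "E \<in> carrier (Ext1 R X Y)"
  then obtain c'' d'' where E: "E = cocycle_class R X Y c'' d''" "cocycle_class R X Y c'' d'' \<noteq> {}"
    by (auto simp: ext)
  note e = cocycle_class_closed[OF E(2)]
  show "C \<oplus>\<^bsub>Ext1 R X Y\<^esub> D \<oplus>\<^bsub>Ext1 R X Y\<^esub> E = C \<oplus>\<^bsub>Ext1 R X Y\<^esub> (D \<oplus>\<^bsub>Ext1 R X Y\<^esub> E)"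
    unfolding C(1) D(1) E(1) Ext1_add[OF C(2) D(2)] Ext1_add[OF D(2) E(2)]
      Ext1_add[OF Ext1_add(2)[OF C(2) D(2)] E(2)] Ext1_add[OF C(2) Ext1_add(2)[OF D(2) E(2)]]
    by (rule cong) (simp_all add: c d e Y.M.a_assoc)
qed

lemma connecting_hom_eq_cocycle_class:
  assumes S: "short_exact R Y S Z" and X: "left_module R X" and f: "f \<in> mod_hom R X Z"
    and c: "has_cocycle R X Y S f c d"
  shows "connecting_hom R X Y S f = cocycle_class R X Y c d" "cocycle_class R X Y c d \<noteq> {}"
proof -
  have "has_cocycle R X Y (pullback X f S) (\<lambda>x. x) c d"
    using c by (subst has_cocycle_pullback_iff[OF S X X f mod_hom_id])
  note pb = short_exact_pullback[OF S X f] this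
  show "connecting_hom R X Y S f = cocycle_class R X Y c d" "cocycle_class R X Y c d \<noteq> {}"
    using ext_class_eq_cocycle_class[OF pb] cocycle_class_nonempty[OF pb]
    by (simp_all add: connecting_hom_def)
qed

lemma connecting_hom_closed:
  assumes "short_exact R Y S Z" "left_module R X" "f \<in> mod_hom R X Z"
  shows "connecting_hom R X Y S f \<in> carrier (Ext1 R X Y)"
  using exact_seq.has_cocycle_ex[OF exact_seq.intro[OF assms(1)] assms(2,3)]
    connecting_hom_eq_cocycle_class[OF assms] unfolding mem_carrier_Ext1_iff by metis

lemma connecting_hom_cong:
  assumes "short_exact R Y S Z" "left_module R X" "f \<in> mod_hom R X Z"
    and "\<And>x. x \<in> carrier X \<Longrightarrow> f x = g x"
  shows "connecting_hom R X Y S f = connecting_hom R X Y S g"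
proof -
  obtain c d where c: "has_cocycle R X Y S f c d"
    using exact_seq.has_cocycle_ex[OF exact_seq.intro[OF assms(1)] assms(2,3)] by blast
  have "has_cocycle R X Y S f c d \<longleftrightarrow> has_cocycle R X Y S g c d"
    by (rule has_cocycle_cong) (use assms in auto)
  with c have "has_cocycle R X Y S g c d" by simp
  moreover have "g \<in> mod_hom R X Z" using assms(3) mod_hom_cong[OF assms(2,4)] by simp
  ultimately show ?thesis
    using c assms(1-3) by (simp add: connecting_hom_eq_cocycle_class)
qed

lemma connecting_hom_add:
  assumes S: "short_exact R Y S Z" and X: "left_module R X"
    and f: "f \<in> mod_hom R X Z" and g: "g \<in> mod_hom R X Z"
  shows "connecting_hom R X Y S (\<lambda>x. f x \<oplus>\<^bsub>Z\<^esub> g x)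
    = connecting_hom R X Y S f \<oplus>\<^bsub>Ext1 R X Y\<^esub> connecting_hom R X Y S g"
proof -
  note ex = exact_seq.has_cocycle_ex[OF exact_seq.intro[OF S] X]
  obtain c d c' d' where c: "has_cocycle R X Y S f c d" and c': "has_cocycle R X Y S g c' d'"
    using ex[OF f] ex[OF g] by blast
  have Z: "left_module R Z" using S by (simp add: short_exact_def)
  note eq = connecting_hom_eq_cocycle_class[OF S X]
  show ?thesis
    using eq[OF mod_hom_plus[OF Z f g] has_cocycle_plus[OF S X c c']] eq[OF f c] eq[OF g c']
    by (simp add: Ext1_add)
qed

lemma connecting_hom_smult:
  assumes S: "short_exact R Y S Z" and X: "left_module R X"
    and f: "f \<in> mod_hom R X Z" and g: "g \<in> mod_hom R X X"
  shows "connecting_hom R X Y S (\<lambda>x. f (g x)) = g \<odot>\<^bsub>Ext1 R X Y\<^esub> connecting_hom R X Y S f"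
proof -
  obtain c d where c: "has_cocycle R X Y S f c d"
    using exact_seq.has_cocycle_ex[OF exact_seq.intro[OF S] X f] by blast
  note eq = connecting_hom_eq_cocycle_class[OF S X]
  let ?C = "cocycle_class R X Y (\<lambda>x x'. c (g x) (g x')) (\<lambda>r x. d r (g x))"
  have "ext_class R X Y (pullback X g T) = ?C" if "T \<in> cocycle_class R X Y c d" for T
  proof -
    have T: "short_exact R Y T X" "has_cocycle R X Y T (\<lambda>x. x) c d"
      using that by (auto simp: cocycle_class_def)
    show ?thesis
      using connecting_hom_eq_cocycle_class[OF T(1) X g has_cocycle_precompose[OF X g T(2)]]
      by (simp add: connecting_hom_def)
  qed
  then have "(\<Union>T\<in>cocycle_class R X Y c d. ext_class R X Y (pullback X g T)) = ?C"
    using eq(2)[OF f c] by simp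
  then show ?thesis
    using eq[OF f c] eq[OF mod_hom_compose[OF g f] has_cocycle_precompose[OF X g c]]
    by (simp add: Ext1_def)
qed

lemma ext_class_eq_connecting_hom_iff:
  fixes T :: "('r, 'y, 'y \<times> 'x, 'x) ses"
  assumes T: "short_exact R Y T X" and S: "short_exact R Y S Z" and f: "f \<in> mod_hom R X Z"
  shows "ext_class R X Y T = connecting_hom R X Y S f \<longleftrightarrow> (\<exists>h. ses_hom R Y (\<lambda>y. y) h f T S)"
proof -
  have X: "left_module R X" using T by (simp add: short_exact_def)
  show ?thesis
  proof
    assume eq: "ext_class R X Y T = connecting_hom R X Y S f"
    obtain c d where c: "has_cocycle R X Y S f c d"
      using exact_seq.has_cocycle_ex[OF exact_seq.intro[OF S] X f] by blast
    have "T \<in> ext_class R X Y T" using T ses_equiv_refl by (auto simp: ext_class_def)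
    then have "has_cocycle R X Y T (\<lambda>x. x) c d"
      unfolding eq connecting_hom_eq_cocycle_class[OF S X f c] by (simp add: cocycle_class_def)
    then show "\<exists>h. ses_hom R Y (\<lambda>y. y) h f T S" by (rule ses_hom_from_cocycle[OF T S _ c])
  next
    assume "\<exists>h. ses_hom R Y (\<lambda>y. y) h f T S"
    then obtain h where h: "ses_hom R Y (\<lambda>y. y) h f T S" ..
    obtain c d where c: "has_cocycle R X Y T (\<lambda>x. x) c d"
      using exact_seq.has_cocycle_ex[OF exact_seq.intro[OF T] X mod_hom_id] by blast
    show "ext_class R X Y T = connecting_hom R X Y S f"
      using ext_class_eq_cocycle_class[OF T c]
        connecting_hom_eq_cocycle_class[OF S X f ses_hom_has_cocycle[OF T h X c]] by simp
  qed
qed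

lemma pushout_equivI:
  assumes S: "short_exact R A S X" and T: "short_exact R B T X" and a: "a \<in> mod_hom R A B"
    and g: "ses_hom R A a g (\<lambda>x. x) S T"
  shows "ses_equiv R B (pushout A B a S) T"
proof -
  have X: "left_module R X" and B: "left_module R B" using T by (simp_all add: short_exact_def)
  obtain c d where "has_cocycle R X A S (\<lambda>x. x) c d"
    using exact_seq.has_cocycle_ex[OF exact_seq.intro[OF S] X mod_hom_id] by blast
  then obtain t where t: "lifts R X A S (\<lambda>x. x) c d t" by (auto simp: has_cocycle_def)
  obtain h where h: "ses_hom R A a h (\<lambda>x. x) S (pushout A B a S)"
    using ses_hom_pushout[OF S B a] by blast
  show ?thesis
    using has_cocycleI[OF lifts_ses_hom[OF X S h a t]] has_cocycleI[OF lifts_ses_hom[OF X S g a t]]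
    by (subst ses_equiv_iff_cocycle[OF short_exact_pushout[OF S B a] T])
qed

section \<open>Universal sequences\<close>

lemma gfinprod_hom:
  assumes "comm_group G" "comm_group H" and f: "f \<in> hom G H"
    and x: "\<And>k. k \<in> K \<Longrightarrow> x k \<in> carrier G" and fin: "finite {k\<in>K. x k \<noteq> \<one>\<^bsub>G\<^esub>}"
  shows "f (gfinprod G x K) = gfinprod H (\<lambda>k. f (x k)) K"
proof -
  interpret G: comm_group G by fact
  interpret H: comm_group H by fact
  have one: "f \<one>\<^bsub>G\<^esub> = \<one>\<^bsub>H\<^esub>" using f G.group_axioms H.group_axioms by (rule hom_one)
  let ?F = "{k\<in>K. x k \<noteq> \<one>\<^bsub>G\<^esub>}"
  have closed: "f (x k) \<in> carrier H" if "k \<in> K" for k using f x[OF that] by (auto simp: hom_def)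
  have "f (finprod G x F) = finprod H (\<lambda>k. f (x k)) F" if "finite F" "F \<subseteq> K" for F
    using that
  proof (induction F rule: finite_induct)
    case (insert k F)
    then have "x \<in> F \<rightarrow> carrier G" "(\<lambda>k. f (x k)) \<in> F \<rightarrow> carrier H" "x k \<in> carrier G" "k \<in> K"
      using x closed by auto
    then show ?case using insert closed[of k] f by (simp add: hom_mult[OF f])
  qed (simp add: one)
  from this[OF fin] have "f (gfinprod G x K) = finprod H (\<lambda>k. f (x k)) ?F"
    using fin by (simp add: gfinprod_def)
  also have "\<dots> = gfinprod H (\<lambda>k. f (x k)) ?F"
    using fin closed by (intro H.gfinprod_eq_finprod[symmetric]) auto
  also have "\<dots> = gfinprod H (\<lambda>k. f (x k)) K"
    using closed by (intro H.gfinprod_mono_neutral_cong_left) (auto simp: one)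
  finally show ?thesis .
qed

lemma gfinprod_delta:
  assumes "comm_group G" "k \<in> K" "x \<in> carrier G"
  shows "gfinprod G (\<lambda>j. if j = k then x else \<one>\<^bsub>G\<^esub>) K = x"
proof -
  interpret G: comm_group G by fact
  have "gfinprod G (\<lambda>j. if j = k then x else \<one>\<^bsub>G\<^esub>) K = gfinprod G (\<lambda>j. x) {k}"
    using assms(2,3) by (intro G.gfinprod_mono_neutral_cong_right) auto
  then show ?thesis using assms(3) by simp
qed

lemma left_module_comm_group: "left_module R M \<Longrightarrow> comm_group (add_monoid M)"
  using abelian_group.a_comm_group left_module_abelian by blast

lemma mod_hom_hom: "h \<in> mod_hom R M N \<Longrightarrow> h \<in> hom (add_monoid M) (add_monoid N)"
  by (simp add: mod_hom_def)

lemma gsum_mod_hom: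
  assumes N: "left_module R N" and A: "\<And>k. k \<in> K \<Longrightarrow> left_module R (A k)"
    and h: "\<And>k. k \<in> K \<Longrightarrow> h k \<in> mod_hom R (A k) N"
  shows "(\<lambda>f. gfinprod (add_monoid N) (\<lambda>k. h k (f k)) K) \<in> mod_hom R (direct_sum K A) N"
proof -
  interpret N: left_module R N by fact
  note NG = left_module_comm_group[OF N]
  note NGM = comm_group.axioms(1)[OF NG]
  have hom: "(\<lambda>f. gfinprod (add_monoid N) (\<lambda>k. h k (f k)) K)
      \<in> hom (sum_group K (\<lambda>k. add_monoid (A k))) (add_monoid N)"
    using h A by (intro comm_group.hom_group_sum[OF NG])
      (blast intro: mod_hom_hom abelian_group.a_group left_module_abelian)+
  note car = carrier_direct_sum[of K R A, OF A]
  have ds: "carrier (direct_sum K A) = carrier (sum_group K (\<lambda>k. add_monoid (A k)))"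
    "f \<oplus>\<^bsub>direct_sum K A\<^esub> g = f \<otimes>\<^bsub>sum_group K (\<lambda>k. add_monoid (A k))\<^esub> g" for f g
    by (simp_all add: direct_sum_def module_of_def)
  show ?thesis
  proof (rule mod_homI)
    fix r f assume r: "r \<in> carrier R" and f: "f \<in> carrier (direct_sum K A)"
    have hf: "h k (f k) \<in> carrier N" if "k \<in> K" for k
      using f that mod_hom_closed[OF h[OF that]] by (auto simp: car)
    have "finite {k\<in>K. f k \<noteq> \<zero>\<^bsub>A k\<^esub>}" using f by (simp add: car)
    then have fin: "finite {k\<in>K. h k (f k) \<noteq> \<zero>\<^bsub>N\<^esub>}"
      by (rule rev_finite_subset) (auto simp: mod_hom_zero[OF A N h])
    have "(\<lambda>x. r \<odot>\<^bsub>N\<^esub> x) \<in> hom (add_monoid N) (add_monoid N)"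
      using r by (auto simp: hom_def N.smult_closed N.smult_r_distr)
    from gfinprod_hom[OF NG NG this, of K "\<lambda>k. h k (f k)"]
    have "r \<odot>\<^bsub>N\<^esub> gfinprod (add_monoid N) (\<lambda>k. h k (f k)) K
        = gfinprod (add_monoid N) (\<lambda>k. r \<odot>\<^bsub>N\<^esub> h k (f k)) K"
      using hf fin by simp
    also have "\<dots> = gfinprod (add_monoid N) (\<lambda>k. h k ((r \<odot>\<^bsub>direct_sum K A\<^esub> f) k)) K"
      using f r hf
      by (intro comm_monoid.gfinprod_cong[OF NGM])
         (auto simp: simp_implies_def car PiE_iff mod_hom_smult[OF h] N.smult_closed)
    finally show "gfinprod (add_monoid N) (\<lambda>k. h k ((r \<odot>\<^bsub>direct_sum K A\<^esub> f) k)) K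
      = r \<odot>\<^bsub>N\<^esub> gfinprod (add_monoid N) (\<lambda>k. h k (f k)) K" ..
  next
    fix f g assume "f \<in> carrier (direct_sum K A)" "g \<in> carrier (direct_sum K A)"
    then show "gfinprod (add_monoid N) (\<lambda>k. h k ((f \<oplus>\<^bsub>direct_sum K A\<^esub> g) k)) K
      = gfinprod (add_monoid N) (\<lambda>k. h k (f k)) K \<oplus>\<^bsub>N\<^esub> gfinprod (add_monoid N) (\<lambda>k. h k (g k)) K"
      using hom_mult[OF hom, of f g] unfolding ds by simp
  next
    fix f assume "f \<in> carrier (direct_sum K A)"
    then show "gfinprod (add_monoid N) (\<lambda>k. h k (f k)) K \<in> carrier N"
      using hom unfolding ds by (auto simp: hom_def)
  qed
qed

lemma summation_map_hom:
  assumes "left_module R Y"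
  shows "summation_map K Y \<in> mod_hom R (direct_sum K (\<lambda>_. Y)) Y"
  using gsum_mod_hom[of R Y K "\<lambda>_. Y" "\<lambda>_ y. y"] assms
  by (simp add: summation_map_def[abs_def] mod_hom_id)

definition direct_sum_inj :: "'k set \<Rightarrow> ('k \<Rightarrow> ('r, 'm) module) \<Rightarrow> 'k \<Rightarrow> 'm \<Rightarrow> 'k \<Rightarrow> 'm" where
  "direct_sum_inj K A k x = (\<lambda>j\<in>K. if j = k then x else \<zero>\<^bsub>A j\<^esub>)"

lemma direct_sum_inj_hom:
  assumes A: "\<And>k. k \<in> K \<Longrightarrow> left_module R (A k)" and k: "k \<in> K"
  shows "direct_sum_inj K A k \<in> mod_hom R (A k) (direct_sum K A)"
proof -
  have z: "\<zero>\<^bsub>A j\<^esub> \<in> carrier (A j)" "\<zero>\<^bsub>A j\<^esub> \<oplus>\<^bsub>A j\<^esub> \<zero>\<^bsub>A j\<^esub> = \<zero>\<^bsub>A j\<^esub>" if "j \<in> K" for j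
    using left_module_abelian[OF A[OF that]]
    by (simp_all add: abelian_group_def abelian_monoid.zero_closed abelian_monoid.l_zero)
  show ?thesis
  proof (rule mod_homI)
    fix x assume x: "x \<in> carrier (A k)"
    have "finite {j\<in>K. direct_sum_inj K A k x j \<noteq> \<zero>\<^bsub>A j\<^esub>}"
      by (rule finite_subset[of _ "{k}"]) (auto simp: direct_sum_inj_def)
    then show "direct_sum_inj K A k x \<in> carrier (direct_sum K A)"
      using x k z by (auto simp: carrier_direct_sum[of K R A, OF A] direct_sum_inj_def)
    show "direct_sum_inj K A k (r \<odot>\<^bsub>A k\<^esub> x) = r \<odot>\<^bsub>direct_sum K A\<^esub> direct_sum_inj K A k x"
      if "r \<in> carrier R" for r
      using that by (auto simp: direct_sum_inj_def left_module_smult_zero[OF A] intro!: restrict_ext)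
    show "direct_sum_inj K A k (x \<oplus>\<^bsub>A k\<^esub> y)
        = direct_sum_inj K A k x \<oplus>\<^bsub>direct_sum K A\<^esub> direct_sum_inj K A k y" for y
      by (auto simp: direct_sum_inj_def z intro!: restrict_ext)
  qed
qed

lemma summation_map_inj:
  assumes Y: "left_module R Y" and "k \<in> K" "y \<in> carrier Y"
  shows "summation_map K Y (direct_sum_inj K (\<lambda>_. Y) k y) = y"
proof -
  note YG = left_module_comm_group[OF Y]
  note YGM = comm_group.axioms(1)[OF YG]
  have "summation_map K Y (direct_sum_inj K (\<lambda>_. Y) k y)
      = gfinprod (add_monoid Y) (\<lambda>j. if j = k then y else \<one>\<^bsub>add_monoid Y\<^esub>) K"
    unfolding summation_map_def
    using assms monoid.one_closed[OF comm_monoid.axioms(1)[OF YGM]]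
    by (intro comm_monoid.gfinprod_cong[OF YGM]) (auto simp: simp_implies_def direct_sum_inj_def)
  also have "\<dots> = y"
    using assms by (intro gfinprod_delta YG) auto
  finally show ?thesis .
qed

lemma direct_sum_proj_hom:
  assumes "\<And>k. k \<in> K \<Longrightarrow> left_module R (A k)" and "k \<in> K"
  shows "(\<lambda>f. f k) \<in> mod_hom R (direct_sum K A) (A k)"
  using assms(2) by (intro mod_homI) (auto simp: carrier_direct_sum[of K R A, OF assms(1)])

lemma gsum_inj:
  assumes A: "\<And>k. k \<in> K \<Longrightarrow> left_module R (A k)" and R: "ring R"
    and z: "z \<in> carrier (direct_sum K A)"
  shows "gfinprod (add_monoid (direct_sum K A)) (\<lambda>k. direct_sum_inj K A k (z k)) K = z"
    (is "?g = z")
proof -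
  have Z: "left_module R (direct_sum K A)" using R A by (rule left_module_direct_sum)
  note car = carrier_direct_sum[of K R A, OF A]
  note ZG = left_module_comm_group[OF Z]
  note ZGM = comm_group.axioms(1)[OF ZG]
  have zk: "z k \<in> carrier (A k)" if "k \<in> K" for k using z that by (auto simp: car)
  have inj: "direct_sum_inj K A k (z k) \<in> carrier (direct_sum K A)" if "k \<in> K" for k
    using direct_sum_inj_hom[of K R A, OF A that] zk[OF that] by (rule mod_hom_closed)
  have zero: "direct_sum_inj K A k (z k) = \<zero>\<^bsub>direct_sum K A\<^esub>" if "k \<in> K" "z k = \<zero>\<^bsub>A k\<^esub>" for k
    using that by (auto simp: direct_sum_inj_def intro!: restrict_ext)
  have "finite {k\<in>K. z k \<noteq> \<zero>\<^bsub>A k\<^esub>}" using z by (simp add: car)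
  then have fin: "finite {k\<in>K. direct_sum_inj K A k (z k) \<noteq> \<one>\<^bsub>add_monoid (direct_sum K A)\<^esub>}"
    by (rule rev_finite_subset) (use zero in auto)
  have g: "?g \<in> carrier (direct_sum K A)"
    using comm_monoid.gfinprod_closed[OF ZGM, of "\<lambda>k. direct_sum_inj K A k (z k)" K] inj by auto
  show ?thesis
  proof (rule extensionalityI[of _ K])
    fix j assume j: "j \<in> K"
    note AG = left_module_comm_group[OF A[OF j]]
    note AGM = comm_group.axioms(1)[OF AG]
    have "?g j = gfinprod (add_monoid (A j)) (\<lambda>k. direct_sum_inj K A k (z k) j) K"
      using gfinprod_hom[OF ZG AG
          mod_hom_hom[OF direct_sum_proj_hom[of K R A, OF A j]], of K "\<lambda>k. direct_sum_inj K A k (z k)"]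
        inj fin by simp
    also have "\<dots> = gfinprod (add_monoid (A j)) (\<lambda>k. if k = j then z j else \<one>\<^bsub>add_monoid (A j)\<^esub>) K"
      using j zk monoid.one_closed[OF comm_monoid.axioms(1)[OF AGM]]
      by (intro comm_monoid.gfinprod_cong[OF AGM]) (auto simp: simp_implies_def direct_sum_inj_def)
    also have "\<dots> = z j"
      using j zk by (intro gfinprod_delta AG) auto
    finally show "?g j = z j" .
  next
    have "f \<in> extensional K" if "f \<in> carrier (direct_sum K A)" for f
      using that by (simp add: car PiE_iff)
    then show "?g \<in> extensional K" "z \<in> extensional K" using g z by blast+
  qed
qed

lemma ses_hom_compose:
  assumes "ses_hom R A a h g T S" "ses_hom R B b k l S U" "a \<in> mod_hom R A B"
  shows "ses_hom R A (\<lambda>y. b (a y)) (\<lambda>m. k (h m)) (\<lambda>x. l (g x)) T U"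
  using assms by (auto simp: ses_hom_def mod_hom_closed intro: mod_hom_compose)

lemma ses_hom_cong:
  assumes "ses_hom R A a h g T S" "\<And>y. y \<in> carrier A \<Longrightarrow> a y = a' y"
  shows "ses_hom R A a' h g T S"
  using assms by (simp add: ses_hom_def)

lemma pushout_direct_sum_equiv_iff:
  fixes A :: "'k \<Rightarrow> ('r, 'x) module" and E :: "'k \<Rightarrow> ('r, 'y, 'n, 'x) ses"
  assumes S: "short_exact R Y S (direct_sum K A)"
    and E: "\<And>k. k \<in> K \<Longrightarrow> short_exact R Y (E k) (A k)"
  shows "ses_equiv R Y
      (pushout (direct_sum K (\<lambda>_. Y)) Y (summation_map K Y) (direct_sum_ses K E)) S \<longleftrightarrow>
    (\<forall>k\<in>K. \<exists>h. ses_hom R Y (\<lambda>y. y) h (direct_sum_inj K A k) (E k) S)" (is "ses_equiv R Y ?U S \<longleftrightarrow> _")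
proof -
  interpret S: exact_seq R Y S "direct_sum K A" by (rule exact_seq.intro) fact
  have Y: "left_module R Y" and M: "left_module R (mid S)"
    by (rule S.Y.left_module_axioms S.M.left_module_axioms)+
  have R: "ring R" using Y by (rule left_module_ring)
  have A: "left_module R (A k)" and mE: "left_module R (mid (E k))" if "k \<in> K" for k
    using E[OF that] by (simp_all add: short_exact_def)
  have D: "short_exact R (direct_sum K (\<lambda>_. Y)) (direct_sum_ses K E) (direct_sum K A)"
    by (rule short_exact_direct_sum_ses[OF R E])
  note sum = summation_map_hom[OF Y, of K]
  have U: "short_exact R Y ?U (direct_sum K A)" by (rule short_exact_pushout[OF D Y sum])
  show ?thesis
  proof
    assume "ses_equiv R Y ?U S"
    then obtain h where h: "ses_hom R Y (\<lambda>y. y) h (\<lambda>x. x) ?U S"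
      using ses_equiv_iff_ses_hom[OF U S] by blast
    obtain p where p: "ses_hom R (direct_sum K (\<lambda>_. Y)) (summation_map K Y) p (\<lambda>x. x) (direct_sum_ses K E) ?U"
      using ses_hom_pushout[OF D Y sum] by blast
    show "\<forall>k\<in>K. \<exists>h. ses_hom R Y (\<lambda>y. y) h (direct_sum_inj K A k) (E k) S"
    proof
      fix k assume k: "k \<in> K"
      have incY: "direct_sum_inj K (\<lambda>_. Y) k \<in> mod_hom R Y (direct_sum K (\<lambda>_. Y))"
        using direct_sum_inj_hom[of K R "\<lambda>_. Y" k] Y k by simp
      have zero: "inc (E j) \<zero>\<^bsub>Y\<^esub> = \<zero>\<^bsub>mid (E j)\<^esub>" "prj (E j) \<zero>\<^bsub>mid (E j)\<^esub> = \<zero>\<^bsub>A j\<^esub>"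
        if "j \<in> K" for j
        using exact_seq.inc_zero[OF exact_seq.intro[OF E[OF that]]]
          exact_seq.prj_zero[OF exact_seq.intro[OF E[OF that]]] by simp_all
      have "ses_hom R Y (direct_sum_inj K (\<lambda>_. Y) k) (direct_sum_inj K (\<lambda>k. mid (E k)) k)
          (direct_sum_inj K A k) (E k) (direct_sum_ses K E)"
        using direct_sum_inj_hom[of K R "\<lambda>k. mid (E k)" k, OF mE k] k
        by (auto simp: ses_hom_def direct_sum_inj_def zero intro!: restrict_ext)
      from ses_hom_compose[OF ses_hom_compose[OF this p incY] h mod_hom_compose[OF incY sum]]
      have "ses_hom R Y (\<lambda>y. summation_map K Y (direct_sum_inj K (\<lambda>_. Y) k y))
          (\<lambda>m. h (p (direct_sum_inj K (\<lambda>k. mid (E k)) k m))) (direct_sum_inj K A k) (E k) S" .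
      from ses_hom_cong[OF this summation_map_inj[OF Y k]]
      show "\<exists>h. ses_hom R Y (\<lambda>y. y) h (direct_sum_inj K A k) (E k) S" by blast
    qed
  next
    assume "\<forall>k\<in>K. \<exists>h. ses_hom R Y (\<lambda>y. y) h (direct_sum_inj K A k) (E k) S"
    then obtain e where e: "\<And>k. k \<in> K \<Longrightarrow> ses_hom R Y (\<lambda>y. y) (e k) (direct_sum_inj K A k) (E k) S"
      by metis
    have e_hom: "e k \<in> mod_hom R (mid (E k)) (mid S)" if "k \<in> K" for k
      using e[OF that] by (simp add: ses_hom_def)
    let ?g = "\<lambda>m. gfinprod (add_monoid (mid S)) (\<lambda>k. e k (m k)) K"
    note YG = left_module_comm_group[OF Y]
    note YGM = comm_group.axioms(1)[OF YG]
    note MG = left_module_comm_group[OF M]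
    note MGM = comm_group.axioms(1)[OF MG]
    note ZG = left_module_comm_group[OF S.X.left_module_axioms]
    note ZGM = comm_group.axioms(1)[OF ZG]
    have "?g \<in> mod_hom R (direct_sum K (\<lambda>k. mid (E k))) (mid S)"
      using gsum_mod_hom[of R "mid S" K "\<lambda>k. mid (E k)" e, OF M mE e_hom] .
    moreover have "?g (inc (direct_sum_ses K E) y) = inc S (summation_map K Y y)"
      if y: "y \<in> carrier (direct_sum K (\<lambda>_. Y))" for y
    proof -
      have yk: "y k \<in> carrier Y" if "k \<in> K" for k
        using y that Y by (auto simp: carrier_direct_sum[of K R "\<lambda>_. Y"])
      have fin: "finite {k\<in>K. y k \<noteq> \<zero>\<^bsub>Y\<^esub>}"
        using y Y by (simp add: carrier_direct_sum[of K R "\<lambda>_. Y"])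
      have "inc S (summation_map K Y y) = gfinprod (add_monoid (mid S)) (\<lambda>k. inc S (y k)) K"
        unfolding summation_map_def
        by (rule gfinprod_hom[OF YG MG mod_hom_hom[OF S.inc_hom]])
           (use yk fin in auto)
      also have "\<dots> = ?g (inc (direct_sum_ses K E) y)"
        using e yk by (intro comm_monoid.gfinprod_cong[OF MGM])
          (auto simp: simp_implies_def ses_hom_def intro!: mod_hom_closed[OF e_hom]
            exact_seq.inc_closed[OF exact_seq.intro[OF E]])
      finally show ?thesis ..
    qed
    moreover have "prj S (?g m) = prj (direct_sum_ses K E) m"
      if m: "m \<in> carrier (direct_sum K (\<lambda>k. mid (E k)))" for m
    proof -
      have mk: "m k \<in> carrier (mid (E k))" if "k \<in> K" for k
        using m that by (auto simp: carrier_direct_sum[of K R "\<lambda>k. mid (E k)", OF mE])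
      have "finite {k\<in>K. m k \<noteq> \<zero>\<^bsub>mid (E k)\<^esub>}"
        using m by (simp add: carrier_direct_sum[of K R "\<lambda>k. mid (E k)", OF mE])
      then have fin: "finite {k\<in>K. e k (m k) \<noteq> \<zero>\<^bsub>mid S\<^esub>}"
        by (rule rev_finite_subset) (auto simp: mod_hom_zero[OF mE M e_hom])
      let ?z = "prj (direct_sum_ses K E) m"
      have z: "?z \<in> carrier (direct_sum K A)"
        using exact_seq.prj_closed[OF exact_seq.intro[OF D]] m by simp
      have zk: "?z k \<in> carrier (A k)" if "k \<in> K" for k
        using z that by (auto simp: carrier_direct_sum[of K R A, OF A])
      have "prj S (?g m) = gfinprod (add_monoid (direct_sum K A)) (\<lambda>k. prj S (e k (m k))) K"
        by (rule gfinprod_hom[OF MG ZG mod_hom_hom[OF S.prj_hom]])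
           (use mk fin in \<open>auto intro: mod_hom_closed[OF e_hom]\<close>)
      also have "\<dots> = gfinprod (add_monoid (direct_sum K A)) (\<lambda>k. direct_sum_inj K A k (?z k)) K"
        using e mk zk by (intro comm_monoid.gfinprod_cong[OF ZGM])
          (auto simp: simp_implies_def ses_hom_def
            intro!: mod_hom_closed[OF direct_sum_inj_hom[of K R A, OF A]])
      also have "\<dots> = ?z" by (rule gsum_inj[OF A R z])
      finally show ?thesis .
    qed
    ultimately have "ses_hom R (direct_sum K (\<lambda>_. Y)) (summation_map K Y) ?g (\<lambda>x. x) (direct_sum_ses K E) S"
      by (simp add: ses_hom_def)
    then show "ses_equiv R Y ?U S" by (rule pushout_equivI[OF D S sum])
  qed
qed

lemma regular_module_simps [simp]:
  "carrier (regular_module R) = carrier R" "\<zero>\<^bsub>regular_module R\<^esub> = \<zero>\<^bsub>R\<^esub>"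
  "x \<oplus>\<^bsub>regular_module R\<^esub> y = x \<oplus>\<^bsub>R\<^esub> y" "r \<odot>\<^bsub>regular_module R\<^esub> x = r \<otimes>\<^bsub>R\<^esub> x"
  by (simp_all add: regular_module_def)

lemma left_module_regular: "ring R \<Longrightarrow> left_module R (regular_module R)"
proof -
  assume "ring R"
  then interpret R: ring R .
  have "abelian_group (regular_module R)"
    by (rule abelian_groupI) (auto simp: R.a_ac intro: bexI[of _ "\<ominus>\<^bsub>R\<^esub> _"] R.l_neg)
  then show ?thesis
    by (intro left_module.intro left_module_axioms.intro R.ring_axioms)
       (auto simp: R.l_distr R.r_distr R.m_assoc)
qed

lemma mod_hom_free_finite_support:
  fixes n :: nat
  assumes R: "ring R" and A: "\<And>k. k \<in> K \<Longrightarrow> left_module R (A k)"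
    and h: "h \<in> mod_hom R (direct_sum {..<n} (\<lambda>_. regular_module R)) (direct_sum K A)"
  shows "\<exists>F. finite F \<and> (\<forall>p\<in>carrier (direct_sum {..<n} (\<lambda>_. regular_module R)).
    \<forall>k\<in>K - F. h p k = \<zero>\<^bsub>A k\<^esub>)"
proof -
  interpret R: ring R by fact
  let ?P = "direct_sum {..<n} (\<lambda>_. regular_module R)"
  have P: "left_module R ?P" using R left_module_regular[OF R] by (rule left_module_direct_sum)
  have Z: "left_module R (direct_sum K A)" using R A by (rule left_module_direct_sum)
  have carP: "carrier ?P = (\<Pi>\<^sub>E j\<in>{..<n}. carrier R)"
    using carrier_direct_sum[of "{..<n}" R "\<lambda>_. regular_module R"] left_module_regular[OF R] by simp
  note car = carrier_direct_sum[of K R A, OF A]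
  define e where "e j = (\<lambda>i\<in>{..<n}. if i = j then \<one>\<^bsub>R\<^esub> else \<zero>\<^bsub>R\<^esub>)" for j
  have e: "e j \<in> carrier ?P" for j by (auto simp: carP e_def)
  define F where "F = (\<Union>j<n. {k\<in>K. h (e j) k \<noteq> \<zero>\<^bsub>A k\<^esub>})"
  have "finite {k\<in>K. h (e j) k \<noteq> \<zero>\<^bsub>A k\<^esub>}" for j
    using mod_hom_closed[OF h e[of j]] by (simp add: car)
  then have fin: "finite F" by (simp add: F_def)
  have "h p k = \<zero>\<^bsub>A k\<^esub>" if "m \<le> n" "p \<in> carrier ?P" "\<And>i. \<lbrakk>i < n; m \<le> i\<rbrakk> \<Longrightarrow> p i = \<zero>\<^bsub>R\<^esub>" "k \<in> K - F" for m p k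
    using that
  proof (induction m arbitrary: p)
    case 0
    then have "p = \<zero>\<^bsub>?P\<^esub>"
      by (intro extensionalityI[of _ "{..<n}"]) (auto simp: carP PiE_iff)
    then have "h p = \<zero>\<^bsub>direct_sum K A\<^esub>" using mod_hom_zero[OF P Z h] by (simp only:)
    then show ?case using \<open>k \<in> K - F\<close> by simp
  next
    case (Suc m)
    interpret Ak: left_module R "A k" using Suc.prems(4) by (intro A) simp
    define q where "q = (\<lambda>i\<in>{..<n}. if i = m then \<zero>\<^bsub>R\<^esub> else p i)"
    have p_in: "p i \<in> carrier R" if "i < n" for i
      using PiE_mem[OF Suc.prems(2)[unfolded carP], of i] that by simp
    have m: "m < n" using Suc.prems(1) by simp
    note pm = p_in[OF m]
    have q: "q \<in> carrier ?P" unfolding carP q_def using p_in by auto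
    have hq: "h q k = \<zero>\<^bsub>A k\<^esub>"
      using Suc.prems by (intro Suc.IH q) (auto simp: q_def)
    have hem: "h (e m) k = \<zero>\<^bsub>A k\<^esub>"
      using m Suc.prems(4) by (auto simp: F_def)
    have p: "p = q \<oplus>\<^bsub>?P\<^esub> p m \<odot>\<^bsub>?P\<^esub> e m"
    proof (rule extensionalityI[of _ "{..<n}"])
      fix i assume i: "i \<in> {..<n}"
      then have "p i \<in> carrier R" using p_in by simp
      then show "p i = (q \<oplus>\<^bsub>?P\<^esub> p m \<odot>\<^bsub>?P\<^esub> e m) i"
        using i pm by (simp add: q_def e_def)
    next
      show "p \<in> extensional {..<n}" using Suc.prems(2) unfolding carP PiE_iff by blast
    qed simp
    have "h p = h q \<oplus>\<^bsub>direct_sum K A\<^esub> p m \<odot>\<^bsub>direct_sum K A\<^esub> h (e m)"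
      using mod_hom_add[OF h q left_module.smult_closed[OF P pm e[of m]], folded p]
      unfolding mod_hom_smult[OF h pm e[of m]] .
    with hq hem show ?case
      using Suc.prems(4) pm left_module_smult_zero[OF Ak.left_module_axioms] by simp
  qed
  from this[of n] fin show ?thesis by (intro exI[of _ F]) auto
qed

lemma finitely_presented_hom_finite_support:
  assumes X: "finitely_presented R X" and A: "\<And>k. k \<in> K \<Longrightarrow> left_module R (A k)"
    and f: "f \<in> mod_hom R X (direct_sum K A)"
  shows "\<exists>F. finite F \<and> (\<forall>x\<in>carrier X. \<forall>k\<in>K - F. f x k = \<zero>\<^bsub>A k\<^esub>)"
proof -
  obtain n :: nat and g where g: "g \<in> mod_hom R (direct_sum {..<n} (\<lambda>_. regular_module R)) X"
    "g ` carrier (direct_sum {..<n} (\<lambda>_. regular_module R)) = carrier X"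
    using X unfolding finitely_presented_def by blast
  have "ring R" using X left_module_ring unfolding finitely_presented_def by blast
  from mod_hom_free_finite_support[OF this, of K A "\<lambda>p. f (g p)" n] A mod_hom_compose[OF g(1) f]
  obtain F where F: "finite F"
    "\<And>p k. \<lbrakk>p \<in> carrier (direct_sum {..<n} (\<lambda>_. regular_module R)); k \<in> K - F\<rbrakk> \<Longrightarrow> f (g p) k = \<zero>\<^bsub>A k\<^esub>"
    by blast
  have "f x k = \<zero>\<^bsub>A k\<^esub>" if "x \<in> carrier X" "k \<in> K - F" for x k
  proof -
    have "x \<in> g ` carrier (direct_sum {..<n} (\<lambda>_. regular_module R))" using that g(2) by simp
    then show ?thesis using F(2) that(2) by blast
  qed
  with F(1) show ?thesis by blast
qed

section \<open>Bases and the connecting homomorphism\<close>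

lemma End_ring_simps [simp]:
  "carrier (End_ring R X) = mod_hom R X X \<inter> extensional (carrier X)"
  "\<zero>\<^bsub>End_ring R X\<^esub> = (\<lambda>x\<in>carrier X. \<zero>\<^bsub>X\<^esub>)"
  by (simp_all add: End_ring_def Hom_group_def)

lemma connecting_hom_zero:
  assumes S: "short_exact R Y S Z" and X: "left_module R X"
  shows "connecting_hom R X Y S (\<lambda>x. \<zero>\<^bsub>Z\<^esub>) = \<zero>\<^bsub>Ext1 R X Y\<^esub>"
proof -
  have Z: "left_module R Z" and Y: "left_module R Y" using S by (simp_all add: short_exact_def)
  interpret Z: left_module R Z by fact
  interpret V: abelian_group "Ext1 R X Y" by (rule Ext1_abelian_group[OF X Y])
  let ?d = "connecting_hom R X Y S (\<lambda>x. \<zero>\<^bsub>Z\<^esub>)"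
  note z = mod_hom_zero_map[OF Z, of X]
  have d: "?d \<in> carrier (Ext1 R X Y)" by (rule connecting_hom_closed[OF S X z])
  have "?d \<oplus>\<^bsub>Ext1 R X Y\<^esub> ?d = ?d"
    using connecting_hom_add[OF S X z z] by simp
  also have "?d = ?d \<oplus>\<^bsub>Ext1 R X Y\<^esub> \<zero>\<^bsub>Ext1 R X Y\<^esub>" using d by simp
  finally show ?thesis using d by (simp del: V.r_zero)
qed

lemma connecting_hom_in_hom:
  assumes S: "short_exact R Y S Z" and X: "left_module R X"
  shows "connecting_hom R X Y S \<in> hom (Hom_group R X Z) (add_monoid (Ext1 R X Y))"
proof -
  have Z: "left_module R Z" using S by (simp add: short_exact_def)
  have "connecting_hom R X Y S (\<lambda>x\<in>carrier X. f x \<oplus>\<^bsub>Z\<^esub> g x)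
      = connecting_hom R X Y S f \<oplus>\<^bsub>Ext1 R X Y\<^esub> connecting_hom R X Y S g"
    if fg: "f \<in> mod_hom R X Z" "g \<in> mod_hom R X Z" for f g
    using connecting_hom_add[OF S X fg]
      connecting_hom_cong[OF S X mod_hom_plus[OF Z fg], of "\<lambda>x\<in>carrier X. f x \<oplus>\<^bsub>Z\<^esub> g x"] by simp
  then show ?thesis
    using connecting_hom_closed[OF S X] by (auto simp: hom_def Hom_group_def)
qed

lemma is_basis_cong:
  assumes V: "abelian_group V"
    and closed: "\<And>i c. \<lbrakk>i \<in> I; c \<in> carrier D\<rbrakk> \<Longrightarrow> c \<odot>\<^bsub>V\<^esub> b i \<in> carrier V"
    and eq: "\<And>i. i \<in> I \<Longrightarrow> b i = b' i"
  shows "is_basis D V I b \<longleftrightarrow> is_basis D V I b'"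
proof -
  interpret V: abelian_group V by fact
  have "finsum V (\<lambda>i. c i \<odot>\<^bsub>V\<^esub> b i) F = finsum V (\<lambda>i. c i \<odot>\<^bsub>V\<^esub> b' i) F"
    if "F \<subseteq> I" "c \<in> F \<rightarrow> carrier D" for c F
    using that eq closed by (intro V.finsum_cong') (auto simp flip: eq, metis eq subsetD Pi_mem)
  then show ?thesis
    unfolding is_basis_def using eq by (simp cong: conj_cong)
qed

text \<open>
  These maps exhaust the Hom group, which is thus a free left \<open>End X'\<close>-module on the inclusions of
  the copies \<open>(X', i)\<close>, by finite generation of \<open>X'\<close> and the orthogonality of the bricks.
\<close>

definition tuple_map ::
    "('r, 'x) module set \<Rightarrow> (('r, 'x) module \<Rightarrow> 'i set) \<Rightarrow> ('r, 'x) module \<Rightarrow> 'i set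
      \<Rightarrow> ('i \<Rightarrow> 'x \<Rightarrow> 'x) \<Rightarrow> 'x \<Rightarrow> ('r, 'x) module \<times> 'i \<Rightarrow> 'x" where
  "tuple_map \<X> I X' F c x =
    (\<lambda>k\<in>Sigma \<X> I. if fst k = X' \<and> snd k \<in> F then c (snd k) x else \<zero>\<^bsub>fst k\<^esub>)"

lemma tuple_map_hom:
  assumes lm: "\<And>X. X \<in> \<X> \<Longrightarrow> left_module R X" and X': "X' \<in> \<X>"
    and F: "finite F" "F \<subseteq> I X'" and c: "\<And>i. i \<in> F \<Longrightarrow> c i \<in> mod_hom R X' X'"
  shows "tuple_map \<X> I X' F c \<in> mod_hom R X' (copower_sum \<X> I)"
proof -
  have A: "left_module R (fst k)" if "k \<in> Sigma \<X> I" for k using that lm by auto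
  have z: "\<zero>\<^bsub>X\<^esub> \<in> carrier X" "\<zero>\<^bsub>X\<^esub> \<oplus>\<^bsub>X\<^esub> \<zero>\<^bsub>X\<^esub> = \<zero>\<^bsub>X\<^esub>" if "X \<in> \<X>" for X
    using left_module_abelian[OF lm[OF that]]
    by (simp_all add: abelian_group_def abelian_monoid.zero_closed abelian_monoid.l_zero)
  note c_simps = mod_hom_closed[OF c] mod_hom_add[OF c] mod_hom_smult[OF c]
  show ?thesis
    unfolding copower_sum_def
  proof (rule mod_homI)
    fix x assume x: "x \<in> carrier X'"
    have "finite {k \<in> Sigma \<X> I. tuple_map \<X> I X' F c x k \<noteq> \<zero>\<^bsub>fst k\<^esub>}"
      by (rule finite_subset[of _ "Pair X' ` F"]) (use F in \<open>auto simp: tuple_map_def split: if_splits\<close>)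
    then show "tuple_map \<X> I X' F c x \<in> carrier (direct_sum (Sigma \<X> I) fst)"
      using x z by (auto simp: carrier_direct_sum[of _ R, OF A] tuple_map_def c_simps)
    show "tuple_map \<X> I X' F c (r \<odot>\<^bsub>X'\<^esub> x) = r \<odot>\<^bsub>direct_sum (Sigma \<X> I) fst\<^esub> tuple_map \<X> I X' F c x"
      if "r \<in> carrier R" for r
      using that x by (auto simp: tuple_map_def c_simps left_module_smult_zero[OF lm] intro!: restrict_ext)
    show "tuple_map \<X> I X' F c (x \<oplus>\<^bsub>X'\<^esub> y)
        = tuple_map \<X> I X' F c x \<oplus>\<^bsub>direct_sum (Sigma \<X> I) fst\<^esub> tuple_map \<X> I X' F c y"
      if "y \<in> carrier X'" for y
      using that x by (auto simp: tuple_map_def c_simps z intro!: restrict_ext)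
  qed
qed

lemma connecting_hom_tuple_map:
  assumes lm: "\<And>X. X \<in> \<X> \<Longrightarrow> left_module R X" and X': "X' \<in> \<X>"
    and S: "short_exact R Y S (copower_sum \<X> I)"
    and F: "finite F" "F \<subseteq> I X'" and c: "\<And>i. i \<in> F \<Longrightarrow> c i \<in> mod_hom R X' X'"
  shows "connecting_hom R X' Y S (tuple_map \<X> I X' F c) =
    finsum (Ext1 R X' Y) (\<lambda>i. c i \<odot>\<^bsub>Ext1 R X' Y\<^esub>
      connecting_hom R X' Y S (direct_sum_inj (Sigma \<X> I) fst (X', i))) F"
  using F c
proof (induction F rule: finite_induct)
  case empty
  have X: "left_module R X'" and Y: "left_module R Y" using lm X' S by (auto simp: short_exact_def)
  interpret V: abelian_group "Ext1 R X' Y" by (rule Ext1_abelian_group[OF X Y])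
  have "tuple_map \<X> I X' {} c = (\<lambda>x. \<zero>\<^bsub>copower_sum \<X> I\<^esub>)"
    by (simp add: tuple_map_def copower_sum_def fun_eq_iff)
  then show ?case using connecting_hom_zero[OF S X] by simp
next
  case (insert i F)
  have X: "left_module R X'" and Y: "left_module R Y" using lm X' S by (auto simp: short_exact_def)
  interpret V: abelian_group "Ext1 R X' Y" by (rule Ext1_abelian_group[OF X Y])
  interpret X: left_module R X' by fact
  let ?Z = "copower_sum \<X> I"
  let ?inj = "\<lambda>i. direct_sum_inj (Sigma \<X> I) fst (X', i)"
  have inj: "?inj j \<in> mod_hom R X' ?Z" if "j \<in> insert i F" for j
    using direct_sum_inj_hom[of "Sigma \<X> I" R fst "(X', j)"] lm X' that insert.prems(1)
    by (auto simp: copower_sum_def)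
  have smult: "connecting_hom R X' Y S (\<lambda>x. ?inj j (c j x))
      = c j \<odot>\<^bsub>Ext1 R X' Y\<^esub> connecting_hom R X' Y S (?inj j)" if "j \<in> insert i F" for j
    using connecting_hom_smult[OF S X inj[OF that] insert.prems(2)[OF that]] .
  have closed: "c j \<odot>\<^bsub>Ext1 R X' Y\<^esub> connecting_hom R X' Y S (?inj j) \<in> carrier (Ext1 R X' Y)"
    if "j \<in> insert i F" for j
    using connecting_hom_closed[OF S X mod_hom_compose[OF insert.prems(2)[OF that] inj[OF that]]]
    by (simp add: smult[OF that])
  have tF: "tuple_map \<X> I X' F c \<in> mod_hom R X' ?Z"
    by (rule tuple_map_hom) (use lm X' insert in auto)
  have tiF: "tuple_map \<X> I X' (insert i F) c \<in> mod_hom R X' ?Z"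
    by (rule tuple_map_hom) (use lm X' insert in auto)
  have ci: "c i \<in> mod_hom R X' X'" using insert.prems by simp
  have zero: "\<zero>\<^bsub>X\<^esub> \<oplus>\<^bsub>X\<^esub> \<zero>\<^bsub>X\<^esub> = \<zero>\<^bsub>X\<^esub>" if "X \<in> \<X>" for X
    using left_module_abelian[OF lm[OF that]]
    by (simp_all add: abelian_group_def abelian_monoid.zero_closed abelian_monoid.l_zero)
  have "tuple_map \<X> I X' (insert i F) c x = tuple_map \<X> I X' F c x \<oplus>\<^bsub>?Z\<^esub> ?inj i (c i x)"
    if x: "x \<in> carrier X'" for x
  proof -
    have "c j x \<in> carrier X'" if "j \<in> insert i F" for j
      using mod_hom_closed[OF insert.prems(2)[OF that] x] .
    then show ?thesis
      using insert.hyps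
      by (auto simp: tuple_map_def copower_sum_def direct_sum_inj_def zero intro!: restrict_ext)
  qed
  from connecting_hom_cong[OF S X tiF this]
  have "connecting_hom R X' Y S (tuple_map \<X> I X' (insert i F) c)
      = connecting_hom R X' Y S (\<lambda>x. tuple_map \<X> I X' F c x \<oplus>\<^bsub>?Z\<^esub> ?inj i (c i x))" .
  also have "\<dots> = connecting_hom R X' Y S (tuple_map \<X> I X' F c)
      \<oplus>\<^bsub>Ext1 R X' Y\<^esub> c i \<odot>\<^bsub>Ext1 R X' Y\<^esub> connecting_hom R X' Y S (?inj i)"
    using connecting_hom_add[OF S X tF mod_hom_compose[OF ci inj]] smult[of i] by simp
  also have "connecting_hom R X' Y S (tuple_map \<X> I X' F c)
      = finsum (Ext1 R X' Y) (\<lambda>i. c i \<odot>\<^bsub>Ext1 R X' Y\<^esub> connecting_hom R X' Y S (?inj i)) F"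
    using insert.prems by (intro insert.IH) auto
  finally show ?case
    using insert.hyps closed by (simp add: V.a_comm V.finsum_closed)
qed

lemma tuple_map_decomposition:
  assumes semi: "semibrick R \<X>" and X': "X' \<in> \<X>" and f: "f \<in> mod_hom R X' (copower_sum \<X> I)"
  shows "\<exists>F c. finite F \<and> F \<subseteq> I X' \<and> c \<in> F \<rightarrow> carrier (End_ring R X') \<and>
    (\<forall>x\<in>carrier X'. f x = tuple_map \<X> I X' F c x)"
proof -
  have fp: "finitely_presented R X" if "X \<in> \<X>" for X
    using semi that by (auto simp: semibrick_def brick_def)
  then have lm: "left_module R X" if "X \<in> \<X>" for X
    using that by (auto simp: finitely_presented_def)
  have A: "left_module R (fst k)" if "k \<in> Sigma \<X> I" for k using that lm by auto
  have f': "f \<in> mod_hom R X' (direct_sum (Sigma \<X> I) fst)" using f by (simp add: copower_sum_def)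
  obtain G where G: "finite G" "\<And>x k. \<lbrakk>x \<in> carrier X'; k \<in> Sigma \<X> I - G\<rbrakk> \<Longrightarrow> f x k = \<zero>\<^bsub>fst k\<^esub>"
    using finitely_presented_hom_finite_support[OF fp[OF X'] A f'] by blast
  have comp: "(\<lambda>x. f x k) \<in> mod_hom R X' (fst k)" if "k \<in> Sigma \<X> I" for k
    using mod_hom_compose[OF f' direct_sum_proj_hom[OF A that]] by simp
  define F where "F = {i \<in> I X'. (X', i) \<in> G}"
  define c where "c i = (\<lambda>x\<in>carrier X'. f x (X', i))" for i
  have "F \<subseteq> Pair X' -` G" by (auto simp: F_def)
  then have "finite F"
    by (rule finite_subset) (rule finite_vimageI[OF G(1)], simp add: inj_on_def)
  moreover have "F \<subseteq> I X'" by (auto simp: F_def)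
  moreover have "c \<in> F \<rightarrow> carrier (End_ring R X')"
  proof
    fix i assume "i \<in> F"
    then have "(X', i) \<in> Sigma \<X> I" using X' by (simp add: F_def)
    from comp[OF this] show "c i \<in> carrier (End_ring R X')"
      using mod_hom_cong[OF lm[OF X'], of "\<lambda>x. f x (X', i)" "c i"] by (simp add: c_def)
  qed
  moreover have "f x = tuple_map \<X> I X' F c x" if x: "x \<in> carrier X'" for x
  proof (rule extensionalityI[of _ "Sigma \<X> I"])
    show "f x \<in> extensional (Sigma \<X> I)"
      using mod_hom_closed[OF f' x] by (simp add: carrier_direct_sum[of _ R, OF A] PiE_iff)
    show "tuple_map \<X> I X' F c x \<in> extensional (Sigma \<X> I)" by (simp add: tuple_map_def)
    fix k assume k: "k \<in> Sigma \<X> I"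
    then obtain X i where Xi: "k = (X, i)" "X \<in> \<X>" "i \<in> I X" by auto
    show "f x k = tuple_map \<X> I X' F c x k"
    proof (cases "X = X'")
      case True
      then show ?thesis using k Xi x G(2)[OF x, of k] by (auto simp: tuple_map_def F_def c_def)
    next
      case False
      then have "carrier (Hom_group R X' X) = {\<one>\<^bsub>Hom_group R X' X\<^esub>}"
        using bspec[OF bspec[OF conjunct2[OF semi[unfolded semibrick_def]] X'] Xi(2)] by simp
      moreover have "(\<lambda>x\<in>carrier X'. f x k) \<in> carrier (Hom_group R X' X)"
        using comp[OF k] mod_hom_cong[OF lm[OF X'], of "\<lambda>x. f x k" "\<lambda>x\<in>carrier X'. f x k" X] Xi(1)
        by (simp add: Hom_group_def)
      ultimately have "(\<lambda>x\<in>carrier X'. f x k) = (\<lambda>x\<in>carrier X'. \<zero>\<^bsub>X\<^esub>)"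
        by (simp add: Hom_group_def)
      from fun_cong[OF this, of x] x k Xi False show ?thesis by (simp add: tuple_map_def)
    qed
  qed
  ultimately show ?thesis by blast
qed

lemma is_basis_iff_connecting_hom_iso:
  assumes semi: "semibrick R \<X>" and X': "X' \<in> \<X>"
    and S: "short_exact R Y S (copower_sum \<X> I)"
  shows "is_basis (End_ring R X') (Ext1 R X' Y) (I X')
      (\<lambda>i. connecting_hom R X' Y S (direct_sum_inj (Sigma \<X> I) fst (X', i))) \<longleftrightarrow>
    connecting_hom R X' Y S \<in> iso (Hom_group R X' (copower_sum \<X> I)) (add_monoid (Ext1 R X' Y))"
    (is "is_basis ?D ?V _ ?b \<longleftrightarrow> ?d \<in> iso ?H _")
proof -
  let ?Z = "copower_sum \<X> I"
  let ?t = "tuple_map \<X> I X'"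
  have lm: "left_module R X" if "X \<in> \<X>" for X
    using semi that by (auto simp: semibrick_def brick_def finitely_presented_def)
  have X: "left_module R X'" and Y: "left_module R Y" and Z: "left_module R ?Z"
    using lm X' S by (auto simp: short_exact_def)
  interpret V: abelian_group ?V by (rule Ext1_abelian_group[OF X Y])
  interpret Z: left_module R ?Z by fact
  have H: "carrier ?H = mod_hom R X' ?Z \<inter> extensional (carrier X')"
    by (simp add: Hom_group_def)
  have restr: "restrict f (carrier X') \<in> carrier ?H" "?d (restrict f (carrier X')) = ?d f"
    if f: "f \<in> mod_hom R X' ?Z" for f
    using f mod_hom_cong[OF X, of "restrict f (carrier X')" f] connecting_hom_cong[OF S X f, of "restrict f (carrier X')"]
    by (auto simp: H)
  have t: "?t F c \<in> mod_hom R X' ?Z"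
      "?d (?t F c) = finsum ?V (\<lambda>i. c i \<odot>\<^bsub>?V\<^esub> ?b i) F"
    if F: "finite F" "F \<subseteq> I X'" and c: "c \<in> F \<rightarrow> carrier ?D" for F c
  proof -
    have "c i \<in> mod_hom R X' X'" if "i \<in> F" for i using c that by auto
    then show "?t F c \<in> mod_hom R X' ?Z"
        "?d (?t F c) = finsum ?V (\<lambda>i. c i \<odot>\<^bsub>?V\<^esub> ?b i) F"
      using F by (intro tuple_map_hom connecting_hom_tuple_map lm X' S; blast)+
  qed
  have dec: "\<exists>F c. finite F \<and> F \<subseteq> I X' \<and> c \<in> F \<rightarrow> carrier ?D \<and> (\<forall>x\<in>carrier X'. f x = ?t F c x) \<and>
      ?d f = finsum ?V (\<lambda>i. c i \<odot>\<^bsub>?V\<^esub> ?b i) F"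
    if f: "f \<in> mod_hom R X' ?Z" for f
  proof -
    obtain F c where Fc: "finite F" "F \<subseteq> I X'" "c \<in> F \<rightarrow> carrier ?D"
      "\<And>x. x \<in> carrier X' \<Longrightarrow> f x = ?t F c x"
      using tuple_map_decomposition[OF semi X' f] by blast
    have "?d f = ?d (?t F c)" by (rule connecting_hom_cong[OF S X f Fc(4)])
    then have "?d f = finsum ?V (\<lambda>i. c i \<odot>\<^bsub>?V\<^esub> ?b i) F" unfolding t(2)[OF Fc(1-3)] .
    with Fc show ?thesis by (intro exI[of _ F] exI[of _ c]) simp
  qed
  have t_zero: "(\<forall>x\<in>carrier X'. ?t F c x = \<zero>\<^bsub>?Z\<^esub>) \<longleftrightarrow> (\<forall>i\<in>F. c i = \<zero>\<^bsub>?D\<^esub>)"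
    if F: "F \<subseteq> I X'" and c: "c \<in> F \<rightarrow> carrier ?D" for F c
  proof
    assume *: "\<forall>x\<in>carrier X'. ?t F c x = \<zero>\<^bsub>?Z\<^esub>"
    show "\<forall>i\<in>F. c i = \<zero>\<^bsub>?D\<^esub>"
    proof
      fix i assume i: "i \<in> F"
      have "c i x = \<zero>\<^bsub>X'\<^esub>" if "x \<in> carrier X'" for x
        using fun_cong[OF bspec[OF * that], of "(X', i)"] X' F i
        by (auto simp: tuple_map_def copower_sum_def)
      moreover have "c i \<in> extensional (carrier X')" using c i by auto
      ultimately show "c i = \<zero>\<^bsub>?D\<^esub>"
        by (intro extensionalityI[of _ "carrier X'"]) auto
    qed
  qed (auto simp: tuple_map_def copower_sum_def intro!: restrict_ext)
  have zero_H: "(\<lambda>x. \<zero>\<^bsub>?Z\<^esub>) \<in> mod_hom R X' ?Z" by (rule mod_hom_zero_map[OF Z])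
  have b: "?b i \<in> carrier ?V" if "i \<in> I X'" for i
    using that X' lm direct_sum_inj_hom[of "Sigma \<X> I" R fst "(X', i)"]
    by (intro connecting_hom_closed[OF S X]) (auto simp: copower_sum_def)
  note hom = connecting_hom_in_hom[OF S X]
  show ?thesis
  proof
    assume basis: "is_basis ?D ?V (I X') ?b"
    then have indep: "\<forall>F c. finite F \<longrightarrow> F \<subseteq> I X' \<longrightarrow> c \<in> F \<rightarrow> carrier ?D \<longrightarrow>
        finsum ?V (\<lambda>i. c i \<odot>\<^bsub>?V\<^esub> ?b i) F = \<zero>\<^bsub>?V\<^esub> \<longrightarrow> (\<forall>i\<in>F. c i = \<zero>\<^bsub>?D\<^esub>)"
      and span: "\<forall>v\<in>carrier ?V. \<exists>F c. finite F \<and> F \<subseteq> I X' \<and> c \<in> F \<rightarrow> carrier ?D \<and>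
        v = finsum ?V (\<lambda>i. c i \<odot>\<^bsub>?V\<^esub> ?b i) F"
      unfolding is_basis_def by (rule conjunct2[THEN conjunct1], rule conjunct2[THEN conjunct2])
    have kernel: "f x = \<zero>\<^bsub>?Z\<^esub>"
      if f: "f \<in> mod_hom R X' ?Z" "?d f = \<zero>\<^bsub>?V\<^esub>" and x: "x \<in> carrier X'" for f x
    proof -
      obtain F c where Fc: "finite F" "F \<subseteq> I X'" "c \<in> F \<rightarrow> carrier ?D"
        "\<And>x. x \<in> carrier X' \<Longrightarrow> f x = ?t F c x" "?d f = finsum ?V (\<lambda>i. c i \<odot>\<^bsub>?V\<^esub> ?b i) F"
        using dec[OF f(1)] by blast
      have "\<forall>i\<in>F. c i = \<zero>\<^bsub>?D\<^esub>"
        using indep[rule_format, OF Fc(1-3) trans[OF Fc(5)[symmetric] f(2)]] by blast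
      with t_zero[OF Fc(2,3)] Fc(4) x show ?thesis by simp
    qed
    have "inj_on ?d (carrier ?H)"
    proof (rule inj_onI)
      fix f g assume fg: "f \<in> carrier ?H" "g \<in> carrier ?H" "?d f = ?d g"
      then have f: "f \<in> mod_hom R X' ?Z" and g: "g \<in> mod_hom R X' ?Z" by (auto simp: H)
      let ?e = "\<lambda>x. f x \<oplus>\<^bsub>?Z\<^esub> \<ominus>\<^bsub>?Z\<^esub> g x"
      have e: "?e \<in> mod_hom R X' ?Z" by (rule mod_hom_plus[OF Z f mod_hom_uminus[OF Z g]])
      have eg: "?e x \<oplus>\<^bsub>?Z\<^esub> g x = f x" if "x \<in> carrier X'" for x
        using mod_hom_closed[OF f that] mod_hom_closed[OF g that] by (simp add: Z.M.a_assoc Z.M.l_neg)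
      have "?d f = ?d ?e \<oplus>\<^bsub>?V\<^esub> ?d g"
        using connecting_hom_cong[OF S X mod_hom_plus[OF Z e g], of f] eg connecting_hom_add[OF S X e g]
        by simp
      then have "?d ?e \<oplus>\<^bsub>?V\<^esub> ?d g = \<zero>\<^bsub>?V\<^esub> \<oplus>\<^bsub>?V\<^esub> ?d g"
        using fg(3) connecting_hom_closed[OF S X g] by simp
      then have "?d ?e = \<zero>\<^bsub>?V\<^esub>"
        using connecting_hom_closed[OF S X g] connecting_hom_closed[OF S X e] V.add.right_cancel by simp
      from kernel[OF e this] have "f x = g x" if "x \<in> carrier X'" for x
        using eg[OF that] that mod_hom_closed[OF g that] by simp
      then show "f = g" using fg by (intro extensionalityI[of _ "carrier X'"]) (auto simp: H)
    qed
    moreover have "v \<in> ?d ` carrier ?H" if v: "v \<in> carrier ?V" for v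
    proof -
      obtain F c where Fc: "finite F" "F \<subseteq> I X'" "c \<in> F \<rightarrow> carrier ?D"
        "v = finsum ?V (\<lambda>i. c i \<odot>\<^bsub>?V\<^esub> ?b i) F"
        using bspec[OF span v] by blast
      then have "v = ?d (restrict (?t F c) (carrier X'))"
        using t[OF Fc(1-3)] restr(2) by simp
      then show ?thesis using restr(1)[OF t(1)[OF Fc(1-3)]] by (rule image_eqI)
    qed
    ultimately show "?d \<in> iso ?H (add_monoid ?V)"
      using hom by (auto simp: iso_def bij_betw_def hom_def)
  next
    assume iso: "?d \<in> iso ?H (add_monoid ?V)"
    then have inj: "inj_on ?d (carrier ?H)" and surj: "?d ` carrier ?H = carrier ?V"
      by (auto simp: iso_def bij_betw_def)
    show "is_basis ?D ?V (I X') ?b"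
      unfolding is_basis_def
    proof (intro conjI ballI allI impI)
      fix F c i assume F: "finite F" "F \<subseteq> I X'" and c: "c \<in> F \<rightarrow> carrier ?D"
        and zero: "finsum ?V (\<lambda>i. c i \<odot>\<^bsub>?V\<^esub> ?b i) F = \<zero>\<^bsub>?V\<^esub>" and i: "i \<in> F"
      note t' = t[OF F c]
      have "?d (restrict (?t F c) (carrier X')) = ?d (\<lambda>x\<in>carrier X'. \<zero>\<^bsub>?Z\<^esub>)"
        using t'(2) zero restr(2)[OF t'(1)] restr(2)[OF zero_H] connecting_hom_zero[OF S X] by simp
      then have eq: "restrict (?t F c) (carrier X') = (\<lambda>x\<in>carrier X'. \<zero>\<^bsub>?Z\<^esub>)"
        using inj restr(1)[OF t'(1)] restr(1)[OF zero_H] by (auto dest: inj_onD)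
      have "?t F c x = \<zero>\<^bsub>?Z\<^esub>" if "x \<in> carrier X'" for x
        using fun_cong[OF eq, of x] that by simp
      then show "c i = \<zero>\<^bsub>?D\<^esub>" using t_zero[OF F(2) c] i by blast
    next
      fix v assume "v \<in> carrier ?V"
      then obtain f where f: "f \<in> carrier ?H" "v = ?d f" using surj by blast
      then have "f \<in> mod_hom R X' ?Z" by (simp add: H)
      from dec[OF this] f(2)
      show "\<exists>F c. finite F \<and> F \<subseteq> I X' \<and> c \<in> F \<rightarrow> carrier ?D \<and> v = finsum ?V (\<lambda>i. c i \<odot>\<^bsub>?V\<^esub> ?b i) F"
        by blast
    qed (rule b)
  qed
qed

theorem lemma4p2:
  fixes R :: "('r, 'e) ring_scheme"
    and \<X> :: "('r, 'x) module set"
    and Y :: "('r, 'y) module"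
    and I :: "('r, 'x) module \<Rightarrow> 'i set"
    and M :: "('r, 'm) module"
    and \<alpha> :: "'y \<Rightarrow> 'm"
    and \<beta> :: "'m \<Rightarrow> (('r, 'x) module \<times> 'i \<Rightarrow> 'x)"
  assumes "ring R"
    and "semibrick R \<X>"
    and "left_module R Y"
    and "short_exact R Y \<lparr>inc = \<alpha>, mid = M, prj = \<beta>\<rparr> (copower_sum \<X> I)"
  shows "is_universal R \<X> Y I \<lparr>inc = \<alpha>, mid = M, prj = \<beta>\<rparr> \<longleftrightarrow>
    (\<forall>X'\<in>\<X>. connecting_hom R X' Y \<lparr>inc = \<alpha>, mid = M, prj = \<beta>\<rparr>
       \<in> iso (Hom_group R X' (copower_sum \<X> I)) (add_monoid (Ext1 R X' Y)))"
proof -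
  let ?S = "\<lparr>inc = \<alpha>, mid = M, prj = \<beta>\<rparr>" and ?K = "Sigma \<X> I"
  let ?b = "\<lambda>X i. connecting_hom R X Y ?S (direct_sum_inj ?K fst (X, i))"
  note S = assms(4)
  have lm: "left_module R X" if "X \<in> \<X>" for X
    using assms(2) that by (auto simp: semibrick_def brick_def finitely_presented_def)
  have inj: "direct_sum_inj ?K fst (X, i) \<in> mod_hom R X (copower_sum \<X> I)" if "X \<in> \<X>" "i \<in> I X" for X i
    using that lm direct_sum_inj_hom[of ?K R fst "(X, i)"] by (auto simp: copower_sum_def)
  have equiv_iff: "ses_equiv R Y (universal_ses \<X> Y I E) ?S \<longleftrightarrow>
      (\<forall>X\<in>\<X>. \<forall>i\<in>I X. ext_class R X Y (E X i) = ?b X i)"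
    if E: "\<And>X i. \<lbrakk>X \<in> \<X>; i \<in> I X\<rbrakk> \<Longrightarrow> short_exact R Y (E X i) X"
    for E :: "('r, 'x) module \<Rightarrow> 'i \<Rightarrow> ('r, 'y, 'y \<times> 'x, 'x) ses"
  proof -
    have "ses_equiv R Y (universal_ses \<X> Y I E) ?S \<longleftrightarrow>
        (\<forall>k\<in>?K. \<exists>h. ses_hom R Y (\<lambda>y. y) h (direct_sum_inj ?K fst k) (case k of (X, i) \<Rightarrow> E X i) ?S)"
      unfolding universal_ses_def
      by (rule pushout_direct_sum_equiv_iff) (use S E in \<open>auto simp: copower_sum_def\<close>)
    also have "\<dots> \<longleftrightarrow> (\<forall>X\<in>\<X>. \<forall>i\<in>I X. \<exists>h. ses_hom R Y (\<lambda>y. y) h (direct_sum_inj ?K fst (X, i)) (E X i) ?S)"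
      by auto
    also have "\<dots> \<longleftrightarrow> (\<forall>X\<in>\<X>. \<forall>i\<in>I X. ext_class R X Y (E X i) = ?b X i)"
      by (intro ball_cong refl ext_class_eq_connecting_hom_iff[OF E S inj, symmetric])
    finally show ?thesis .
  qed
  have basis_cong: "is_basis (End_ring R X) (Ext1 R X Y) (I X) b' \<longleftrightarrow>
      is_basis (End_ring R X) (Ext1 R X Y) (I X) (?b X)"
    if X: "X \<in> \<X>" and eq: "\<And>i. i \<in> I X \<Longrightarrow> b' i = ?b X i" for X b'
  proof (rule is_basis_cong[OF Ext1_abelian_group[OF lm[OF X] assms(3)] _ eq])
    fix i c assume i: "i \<in> I X" and c: "c \<in> carrier (End_ring R X)"
    then have c': "c \<in> mod_hom R X X" by simp
    show "c \<odot>\<^bsub>Ext1 R X Y\<^esub> b' i \<in> carrier (Ext1 R X Y)"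
      using connecting_hom_closed[OF S lm[OF X] mod_hom_compose[OF c' inj[OF X i]]]
        connecting_hom_smult[OF S lm[OF X] inj[OF X i] c'] eq[OF i] by simp
  qed
  have "is_universal R \<X> Y I ?S \<longleftrightarrow>
      (\<forall>X\<in>\<X>. is_basis (End_ring R X) (Ext1 R X Y) (I X) (?b X))"
  proof
    assume "is_universal R \<X> Y I ?S"
    then obtain E where E: "\<And>X i. \<lbrakk>X \<in> \<X>; i \<in> I X\<rbrakk> \<Longrightarrow> short_exact R Y (E X i) X"
      "\<And>X. X \<in> \<X> \<Longrightarrow> is_basis (End_ring R X) (Ext1 R X Y) (I X) (\<lambda>i. ext_class R X Y (E X i))"
      "ses_equiv R Y (universal_ses \<X> Y I E) ?S"
      unfolding is_universal_def by blast
    have "\<forall>X\<in>\<X>. \<forall>i\<in>I X. ext_class R X Y (E X i) = ?b X i"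
      using equiv_iff[of E] E(1,3) by blast
    then show "\<forall>X\<in>\<X>. is_basis (End_ring R X) (Ext1 R X Y) (I X) (?b X)"
      using basis_cong[THEN iffD1, OF _ _ E(2)] by blast
  next
    assume basis: "\<forall>X\<in>\<X>. is_basis (End_ring R X) (Ext1 R X Y) (I X) (?b X)"
    have "\<exists>T :: ('r, 'y, 'y \<times> 'x, 'x) ses. short_exact R Y T X \<and> ext_class R X Y T = ?b X i"
      if "X \<in> \<X>" "i \<in> I X" for X i
    proof -
      have "?b X i \<in> carrier (Ext1 R X Y)"
        by (rule connecting_hom_closed[OF S lm[OF that(1)] inj[OF that]])
      then show ?thesis unfolding carrier_Ext1 by auto
    qed
    then obtain E :: "('r, 'x) module \<Rightarrow> 'i \<Rightarrow> ('r, 'y, 'y \<times> 'x, 'x) ses"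
      where E: "\<And>X i. \<lbrakk>X \<in> \<X>; i \<in> I X\<rbrakk> \<Longrightarrow> short_exact R Y (E X i) X \<and> ext_class R X Y (E X i) = ?b X i"
      by metis
    show "is_universal R \<X> Y I ?S"
      unfolding is_universal_def
    proof (intro exI[of _ E] conjI ballI)
      show "ses_equiv R Y (universal_ses \<X> Y I E) ?S"
        using equiv_iff[of E] E by blast
      show "is_basis (End_ring R X) (Ext1 R X Y) (I X) (\<lambda>i. ext_class R X Y (E X i))" if "X \<in> \<X>" for X
        using basis_cong[of X "\<lambda>i. ext_class R X Y (E X i)"] basis E that by blast
    qed (use E in blast)
  qed
  also have "\<dots> \<longleftrightarrow> (\<forall>X'\<in>\<X>. connecting_hom R X' Y ?S
      \<in> iso (Hom_group R X' (copower_sum \<X> I)) (add_monoid (Ext1 R X' Y)))"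
    by (intro ball_cong refl is_basis_iff_connecting_hom_iso[OF assms(2) _ S])
  finally show ?thesis .
qed

end
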